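(* Let $Q=(V,E)$ be a monoidal quiver, and let $(\mathcal{M},\otimes)$ with the morphism $\tau\colon Q\to U\mathcal{M}$ be the category constructed from $Q$ in the context. Then $\mathcal{M}$ is the free linear monoidal category over $Q$: $(\mathcal{M},\otimes)$ is a strict linear monoidal category, and for every linear monoidal category $\mathcal{D}$ and every morphism of monoidal quivers $\phi\colon Q\to U\mathcal{D}$ there exists a unique linear monoidal functor $\phi'\colon\mathcal{M}\to\mathcal{D}$ such that $U\phi'\circ\tau=\phi$.
   Context: $\Bbbk$ is a fixed commutative ground ring; linear means $\Bbbk$-linear, categories are small, monoidal categories are strict. A quiver $Q=(V,E)$ is a set $V$ of vertices and a set $E$ of edges with start and end maps $\partial_0,\partial_1\colon E\to V$; write $e\colon a\to b$ if $\partial_0e=a$, $\partial_1e=b$. A monoidal quiver is a quiver whose vertex set is a monoid (product written as concatenation, identity $\mathbb{1}$). A morphism of monoidal quivers is a pair of maps on vertices and edges compatible with $\partial_0,\partial_1$ such that the map on vertices is a monoid morphism. A linear category is a category whose hom-sets are $\Bbbk$-modules and whose composition is bilinear. A (strict) linear monoidal category is a linear category with a bilinear bifunctor $\otimes$ which is strictly associative on objects and morphisms and has a strict unit object $\mathbb{1}$. A linear monoidal functor is a linear functor strictly preserving $\otimes$ (on objects and morphisms) and $\mathbb{1}$. For a linear monoidal category $\mathcal{D}$, $U\mathcal{D}$ is its underlying monoidal quiver (vertices: objects; edges: all morphisms), and $U$ is also applied to functors. The free linear category $\mathscr{L}Q$ over a quiver $Q=(V,E)$ has object set $V$, and $\mathscr{L}Q(a,b)$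 is the free $\Bbbk$-module on paths from $a$ to $b$ (formal finite compositions of composable edges, including trivial paths $1_v$), with composition extended bilinearly. An ideal of a linear category is a family of submodules of its hom-modules closed under composition on either side with arbitrary morphisms; $\langle S\rangle$ is the smallest ideal containing $S$; the quotient category has the same objects and the quotient modules as hom-modules, the class of $f$ being $[f]$. Construction of $\mathcal{M}$. Let $Q=(V,E)$ be a monoidal quiver. Let $\bar Q=(V,\bar E)$, where $\bar E$ is the set of triples $(v,e,w)$ with $v,w\in V$, $e\in E$, and for $e\colon x\to y$ the triple $(v,e,w)$ is an edge $vxw\to vyw$. Let $\mathcal{M}'=\mathscr{L}\bar Q$. Define an operation $\otimes$ on $\mathcal{M}'$ by: $a\otimes b=ab$ on objects and $1_a\otimes1_b=1_{ab}$; $1_a\otimes(v,e,w)=(av,e,w)$ and $(v,e,w)\otimes1_a=(v,e,wa)$; for a path $f=\alpha_1\circ\dots\circ\alpha_n$ of edges, $1_a\otimes f=(1_a\otimes\alpha_1)\circ\dots\circ(1_a\otimes\alpha_n)$ and $f\otimes1_a=(\alpha_1\otimes1_a)\circ\dots\circ(\alpha_n\otimes1_a)$; for paths $f\colon a\to b$, $g\colon c\to d$, $f\otimes g=(f\otimes1_d)\circ(1_a\otimes g)$; extended bilinearly to all morphisms. Let $C$ be the set of all morphisms $$(v,e,wv'y'w')\circ(vxwv',e',w')-(vywv',e',w')\circ(v,e,wv'x'w')$$ with $v,w,v',w'\in V$ and $e\colon x\to y$, $e'\colon x'\to y'$ in $E$. Let $\mathcal{M}=\mathcal{M}'/\langle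 C\rangle$, with the operation $\otimes$ induced from $\mathcal{M}'$ (namely $[f]\otimes[g]=[f\otimes g]$), and let $\tau\colon Q\to U\mathcal{M}$ be the identity on vertices and $\tau(e)=[(\mathbb{1},e,\mathbb{1})]$ on edges. *)

theory Defs
  imports "Graph_Theory.Arc_Walk" "HOL-Algebra.QuotRing" "HOL-Algebra.Module"
begin

section \<open>Monoidal quivers\<close>

text \<open>
  A quiver is a \<^locale>\<open>wf_digraph\<close> (loops and parallel arcs are allowed there, and nothing is
  assumed finite), with \<open>tail\<close> and \<open>head\<close> in the role of the start and end maps.  The vertices of
  a monoidal quiver are the carrier of a monoid.
\<close>

record ('v, 'e) mon_quiver =
  quiver :: "('v, 'e) pre_digraph"
  vmonoid :: "'v monoid"

locale mon_quiver = wf_digraph "quiver Q" + monoid "vmonoid Q" for Q :: "('v, 'e) mon_quiver" +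
  assumes carrier_vmonoid: "carrier (vmonoid Q) = verts (quiver Q)"

record ('v, 'e, 'w, 'f) quiver_mor =
  on_verts :: "'v \<Rightarrow> 'w"
  on_arcs :: "'e \<Rightarrow> 'f"

definition mon_quiver_morphism ::
    "('v, 'e) mon_quiver \<Rightarrow> ('w, 'f) mon_quiver \<Rightarrow> ('v, 'e, 'w, 'f) quiver_mor \<Rightarrow> bool" where
  "mon_quiver_morphism Q Q' \<phi> \<longleftrightarrow>
     on_verts \<phi> \<in> hom (vmonoid Q) (vmonoid Q') \<and>
     on_verts \<phi> \<one>\<^bsub>vmonoid Q\<^esub> = \<one>\<^bsub>vmonoid Q'\<^esub> \<and>
     (\<forall>e\<in>arcs (quiver Q). on_arcs \<phi> e \<in> arcs (quiver Q') \<and>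
        tail (quiver Q') (on_arcs \<phi> e) = on_verts \<phi> (tail (quiver Q) e) \<and>
        head (quiver Q') (on_arcs \<phi> e) = on_verts \<phi> (head (quiver Q) e))"

definition quiver_mor_comp ::
    "('w, 'f, 'x, 'g) quiver_mor \<Rightarrow> ('v, 'e, 'w, 'f) quiver_mor \<Rightarrow> ('v, 'e, 'x, 'g) quiver_mor" where
  "quiver_mor_comp \<psi> \<phi> =
     \<lparr>on_verts = on_verts \<psi> \<circ> on_verts \<phi>, on_arcs = on_arcs \<psi> \<circ> on_arcs \<phi>\<rparr>"

text \<open>Equality of morphisms with source \<open>Q\<close>; values outside of \<open>Q\<close> are irrelevant.\<close>

definition quiver_mor_eq ::
    "('v, 'e) mon_quiver \<Rightarrow> ('v, 'e, 'w, 'f) quiver_mor \<Rightarrow> ('v, 'e, 'w, 'f) quiver_mor \<Rightarrow> bool" where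
  "quiver_mor_eq Q \<phi> \<psi> \<longleftrightarrow>
     (\<forall>v\<in>verts (quiver Q). on_verts \<phi> v = on_verts \<psi> v) \<and>
     (\<forall>e\<in>arcs (quiver Q). on_arcs \<phi> e = on_arcs \<psi> e)"


section \<open>Linear categories and linear monoidal categories\<close>

definition linear_maps ::
    "('k, 'r) ring_scheme \<Rightarrow> ('k, 'm) module \<Rightarrow> ('k, 'n) module \<Rightarrow> ('m \<Rightarrow> 'n) set" where
  "linear_maps R M N = {h \<in> hom (add_monoid M) (add_monoid N).
     \<forall>r\<in>carrier R. \<forall>x\<in>carrier M. h (r \<odot>\<^bsub>M\<^esub> x) = r \<odot>\<^bsub>N\<^esub> h x}"

definition bilinear_map ::
    "('k, 'r) ring_scheme \<Rightarrow> ('k, 'm) module \<Rightarrow> ('k, 'n) module \<Rightarrow> ('k, 'p) module \<Rightarrow>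
     ('m \<Rightarrow> 'n \<Rightarrow> 'p) \<Rightarrow> bool" where
  "bilinear_map R M N P h \<longleftrightarrow>
     (\<forall>x\<in>carrier M. h x \<in> linear_maps R N P) \<and>
     (\<forall>y\<in>carrier N. (\<lambda>x. h x y) \<in> linear_maps R M P)"

text \<open>
  Hom-modules are indexed by pairs of objects and need not be disjoint, so operations on morphisms
  carry the objects involved: \<open>cmp C a b c g f\<close> is the composite of \<open>f : a \<rightarrow> b\<close> and \<open>g : b \<rightarrow> c\<close>,
  and \<open>mtens C a b c d f g\<close> is the tensor product of \<open>f : a \<rightarrow> b\<close> and \<open>g : c \<rightarrow> d\<close>.
\<close>

record ('k, 'o, 'm) lincat =
  obj :: "'o set"
  Hom :: "'o \<Rightarrow> 'o \<Rightarrow> ('k, 'm) module"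
  cmp :: "'o \<Rightarrow> 'o \<Rightarrow> 'o \<Rightarrow> 'm \<Rightarrow> 'm \<Rightarrow> 'm"
  ident :: "'o \<Rightarrow> 'm"

record ('k, 'o, 'm) linmoncat = "('k, 'o, 'm) lincat" +
  otens :: "'o \<Rightarrow> 'o \<Rightarrow> 'o"
  mtens :: "'o \<Rightarrow> 'o \<Rightarrow> 'o \<Rightarrow> 'o \<Rightarrow> 'm \<Rightarrow> 'm \<Rightarrow> 'm"
  tunit :: "'o"

abbreviation mor :: "('k, 'o, 'm, 'z) lincat_scheme \<Rightarrow> 'o \<Rightarrow> 'o \<Rightarrow> 'm set" where
  "mor C a b \<equiv> carrier (Hom C a b)"

definition obj_monoid :: "('k, 'o, 'm) linmoncat \<Rightarrow> 'o monoid" where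
  "obj_monoid C = \<lparr>carrier = obj C, mult = otens C, one = tunit C\<rparr>"

locale linear_category = cring R
  for R :: "('k, 'r) ring_scheme" and C :: "('k, 'o, 'm, 'z) lincat_scheme" +
  assumes Hom_module: "\<lbrakk>a \<in> obj C; b \<in> obj C\<rbrakk> \<Longrightarrow> module R (Hom C a b)"
    and ident_closed: "a \<in> obj C \<Longrightarrow> ident C a \<in> mor C a a"
    and cmp_bilinear: "\<lbrakk>a \<in> obj C; b \<in> obj C; c \<in> obj C\<rbrakk> \<Longrightarrow>
      bilinear_map R (Hom C b c) (Hom C a b) (Hom C a c) (cmp C a b c)"
    and cmp_assoc: "\<lbrakk>a \<in> obj C; b \<in> obj C; c \<in> obj C; d \<in> obj C;
        f \<in> mor C a b; g \<in> mor C b c; h \<in> mor C c d\<rbrakk> \<Longrightarrow>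
      cmp C a b d (cmp C b c d h g) f = cmp C a c d h (cmp C a b c g f)"
    and cmp_ident_left: "\<lbrakk>a \<in> obj C; b \<in> obj C; f \<in> mor C a b\<rbrakk> \<Longrightarrow>
      cmp C a b b (ident C b) f = f"
    and cmp_ident_right: "\<lbrakk>a \<in> obj C; b \<in> obj C; f \<in> mor C a b\<rbrakk> \<Longrightarrow>
      cmp C a a b f (ident C a) = f"

locale linear_monoidal_category = linear_category R C + obj: monoid "obj_monoid C"
  for R :: "('k, 'r) ring_scheme" and C :: "('k, 'o, 'm) linmoncat" +
  assumes mtens_bilinear: "\<lbrakk>a \<in> obj C; b \<in> obj C; c \<in> obj C; d \<in> obj C\<rbrakk> \<Longrightarrow>
      bilinear_map R (Hom C a b) (Hom C c d) (Hom C (otens C a c) (otens C b d)) (mtens C a b c d)"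
    and mtens_ident: "\<lbrakk>a \<in> obj C; b \<in> obj C\<rbrakk> \<Longrightarrow>
      mtens C a a b b (ident C a) (ident C b) = ident C (otens C a b)"
    and mtens_cmp: "\<lbrakk>a \<in> obj C; b \<in> obj C; c \<in> obj C; a' \<in> obj C; b' \<in> obj C; c' \<in> obj C;
        f \<in> mor C a b; g \<in> mor C b c; f' \<in> mor C a' b'; g' \<in> mor C b' c'\<rbrakk> \<Longrightarrow>
      mtens C a c a' c' (cmp C a b c g f) (cmp C a' b' c' g' f') =
      cmp C (otens C a a') (otens C b b') (otens C c c')
        (mtens C b c b' c' g g') (mtens C a b a' b' f f')"
    and mtens_assoc: "\<lbrakk>a \<in> obj C; b \<in> obj C; c \<in> obj C; a' \<in> obj C; b' \<in> obj C; c' \<in> obj C;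
        f \<in> mor C a a'; g \<in> mor C b b'; h \<in> mor C c c'\<rbrakk> \<Longrightarrow>
      mtens C (otens C a b) (otens C a' b') c c' (mtens C a a' b b' f g) h =
      mtens C a a' (otens C b c) (otens C b' c') f (mtens C b b' c c' g h)"
    and mtens_unit_left: "\<lbrakk>a \<in> obj C; b \<in> obj C; f \<in> mor C a b\<rbrakk> \<Longrightarrow>
      mtens C (tunit C) (tunit C) a b (ident C (tunit C)) f = f"
    and mtens_unit_right: "\<lbrakk>a \<in> obj C; b \<in> obj C; f \<in> mor C a b\<rbrakk> \<Longrightarrow>
      mtens C a b (tunit C) (tunit C) f (ident C (tunit C)) = f"

record ('o, 'm, 'p, 'n) cat_functor =
  on_obj :: "'o \<Rightarrow> 'p"
  on_mor :: "'o \<Rightarrow> 'o \<Rightarrow> 'm \<Rightarrow> 'n"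

definition linear_functor ::
    "('k, 'r) ring_scheme \<Rightarrow> ('k, 'o, 'm, 'y) lincat_scheme \<Rightarrow> ('k, 'p, 'n, 'z) lincat_scheme \<Rightarrow>
     ('o, 'm, 'p, 'n) cat_functor \<Rightarrow> bool" where
  "linear_functor R C D F \<longleftrightarrow>
     on_obj F \<in> obj C \<rightarrow> obj D \<and>
     (\<forall>a\<in>obj C. \<forall>b\<in>obj C.
        on_mor F a b \<in> linear_maps R (Hom C a b) (Hom D (on_obj F a) (on_obj F b))) \<and>
     (\<forall>a\<in>obj C. on_mor F a a (ident C a) = ident D (on_obj F a)) \<and>
     (\<forall>a\<in>obj C. \<forall>b\<in>obj C. \<forall>c\<in>obj C. \<forall>f\<in>mor C a b. \<forall>g\<in>mor C b c.
        on_mor F a c (cmp C a b c g f) =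
        cmp D (on_obj F a) (on_obj F b) (on_obj F c) (on_mor F b c g) (on_mor F a b f))"

definition linear_monoidal_functor ::
    "('k, 'r) ring_scheme \<Rightarrow> ('k, 'o, 'm) linmoncat \<Rightarrow> ('k, 'p, 'n) linmoncat \<Rightarrow>
     ('o, 'm, 'p, 'n) cat_functor \<Rightarrow> bool" where
  "linear_monoidal_functor R C D F \<longleftrightarrow>
     linear_functor R C D F \<and>
     on_obj F (tunit C) = tunit D \<and>
     (\<forall>a\<in>obj C. \<forall>b\<in>obj C. on_obj F (otens C a b) = otens D (on_obj F a) (on_obj F b)) \<and>
     (\<forall>a\<in>obj C. \<forall>b\<in>obj C. \<forall>c\<in>obj C. \<forall>d\<in>obj C. \<forall>f\<in>mor C a b. \<forall>g\<in>mor C c d.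
        on_mor F (otens C a c) (otens C b d) (mtens C a b c d f g) =
        mtens D (on_obj F a) (on_obj F b) (on_obj F c) (on_obj F d)
          (on_mor F a b f) (on_mor F c d g))"

text \<open>Equality of functors with source \<open>C\<close>; values outside of \<open>C\<close> are irrelevant.\<close>

definition functor_eq ::
    "('k, 'o, 'm, 'z) lincat_scheme \<Rightarrow> ('o, 'm, 'p, 'n) cat_functor \<Rightarrow>
     ('o, 'm, 'p, 'n) cat_functor \<Rightarrow> bool" where
  "functor_eq C F G \<longleftrightarrow>
     (\<forall>a\<in>obj C. on_obj F a = on_obj G a) \<and>
     (\<forall>a\<in>obj C. \<forall>b\<in>obj C. \<forall>f\<in>mor C a b. on_mor F a b f = on_mor G a b f)"

text \<open>The edges of \<open>U D\<close> are all morphisms, tagged with source and target.\<close>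

definition U_cat :: "('k, 'o, 'm) linmoncat \<Rightarrow> ('o, 'o \<times> 'm \<times> 'o) mon_quiver" where
  "U_cat D =
     \<lparr>quiver = \<lparr>verts = obj D,
        arcs = {(a, f, b). a \<in> obj D \<and> b \<in> obj D \<and> f \<in> mor D a b},
        tail = (\<lambda>(a, f, b). a), head = (\<lambda>(a, f, b). b)\<rparr>,
      vmonoid = obj_monoid D\<rparr>"

definition U_functor ::
    "('o, 'm, 'p, 'n) cat_functor \<Rightarrow> ('o, 'o \<times> 'm \<times> 'o, 'p, 'p \<times> 'n \<times> 'p) quiver_mor" where
  "U_functor F =
     \<lparr>on_verts = on_obj F, on_arcs = (\<lambda>(a, f, b). (on_obj F a, on_mor F a b f, on_obj F b))\<rparr>"


section \<open>Free linear categories\<close>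

text \<open>
  The free module on \<open>X\<close> consists of the finitely supported functions on \<open>X\<close>.  The ring fields
  \<open>mult\<close> and \<open>one\<close> of the type \<^typ>\<open>('k, 'm) module\<close> play no role for modules.
\<close>

definition free_module :: "('k, 'r) ring_scheme \<Rightarrow> 'x set \<Rightarrow> ('k, 'x \<Rightarrow> 'k) module" where
  "free_module R X =
     \<lparr>carrier = {f. (\<forall>x\<in>X. f x \<in> carrier R) \<and> (\<forall>x. x \<notin> X \<longrightarrow> f x = \<zero>\<^bsub>R\<^esub>) \<and>
                    finite {x. f x \<noteq> \<zero>\<^bsub>R\<^esub>}},
      mult = undefined, one = undefined,
      zero = (\<lambda>x. \<zero>\<^bsub>R\<^esub>), add = (\<lambda>f g x. f x \<oplus>\<^bsub>R\<^esub> g x),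
      smult = (\<lambda>r f x. r \<otimes>\<^bsub>R\<^esub> f x)\<rparr>"

definition basis_elem :: "('k, 'r) ring_scheme \<Rightarrow> 'x \<Rightarrow> 'x \<Rightarrow> 'k" where
  "basis_elem R x = (\<lambda>y. if y = x then \<one>\<^bsub>R\<^esub> else \<zero>\<^bsub>R\<^esub>)"

text \<open>
  The bilinear extension of an operation \<open>m\<close> on basis elements: the coefficient of \<open>z\<close> is the
  (finite) sum of \<open>f x \<otimes> g y\<close> over all \<open>(x, y)\<close> in the supports with \<open>m x y = z\<close>.
\<close>

definition bilinear_ext ::
    "('k, 'r) ring_scheme \<Rightarrow> ('x \<Rightarrow> 'y \<Rightarrow> 'z) \<Rightarrow> ('x \<Rightarrow> 'k) \<Rightarrow> ('y \<Rightarrow> 'k) \<Rightarrow> ('z \<Rightarrow> 'k)" where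
  "bilinear_ext R m f g = (\<lambda>z.
     \<Oplus>\<^bsub>R\<^esub> p \<in> {(x, y). f x \<noteq> \<zero>\<^bsub>R\<^esub> \<and> g y \<noteq> \<zero>\<^bsub>R\<^esub> \<and> m x y = z}. f (fst p) \<otimes>\<^bsub>R\<^esub> g (snd p))"

text \<open>
  Paths are walks, i.e. lists of arcs in the order of traversal: the path
  \<open>\<alpha>\<^sub>1 \<circ> \<dots> \<circ> \<alpha>\<^sub>n\<close> is the list \<open>[\<alpha>\<^sub>n, \<dots>, \<alpha>\<^sub>1]\<close>, the trivial path at any vertex is \<open>[]\<close>, and the
  composite of \<open>p : a \<rightarrow> b\<close> and \<open>q : b \<rightarrow> c\<close> is \<open>p @ q\<close>.
\<close>

definition free_lincat ::
    "('k, 'r) ring_scheme \<Rightarrow> ('v, 'e) pre_digraph \<Rightarrow> ('k, 'v, 'e list \<Rightarrow> 'k) lincat" where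
  "free_lincat R G =
     \<lparr>obj = verts G,
      Hom = (\<lambda>a b. free_module R {p. pre_digraph.awalk G a p b}),
      cmp = (\<lambda>a b c g f. bilinear_ext R (\<lambda>q p. p @ q) g f),
      ident = (\<lambda>a. basis_elem R [])\<rparr>"


section \<open>Ideals and quotients of linear categories\<close>

definition lincat_ideal ::
    "('k, 'r) ring_scheme \<Rightarrow> ('k, 'o, 'm, 'z) lincat_scheme \<Rightarrow> ('o \<Rightarrow> 'o \<Rightarrow> 'm set) \<Rightarrow> bool" where
  "lincat_ideal R C I \<longleftrightarrow>
     (\<forall>a\<in>obj C. \<forall>b\<in>obj C. submodule (I a b) R (Hom C a b)) \<and>
     (\<forall>a\<in>obj C. \<forall>b\<in>obj C. \<forall>c\<in>obj C. \<forall>f\<in>I a b. \<forall>g\<in>mor C b c. cmp C a b c g f \<in> I a c) \<and>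
     (\<forall>a\<in>obj C. \<forall>b\<in>obj C. \<forall>c\<in>obj C. \<forall>f\<in>mor C a b. \<forall>g\<in>I b c. cmp C a b c g f \<in> I a c)"

definition gen_ideal ::
    "('k, 'r) ring_scheme \<Rightarrow> ('k, 'o, 'm, 'z) lincat_scheme \<Rightarrow> ('o \<Rightarrow> 'o \<Rightarrow> 'm set) \<Rightarrow>
     'o \<Rightarrow> 'o \<Rightarrow> 'm set" where
  "gen_ideal R C S a b =
     \<Inter>{I a b | I. lincat_ideal R C I \<and> (\<forall>c\<in>obj C. \<forall>d\<in>obj C. S c d \<subseteq> I c d)}"

definition quot_module :: "('k, 'm) module \<Rightarrow> 'm set \<Rightarrow> ('k, 'm set) module" where
  "quot_module M N =
     \<lparr>carrier = a_rcosets\<^bsub>M\<^esub> N, mult = undefined, one = undefined,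
      zero = N, add = set_add M, smult = (\<lambda>r X. \<Union>x\<in>X. N +>\<^bsub>M\<^esub> (r \<odot>\<^bsub>M\<^esub> x))\<rparr>"

definition mor_class ::
    "('k, 'o, 'm, 'z) lincat_scheme \<Rightarrow> ('o \<Rightarrow> 'o \<Rightarrow> 'm set) \<Rightarrow> 'o \<Rightarrow> 'o \<Rightarrow> 'm \<Rightarrow> 'm set" where
  "mor_class C I a b f = I a b +>\<^bsub>Hom C a b\<^esub> f"

text \<open>
  Operations on classes are defined as in \<^const>\<open>rcoset_mult\<close>, by the union of the classes of all
  results on representatives.  This union is itself a class exactly when the operation does not
  depend on the representatives.
\<close>

definition quot_lincat ::
    "('k, 'o, 'm) lincat \<Rightarrow> ('o \<Rightarrow> 'o \<Rightarrow> 'm set) \<Rightarrow> ('k, 'o, 'm set) lincat" where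
  "quot_lincat C I =
     \<lparr>obj = obj C,
      Hom = (\<lambda>a b. quot_module (Hom C a b) (I a b)),
      cmp = (\<lambda>a b c G F. \<Union>g\<in>G. \<Union>f\<in>F. mor_class C I a c (cmp C a b c g f)),
      ident = (\<lambda>a. mor_class C I a a (ident C a))\<rparr>"


section \<open>The category constructed from a monoidal quiver\<close>

definition bar_quiver :: "('v, 'e) mon_quiver \<Rightarrow> ('v, 'v \<times> 'e \<times> 'v) pre_digraph" where
  "bar_quiver Q =
     \<lparr>verts = verts (quiver Q),
      arcs = verts (quiver Q) \<times> arcs (quiver Q) \<times> verts (quiver Q),
      tail = (\<lambda>(v, e, w). v \<otimes>\<^bsub>vmonoid Q\<^esub> tail (quiver Q) e \<otimes>\<^bsub>vmonoid Q\<^esub> w),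
      head = (\<lambda>(v, e, w). v \<otimes>\<^bsub>vmonoid Q\<^esub> head (quiver Q) e \<otimes>\<^bsub>vmonoid Q\<^esub> w)\<rparr>"

definition pre_cat ::
    "('k, 'r) ring_scheme \<Rightarrow> ('v, 'e) mon_quiver \<Rightarrow>
     ('k, 'v, ('v \<times> 'e \<times> 'v) list \<Rightarrow> 'k) lincat" where
  "pre_cat R Q = free_lincat R (bar_quiver Q)"

text \<open>\<open>1\<^sub>a \<otimes> p\<close> and \<open>p \<otimes> 1\<^sub>a\<close> for a path \<open>p\<close>:\<close>

definition whisker_left ::
    "('v, 'e) mon_quiver \<Rightarrow> 'v \<Rightarrow> ('v \<times> 'e \<times> 'v) list \<Rightarrow> ('v \<times> 'e \<times> 'v) list" where
  "whisker_left Q a p = map (\<lambda>(v, e, w). (a \<otimes>\<^bsub>vmonoid Q\<^esub> v, e, w)) p"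

definition whisker_right ::
    "('v, 'e) mon_quiver \<Rightarrow> ('v \<times> 'e \<times> 'v) list \<Rightarrow> 'v \<Rightarrow> ('v \<times> 'e \<times> 'v) list" where
  "whisker_right Q p a = map (\<lambda>(v, e, w). (v, e, w \<otimes>\<^bsub>vmonoid Q\<^esub> a)) p"

text \<open>
  For paths \<open>p : a \<rightarrow> b\<close> and \<open>q : c \<rightarrow> d\<close> the tensor product is \<open>(p \<otimes> 1\<^sub>d) \<circ> (1\<^sub>a \<otimes> q)\<close>; as lists are
  in the order of traversal, the factor \<open>1\<^sub>a \<otimes> q\<close> comes first.
\<close>

definition path_tensor ::
    "('v, 'e) mon_quiver \<Rightarrow> 'v \<Rightarrow> 'v \<Rightarrow> ('v \<times> 'e \<times> 'v) list \<Rightarrow> ('v \<times> 'e \<times> 'v) list \<Rightarrow>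
     ('v \<times> 'e \<times> 'v) list" where
  "path_tensor Q a d p q = whisker_left Q a q @ whisker_right Q p d"

definition pre_tensor ::
    "('k, 'r) ring_scheme \<Rightarrow> ('v, 'e) mon_quiver \<Rightarrow> 'v \<Rightarrow> 'v \<Rightarrow> 'v \<Rightarrow> 'v \<Rightarrow>
     (('v \<times> 'e \<times> 'v) list \<Rightarrow> 'k) \<Rightarrow> (('v \<times> 'e \<times> 'v) list \<Rightarrow> 'k) \<Rightarrow>
     (('v \<times> 'e \<times> 'v) list \<Rightarrow> 'k)" where
  "pre_tensor R Q a b c d f g = bilinear_ext R (path_tensor Q a d) f g"

text \<open>The set \<open>C\<close> of interchange relations, sorted by source \<open>a\<close> and target \<open>b\<close>.\<close>

definition interchange_rels ::
    "('k, 'r) ring_scheme \<Rightarrow> ('v, 'e) mon_quiver \<Rightarrow> 'v \<Rightarrow> 'v \<Rightarrow>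
     (('v \<times> 'e \<times> 'v) list \<Rightarrow> 'k) set" where
  "interchange_rels R Q a b =
     {r. \<exists>v \<in> verts (quiver Q). \<exists>w \<in> verts (quiver Q). \<exists>v' \<in> verts (quiver Q). \<exists>w' \<in> verts (quiver Q).
         \<exists>e \<in> arcs (quiver Q). \<exists>e' \<in> arcs (quiver Q). \<exists>x y x' y'.
       x = tail (quiver Q) e \<and> y = head (quiver Q) e \<and>
       x' = tail (quiver Q) e' \<and> y' = head (quiver Q) e' \<and>
       a = v \<otimes>\<^bsub>vmonoid Q\<^esub> x \<otimes>\<^bsub>vmonoid Q\<^esub> w \<otimes>\<^bsub>vmonoid Q\<^esub> v' \<otimes>\<^bsub>vmonoid Q\<^esub> x' \<otimes>\<^bsub>vmonoid Q\<^esub> w' \<and>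
       b = v \<otimes>\<^bsub>vmonoid Q\<^esub> y \<otimes>\<^bsub>vmonoid Q\<^esub> w \<otimes>\<^bsub>vmonoid Q\<^esub> v' \<otimes>\<^bsub>vmonoid Q\<^esub> y' \<otimes>\<^bsub>vmonoid Q\<^esub> w' \<and>
       r = cmp (pre_cat R Q) a
             (v \<otimes>\<^bsub>vmonoid Q\<^esub> x \<otimes>\<^bsub>vmonoid Q\<^esub> w \<otimes>\<^bsub>vmonoid Q\<^esub> v' \<otimes>\<^bsub>vmonoid Q\<^esub> y' \<otimes>\<^bsub>vmonoid Q\<^esub> w') b
             (basis_elem R [(v, e, w \<otimes>\<^bsub>vmonoid Q\<^esub> v' \<otimes>\<^bsub>vmonoid Q\<^esub> y' \<otimes>\<^bsub>vmonoid Q\<^esub> w')])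
             (basis_elem R [(v \<otimes>\<^bsub>vmonoid Q\<^esub> x \<otimes>\<^bsub>vmonoid Q\<^esub> w \<otimes>\<^bsub>vmonoid Q\<^esub> v', e', w')])
           \<ominus>\<^bsub>Hom (pre_cat R Q) a b\<^esub>
           cmp (pre_cat R Q) a
             (v \<otimes>\<^bsub>vmonoid Q\<^esub> y \<otimes>\<^bsub>vmonoid Q\<^esub> w \<otimes>\<^bsub>vmonoid Q\<^esub> v' \<otimes>\<^bsub>vmonoid Q\<^esub> x' \<otimes>\<^bsub>vmonoid Q\<^esub> w') b
             (basis_elem R [(v \<otimes>\<^bsub>vmonoid Q\<^esub> y \<otimes>\<^bsub>vmonoid Q\<^esub> w \<otimes>\<^bsub>vmonoid Q\<^esub> v', e', w')])
             (basis_elem R [(v, e, w \<otimes>\<^bsub>vmonoid Q\<^esub> v' \<otimes>\<^bsub>vmonoid Q\<^esub> x' \<otimes>\<^bsub>vmonoid Q\<^esub> w')])}"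

definition interchange_ideal ::
    "('k, 'r) ring_scheme \<Rightarrow> ('v, 'e) mon_quiver \<Rightarrow> 'v \<Rightarrow> 'v \<Rightarrow>
     (('v \<times> 'e \<times> 'v) list \<Rightarrow> 'k) set" where
  "interchange_ideal R Q = gen_ideal R (pre_cat R Q) (interchange_rels R Q)"

definition free_linmoncat ::
    "('k, 'r) ring_scheme \<Rightarrow> ('v, 'e) mon_quiver \<Rightarrow>
     ('k, 'v, (('v \<times> 'e \<times> 'v) list \<Rightarrow> 'k) set) linmoncat" where
  "free_linmoncat R Q =
     lincat.extend (quot_lincat (pre_cat R Q) (interchange_ideal R Q))
       (linmoncat.fields
         (mult (vmonoid Q))
         (\<lambda>a b c d F G. \<Union>f\<in>F. \<Union>g\<in>G.
            mor_class (pre_cat R Q) (interchange_ideal R Q)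
              (a \<otimes>\<^bsub>vmonoid Q\<^esub> c) (b \<otimes>\<^bsub>vmonoid Q\<^esub> d) (pre_tensor R Q a b c d f g))
         (one (vmonoid Q)))"

text \<open>The arc \<open>(\<one>, e, \<one>)\<close> runs from \<open>\<one> \<otimes> tail e \<otimes> \<one> = tail e\<close> to \<open>\<one> \<otimes> head e \<otimes> \<one> = head e\<close>.\<close>

definition free_tau ::
    "('k, 'r) ring_scheme \<Rightarrow> ('v, 'e) mon_quiver \<Rightarrow>
     ('v, 'e, 'v, 'v \<times> (('v \<times> 'e \<times> 'v) list \<Rightarrow> 'k) set \<times> 'v) quiver_mor" where
  "free_tau R Q =
     \<lparr>on_verts = (\<lambda>v. v),
      on_arcs = (\<lambda>e.
        (tail (quiver Q) e,
         mor_class (pre_cat R Q) (interchange_ideal R Q) (tail (quiver Q) e) (head (quiver Q) e)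
           (basis_elem R [(\<one>\<^bsub>vmonoid Q\<^esub>, e, \<one>\<^bsub>vmonoid Q\<^esub>)]),
         head (quiver Q) e))\<rparr>"

end

theory Submission
  imports Defs
begin

text \<open>
  Write \<open>L\<close> for the free linear category over the whiskered arcs \<open>(v, e, w)\<close>, \<open>I\<close> for the ideal
  generated by the interchange relations, and \<open>\<M>\<close> for the quotient of \<open>L\<close> by \<open>I\<close>.

  All data on \<open>\<M>\<close> are multilinear, and its hom-modules are spanned by the classes of paths.  An
  identity between morphisms of \<open>\<M>\<close> can therefore be checked on classes of paths, one argument
  after the other (\<open>linear_eq_on_pcls\<close>), and there it is a statement about lists of arcs.

  \<^emph>\<open>The tensor product.\<close>  Whiskering with an object on the left or on the right is a linear
  endofunctor of \<open>L\<close>.  It sends an interchange relation to the interchange relation of the whiskered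
  arcs, hence preserves \<open>I\<close>, because preimages of ideals under linear functors are ideals
  (\<open>lincat_ideal_preimage\<close>).  As \<open>f \<otimes> g\<close> is the composite of a right whiskering of \<open>f\<close> and a left
  whiskering of \<open>g\<close>, its class depends on the classes of \<open>f\<close> and \<open>g\<close> only (\<open>mtens_cls\<close>).  On paths
  the tensor product is strictly associative and unital already in \<open>L\<close>.  It is a functor only
  modulo \<open>I\<close>: the two sides of the functoriality law differ by moving one whiskered path past
  another, and \<open>interchange_pcls\<close> extends the interchange relations from arcs to paths.

  \<^emph>\<open>The universal property.\<close>  A morphism \<open>\<phi>\<close> from the quiver to a linear monoidal category \<open>D\<close>
  leaves no choice for the image of an arc: \<open>(v, e, w)\<close> is \<open>1\<^sub>v \<otimes> \<tau>(e) \<otimes> 1\<^sub>w\<close> (\<open>pcls_arc\<close>), so it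
  has to go to \<open>1 \<otimes> \<phi>(e) \<otimes> 1\<close>.  This determines the functor on paths and hence everywhere
  (\<open>lift_unique\<close>).  Conversely, extending this assignment to paths and then linearly gives a functor
  on \<open>L\<close>.  The interchange law of \<open>D\<close> says that both ways around a square of arcs have the same
  image, so the functor kills \<open>I\<close> and descends to \<open>\<M>\<close> (\<open>pre_lift_zero_on_I\<close>); by the same law it
  is compatible with tensor products of paths (\<open>path_mor_square\<close>).
\<close>

section \<open>Linear maps\<close>

lemma linear_mapsI:
  assumes "\<And>x. x \<in> carrier M \<Longrightarrow> h x \<in> carrier N"
    and "\<And>x y. \<lbrakk>x \<in> carrier M; y \<in> carrier M\<rbrakk> \<Longrightarrow> h (x \<oplus>\<^bsub>M\<^esub> y) = h x \<oplus>\<^bsub>N\<^esub> h y"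
    and "\<And>r x. \<lbrakk>r \<in> carrier R; x \<in> carrier M\<rbrakk> \<Longrightarrow> h (r \<odot>\<^bsub>M\<^esub> x) = r \<odot>\<^bsub>N\<^esub> h x"
  shows "h \<in> linear_maps R M N"
  using assms unfolding linear_maps_def hom_def by auto

lemma linear_mapsD:
  assumes "h \<in> linear_maps R M N"
  shows "x \<in> carrier M \<Longrightarrow> h x \<in> carrier N"
    and "\<lbrakk>x \<in> carrier M; y \<in> carrier M\<rbrakk> \<Longrightarrow> h (x \<oplus>\<^bsub>M\<^esub> y) = h x \<oplus>\<^bsub>N\<^esub> h y"
    and "\<lbrakk>r \<in> carrier R; x \<in> carrier M\<rbrakk> \<Longrightarrow> h (r \<odot>\<^bsub>M\<^esub> x) = r \<odot>\<^bsub>N\<^esub> h x"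
  using assms unfolding linear_maps_def hom_def by auto

lemma linear_maps_id: "(\<lambda>x. x) \<in> linear_maps R M M"
  by (rule linear_mapsI) auto

lemma linear_maps_comp:
  assumes "h \<in> linear_maps R M N" and "k \<in> linear_maps R N P"
  shows "(\<lambda>x. k (h x)) \<in> linear_maps R M P"
  by (rule linear_mapsI) (simp_all add: linear_mapsD[OF assms(1)] linear_mapsD[OF assms(2)])

lemma linear_maps_zero:
  assumes M: "module R M" and N: "module R N" and h: "h \<in> linear_maps R M N"
  shows "h \<zero>\<^bsub>M\<^esub> = \<zero>\<^bsub>N\<^esub>"
proof -
  interpret M: module R M by (rule M)
  interpret N: module R N by (rule N)
  have "h (\<zero>\<^bsub>R\<^esub> \<odot>\<^bsub>M\<^esub> \<zero>\<^bsub>M\<^esub>) = \<zero>\<^bsub>R\<^esub> \<odot>\<^bsub>N\<^esub> h \<zero>\<^bsub>M\<^esub>"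
    by (simp del: M.smult_l_null N.smult_l_null M.smult_r_null add: linear_mapsD(3)[OF h])
  then show ?thesis
    using linear_mapsD(1)[OF h M.M.zero_closed] by simp
qed

lemma linear_maps_uminus:
  assumes M: "module R M" and N: "module R N" and h: "h \<in> linear_maps R M N"
    and x: "x \<in> carrier M"
  shows "h (\<ominus>\<^bsub>M\<^esub> x) = \<ominus>\<^bsub>N\<^esub> h x"
proof -
  interpret M: module R M by (rule M)
  interpret N: module R N by (rule N)
  have hx: "h x \<in> carrier N" and hmx: "h (\<ominus>\<^bsub>M\<^esub> x) \<in> carrier N"
    using linear_mapsD(1)[OF h] x by simp_all
  have "h (\<ominus>\<^bsub>M\<^esub> x) \<oplus>\<^bsub>N\<^esub> h x = h \<zero>\<^bsub>M\<^esub>"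
    using x by (simp flip: linear_mapsD(2)[OF h] add: M.M.l_neg)
  then show ?thesis
    using hx hmx by (metis N.M.minus_equality linear_maps_zero[OF M N h])
qed

lemma linear_maps_minus:
  assumes M: "module R M" and N: "module R N" and h: "h \<in> linear_maps R M N"
    and "x \<in> carrier M" "y \<in> carrier M"
  shows "h (x \<ominus>\<^bsub>M\<^esub> y) = h x \<ominus>\<^bsub>N\<^esub> h y"
proof -
  interpret M: module R M by (rule M)
  show ?thesis
    using assms(4,5) by (simp add: a_minus_def linear_mapsD(2)[OF h] linear_maps_uminus[OF M N h])
qed

lemma submodule_preimage:
  assumes M: "module R M" and N: "module R N" and h: "h \<in> linear_maps R M N"
    and K: "submodule K R N"
  shows "submodule {x \<in> carrier M. h x \<in> K} R M"
proof -
  interpret M: module R M by (rule M)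
  interpret N: module R N by (rule N)
  have "\<zero>\<^bsub>N\<^esub> \<in> K"
    using subgroup.one_closed[OF submodule.axioms(1)[OF K]] by simp
  then show ?thesis
    using N.submoduleE[OF K]
    by (intro M.submoduleI)
      (auto simp: linear_mapsD[OF h] linear_maps_zero[OF M N h] linear_maps_uminus[OF M N h])
qed

lemma submodule_zero:
  assumes "module R M" shows "submodule {\<zero>\<^bsub>M\<^esub>} R M"
proof -
  interpret M: module R M by (rule assms)
  show ?thesis by (rule M.submoduleI) auto
qed

text \<open>
  All module axioms are identities, so they pass to the image of a module under a surjection
  that respects the operations.
\<close>

lemma module_surj_image:
  assumes M: "module R M"
    and surj: "carrier N = \<pi> ` carrier M"
    and zero: "\<zero>\<^bsub>N\<^esub> = \<pi> \<zero>\<^bsub>M\<^esub>"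
    and add: "\<And>x y. \<lbrakk>x \<in> carrier M; y \<in> carrier M\<rbrakk> \<Longrightarrow> \<pi> x \<oplus>\<^bsub>N\<^esub> \<pi> y = \<pi> (x \<oplus>\<^bsub>M\<^esub> y)"
    and smult: "\<And>r x. \<lbrakk>r \<in> carrier R; x \<in> carrier M\<rbrakk> \<Longrightarrow> r \<odot>\<^bsub>N\<^esub> \<pi> x = \<pi> (r \<odot>\<^bsub>M\<^esub> x)"
  shows "module R N" and "\<pi> \<in> linear_maps R M N"
proof -
  interpret M: module R M by (rule M)
  show "module R N"
  proof (rule moduleI)
    show "abelian_group N"
    proof (rule abelian_groupI)
      fix X assume "X \<in> carrier N"
      then obtain x where x: "x \<in> carrier M" "X = \<pi> x" using surj by auto
      then show "\<exists>Y\<in>carrier N. Y \<oplus>\<^bsub>N\<^esub> X = \<zero>\<^bsub>N\<^esub>"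
        using surj by (intro bexI[of _ "\<pi> (\<ominus>\<^bsub>M\<^esub> x)"]) (auto simp: add zero M.M.l_neg)
    qed (auto simp: surj zero add M.M.a_ac)
  qed (auto simp: M.R.is_cring surj add smult M.smult_l_distr M.smult_r_distr M.smult_assoc1)
  show "\<pi> \<in> linear_maps R M N"
    using surj by (intro linear_mapsI) (simp_all add: add smult)
qed


section \<open>Spanning sets and free modules\<close>

text \<open>
  Phrased with submodules in place of linear combinations, so that uniqueness arguments avoid sums.
\<close>

definition spans :: "('k, 'r) ring_scheme \<Rightarrow> ('k, 'm) module \<Rightarrow> 'm set \<Rightarrow> bool" where
  "spans R M B \<longleftrightarrow> B \<subseteq> carrier M \<and> (\<forall>K. submodule K R M \<longrightarrow> B \<subseteq> K \<longrightarrow> carrier M \<subseteq> K)"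

text \<open>The equalizer of two linear maps is a submodule.\<close>

lemma linear_maps_eq_on_span:
  assumes M: "module R M" and N: "module R N" and B: "spans R M B"
    and h: "h \<in> linear_maps R M N" and k: "k \<in> linear_maps R M N"
    and eq: "\<And>b. b \<in> B \<Longrightarrow> h b = k b"
    and x: "x \<in> carrier M"
  shows "h x = k x"
proof -
  interpret M: module R M by (rule M)
  have "submodule {x \<in> carrier M. h x = k x} R M"
    by (rule M.submoduleI)
      (auto simp: linear_mapsD(2,3)[OF h] linear_mapsD(2,3)[OF k] linear_maps_zero[OF M N]
        linear_maps_uminus[OF M N] h k)
  moreover have "B \<subseteq> {x \<in> carrier M. h x = k x}"
    using B eq unfolding spans_def by auto
  ultimately show ?thesis
    using B x unfolding spans_def by blast
qed

lemma spans_surj_image: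
  assumes M: "module R M" and N: "module R N" and B: "spans R M B"
    and h: "h \<in> linear_maps R M N" and surj: "carrier N = h ` carrier M"
  shows "spans R N (h ` B)"
  unfolding spans_def
proof (intro conjI allI impI)
  show "h ` B \<subseteq> carrier N" using B surj unfolding spans_def by auto
next
  fix K assume K: "submodule K R N" and "h ` B \<subseteq> K"
  then have "B \<subseteq> {x \<in> carrier M. h x \<in> K}"
    using B unfolding spans_def by auto
  then have "carrier M \<subseteq> {x \<in> carrier M. h x \<in> K}"
    using B submodule_preimage[OF M N h K] unfolding spans_def by blast
  then show "carrier N \<subseteq> K" using surj by auto
qed

lemma free_module_simps:
  "carrier (free_module R X) = {f. (\<forall>x\<in>X. f x \<in> carrier R) \<and> (\<forall>x. x \<notin> X \<longrightarrow> f x = \<zero>\<^bsub>R\<^esub>) \<and>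
                    finite {x. f x \<noteq> \<zero>\<^bsub>R\<^esub>}}"
  "\<zero>\<^bsub>free_module R X\<^esub> = (\<lambda>x. \<zero>\<^bsub>R\<^esub>)"
  "f \<oplus>\<^bsub>free_module R X\<^esub> g = (\<lambda>x. f x \<oplus>\<^bsub>R\<^esub> g x)"
  "r \<odot>\<^bsub>free_module R X\<^esub> f = (\<lambda>x. r \<otimes>\<^bsub>R\<^esub> f x)"
  by (simp_all add: free_module_def)

context cring
begin

lemma free_module_coeff_closed:
  "f \<in> carrier (free_module R X) \<Longrightarrow> f x \<in> carrier R"
  by (cases "x \<in> X") (auto simp: free_module_simps)

lemma module_free_module: "module R (free_module R X)"
proof (rule moduleI)
  have fin: "finite {x. h x \<noteq> \<zero>}"
    if "finite {x. f x \<noteq> \<zero>}" "finite {x. g x \<noteq> \<zero>}" "\<And>x. f x = \<zero> \<Longrightarrow> g x = \<zero> \<Longrightarrow> h x = \<zero>"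
    for f g h :: "'c \<Rightarrow> 'a"
    by (rule finite_subset[of _ "{x. f x \<noteq> \<zero>} \<union> {x. g x \<noteq> \<zero>}"]) (use that in auto)
  show "abelian_group (free_module R X)"
  proof (rule abelian_groupI)
    fix f assume f: "f \<in> carrier (free_module R X)"
    then have "(\<lambda>x. \<ominus> f x) \<in> carrier (free_module R X)"
      by (auto simp: free_module_simps intro: fin[of f f])
    then show "\<exists>g\<in>carrier (free_module R X). g \<oplus>\<^bsub>free_module R X\<^esub> f = \<zero>\<^bsub>free_module R X\<^esub>"
      using free_module_coeff_closed[OF f]
      by (intro bexI[of _ "\<lambda>x. \<ominus> f x"]) (auto simp: free_module_simps l_neg)
  next
    fix f g assume "f \<in> carrier (free_module R X)" "g \<in> carrier (free_module R X)"
    then show "f \<oplus>\<^bsub>free_module R X\<^esub> g \<in> carrier (free_module R X)"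
      by (auto simp: free_module_simps intro: fin[of f g])
  qed (auto simp: free_module_simps(2-4) free_module_coeff_closed a_ac, auto simp: free_module_simps)
  fix r f assume "r \<in> carrier R" "f \<in> carrier (free_module R X)"
  then show "r \<odot>\<^bsub>free_module R X\<^esub> f \<in> carrier (free_module R X)"
    by (auto simp: free_module_simps intro: fin[of f f])
qed (auto simp: free_module_simps(2-4) free_module_coeff_closed l_distr r_distr m_assoc is_cring)

lemma basis_elem_closed: "x \<in> X \<Longrightarrow> basis_elem R x \<in> carrier (free_module R X)"
  by (auto simp: free_module_simps basis_elem_def)

lemma basis_elem_support: "{y. basis_elem R x y \<noteq> \<zero>} \<subseteq> {x}"
  by (auto simp: basis_elem_def)

lemma basis_elem_same: "basis_elem R x x = \<one>"
  by (simp add: basis_elem_def)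

text \<open>
  By induction on the support: every element is the sum of one with smaller support and a multiple
  of a basis element.
\<close>

lemma free_module_span: "spans R (free_module R X) (basis_elem R ` X)"
  unfolding spans_def
proof (intro conjI allI impI subsetI)
  fix b assume "b \<in> basis_elem R ` X"
  then show "b \<in> carrier (free_module R X)" by (auto intro: basis_elem_closed)
next
  interpret F: module R "free_module R X" by (rule module_free_module)
  fix K f assume K: "submodule K R (free_module R X)" and B: "basis_elem R ` X \<subseteq> K"
  assume f: "f \<in> carrier (free_module R X)"
  then have "finite {x. f x \<noteq> \<zero>}" by (simp add: free_module_simps)
  then show "f \<in> K"
    using f
  proof (induction "{x. f x \<noteq> \<zero>}" arbitrary: f rule: finite_psubset_induct)
    case psubset
    show ?case
    proof (cases "{x. f x \<noteq> \<zero>} = {}")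
      case True
      then have "f = \<zero>\<^bsub>free_module R X\<^esub>" by (auto simp: free_module_simps)
      then show ?thesis
        using subgroup.one_closed[OF submodule.axioms(1)[OF K]] by simp
    next
      case False
      then obtain x where x: "f x \<noteq> \<zero>" by auto
      then have xX: "x \<in> X" using psubset.prems by (auto simp: free_module_simps)
      \<comment> \<open>split off the summand of \<open>f\<close> at \<open>x\<close>\<close>
      define g where "g = f(x := \<zero>)"
      have "g \<in> carrier (free_module R X)"
        using psubset.prems psubset.hyps unfolding g_def
        by (auto simp: free_module_simps intro: finite_subset)
      moreover have "{y. g y \<noteq> \<zero>} \<subset> {y. f y \<noteq> \<zero>}" using x by (auto simp: g_def)
      ultimately have "g \<in> K" using psubset K B by (auto simp: free_module_simps)
      moreover have "f x \<odot>\<^bsub>free_module R X\<^esub> basis_elem R x \<in> K"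
        using F.submoduleE(4)[OF K] B xX free_module_coeff_closed[OF psubset.prems] by auto
      moreover have "f = g \<oplus>\<^bsub>free_module R X\<^esub> f x \<odot>\<^bsub>free_module R X\<^esub> basis_elem R x"
        using free_module_coeff_closed[OF psubset.prems]
        by (auto simp: free_module_simps g_def basis_elem_def)
      ultimately show ?thesis using F.submoduleE(5)[OF K] by metis
    qed
  qed
qed

text \<open>
  Enlarging the range of summation from the support to any larger finite subset of the basis only
  adds zero summands; values on several elements can thus be compared summand by summand.
\<close>

definition lin_ext :: "('a, 'm) module \<Rightarrow> ('x \<Rightarrow> 'm) \<Rightarrow> ('x \<Rightarrow> 'a) \<Rightarrow> 'm" where
  "lin_ext M P f = (\<Oplus>\<^bsub>M\<^esub> x \<in> {x. f x \<noteq> \<zero>}. f x \<odot>\<^bsub>M\<^esub> P x)"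

context
  fixes M :: "('a, 'm) module" and P :: "'x \<Rightarrow> 'm" and X :: "'x set"
  assumes M: "module R M" and P: "\<And>x. x \<in> X \<Longrightarrow> P x \<in> carrier M"
begin

interpretation M: module R M by (rule M)

lemma lin_ext_superset:
  assumes f: "f \<in> carrier (free_module R X)" and A: "finite A" "A \<subseteq> X" "{x. f x \<noteq> \<zero>} \<subseteq> A"
  shows "lin_ext M P f = (\<Oplus>\<^bsub>M\<^esub> x \<in> A. f x \<odot>\<^bsub>M\<^esub> P x)"
  unfolding lin_ext_def
  using A P free_module_coeff_closed[OF f]
  by (intro M.M.add.finprod_mono_neutral_cong_left) (auto simp: subset_iff)

lemma lin_ext_linear: "lin_ext M P \<in> linear_maps R (free_module R X) M"
proof (rule linear_mapsI)
  interpret F: module R "free_module R X" by (rule module_free_module)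
  fix f assume f: "f \<in> carrier (free_module R X)"
  have fR: "f x \<in> carrier R" for x by (rule free_module_coeff_closed[OF f])
  have suppf: "finite {x. f x \<noteq> \<zero>}" "{x. f x \<noteq> \<zero>} \<subseteq> X"
    using f by (auto simp: free_module_simps)
  show "lin_ext M P f \<in> carrier M"
    unfolding lin_ext_def using suppf fR P by (intro M.M.finsum_closed) auto
  {
    fix r assume r: "r \<in> carrier R"
    have "lin_ext M P (r \<odot>\<^bsub>free_module R X\<^esub> f) =
        (\<Oplus>\<^bsub>M\<^esub> x \<in> {x. f x \<noteq> \<zero>}. (r \<odot>\<^bsub>free_module R X\<^esub> f) x \<odot>\<^bsub>M\<^esub> P x)"
      using suppf r F.smult_closed[OF r f]
      by (intro lin_ext_superset) (auto simp: free_module_simps(4))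
    also have "\<dots> = (\<Oplus>\<^bsub>M\<^esub> x \<in> {x. f x \<noteq> \<zero>}. r \<odot>\<^bsub>M\<^esub> (f x \<odot>\<^bsub>M\<^esub> P x))"
      using suppf fR P r
      by (intro M.M.finsum_cong') (auto simp: free_module_simps(4) M.smult_assoc1)
    also have "\<dots> = r \<odot>\<^bsub>M\<^esub> lin_ext M P f"
      unfolding lin_ext_def using suppf fR P r by (intro M.finsum_smult_ldistr[symmetric]) auto
    finally show "lin_ext M P (r \<odot>\<^bsub>free_module R X\<^esub> f) = r \<odot>\<^bsub>M\<^esub> lin_ext M P f" .
  next
    fix g assume g: "g \<in> carrier (free_module R X)"
    have gR: "g x \<in> carrier R" for x by (rule free_module_coeff_closed[OF g])
    have suppg: "finite {x. g x \<noteq> \<zero>}" "{x. g x \<noteq> \<zero>} \<subseteq> X"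
      using g by (auto simp: free_module_simps)
    let ?A = "{x. f x \<noteq> \<zero>} \<union> {x. g x \<noteq> \<zero>}"
    have A: "finite ?A" "?A \<subseteq> X" using suppf suppg by auto
    have PA: "P x \<in> carrier M" if "x \<in> ?A" for x using P A(2) that by blast
    have "lin_ext M P (f \<oplus>\<^bsub>free_module R X\<^esub> g) =
        (\<Oplus>\<^bsub>M\<^esub> x \<in> ?A. (f \<oplus>\<^bsub>free_module R X\<^esub> g) x \<odot>\<^bsub>M\<^esub> P x)"
      using A F.M.a_closed[OF f g]
      by (intro lin_ext_superset) (auto simp: free_module_simps(3))
    also have "\<dots> = (\<Oplus>\<^bsub>M\<^esub> x \<in> ?A. f x \<odot>\<^bsub>M\<^esub> P x \<oplus>\<^bsub>M\<^esub> g x \<odot>\<^bsub>M\<^esub> P x)"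
      using PA fR gR
      by (intro M.M.finsum_cong') (auto simp: free_module_simps(3) M.smult_l_distr)
    also have "\<dots> = (\<Oplus>\<^bsub>M\<^esub> x \<in> ?A. f x \<odot>\<^bsub>M\<^esub> P x) \<oplus>\<^bsub>M\<^esub> (\<Oplus>\<^bsub>M\<^esub> x \<in> ?A. g x \<odot>\<^bsub>M\<^esub> P x)"
      using PA fR gR by (intro M.M.finsum_addf) auto
    also have "\<dots> = lin_ext M P f \<oplus>\<^bsub>M\<^esub> lin_ext M P g"
      using lin_ext_superset[OF f A] lin_ext_superset[OF g A] by simp
    finally show "lin_ext M P (f \<oplus>\<^bsub>free_module R X\<^esub> g) = lin_ext M P f \<oplus>\<^bsub>M\<^esub> lin_ext M P g" .
  }
qed

lemma lin_ext_basis: "x \<in> X \<Longrightarrow> lin_ext M P (basis_elem R x) = P x"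
  using lin_ext_superset[OF basis_elem_closed _ _ basis_elem_support, of x] P
  by (simp add: basis_elem_same)

end

text \<open>
  In \<^const>\<open>bilinear_ext\<close> the range of summation varies with \<open>z\<close> and with the supports.  Summing over
  a fixed finite product set instead, with zero summands off the fibre over \<open>z\<close>, lets bilinearity be
  read off from the summands.
\<close>


context
  fixes m :: "'x \<Rightarrow> 'y \<Rightarrow> 'z" and X :: "'x set" and Y :: "'y set" and Z :: "'z set"
  assumes m: "\<And>x y. \<lbrakk>x \<in> X; y \<in> Y\<rbrakk> \<Longrightarrow> m x y \<in> Z"
begin

lemma bilinear_ext_superset:
  assumes f: "f \<in> carrier (free_module R X)" and g: "g \<in> carrier (free_module R Y)"
    and AB: "finite A" "finite B" "{x. f x \<noteq> \<zero>} \<subseteq> A" "{y. g y \<noteq> \<zero>} \<subseteq> B"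
  shows "bilinear_ext R m f g z =
    (\<Oplus> p \<in> A \<times> B. if m (fst p) (snd p) = z then f (fst p) \<otimes> g (snd p) else \<zero>)"
  unfolding bilinear_ext_def
  using AB free_module_coeff_closed[OF f] free_module_coeff_closed[OF g]
  by (intro add.finprod_mono_neutral_cong_left) (auto split: if_splits)

lemma bilinear_ext_closed:
  assumes f: "f \<in> carrier (free_module R X)" and g: "g \<in> carrier (free_module R Y)"
  shows "bilinear_ext R m f g \<in> carrier (free_module R Z)"
proof -
  note fR = free_module_coeff_closed[OF f] and gR = free_module_coeff_closed[OF g]
  let ?S = "\<lambda>z. {(x, y). f x \<noteq> \<zero> \<and> g y \<noteq> \<zero> \<and> m x y = z}"
  let ?A = "{x. f x \<noteq> \<zero>}" and ?B = "{y. g y \<noteq> \<zero>}"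
  have AB: "finite ?A" "finite ?B" "?A \<subseteq> X" "?B \<subseteq> Y"
    using f g by (auto simp: free_module_simps)
  have zero: "bilinear_ext R m f g z = \<zero>" if "z \<notin> (\<lambda>p. m (fst p) (snd p)) ` (?A \<times> ?B)" for z
  proof -
    have "?S z = {}" using that by force
    then show ?thesis unfolding bilinear_ext_def by (simp only: finsum_empty)
  qed
  then have supp: "{z. bilinear_ext R m f g z \<noteq> \<zero>} \<subseteq> (\<lambda>p. m (fst p) (snd p)) ` (?A \<times> ?B)"
    by blast
  have "finite {z. bilinear_ext R m f g z \<noteq> \<zero>}"
    by (rule finite_subset[OF supp]) (simp add: AB(1,2))
  moreover have "bilinear_ext R m f g z \<in> carrier R" for z
    unfolding bilinear_ext_def using fR gR by (intro finsum_closed) auto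
  moreover have "bilinear_ext R m f g z = \<zero>" if "z \<notin> Z" for z
    by (rule zero) (use m AB(3,4) that in \<open>auto simp: subset_iff\<close>)
  ultimately show ?thesis by (simp add: free_module_simps)
qed

lemma bilinear_ext_bilinear:
  "bilinear_map R (free_module R X) (free_module R Y) (free_module R Z) (bilinear_ext R m)"
  unfolding bilinear_map_def
proof (intro conjI ballI linear_mapsI)
  interpret FX: module R "free_module R X" by (rule module_free_module)
  interpret FY: module R "free_module R Y" by (rule module_free_module)
  fix f g assume f: "f \<in> carrier (free_module R X)" and g: "g \<in> carrier (free_module R Y)"
  note fR = free_module_coeff_closed[OF f] and gR = free_module_coeff_closed[OF g]
  have sf: "finite {x. f x \<noteq> \<zero>}" and sg: "finite {x. g x \<noteq> \<zero>}"
    using f g by (auto simp: free_module_simps)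
  show "bilinear_ext R m f g \<in> carrier (free_module R Z)"
    "bilinear_ext R m f g \<in> carrier (free_module R Z)"
    by (rule bilinear_ext_closed[OF f g])+
  {
    fix r assume r: "r \<in> carrier R"
    let ?AB = "{x. f x \<noteq> \<zero>} \<times> {x. g x \<noteq> \<zero>}"
    have scaled: "r \<otimes> bilinear_ext R m f g z =
        (\<Oplus> p \<in> ?AB. r \<otimes> (if m (fst p) (snd p) = z then f (fst p) \<otimes> g (snd p) else \<zero>))" for z
      unfolding bilinear_ext_superset[OF f g sf sg order_refl order_refl]
      using fR gR r sf sg by (intro finsum_rdistr) auto
    have "bilinear_ext R m f (r \<odot>\<^bsub>free_module R Y\<^esub> g) z = r \<otimes> bilinear_ext R m f g z" for z
    proof -
      have "bilinear_ext R m f (r \<odot>\<^bsub>free_module R Y\<^esub> g) z = (\<Oplus> p \<in> ?AB.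
          if m (fst p) (snd p) = z then f (fst p) \<otimes> (r \<odot>\<^bsub>free_module R Y\<^esub> g) (snd p) else \<zero>)"
        using fR gR r by (intro bilinear_ext_superset f g sf sg FY.smult_closed) (auto simp: free_module_simps(4))
      also have "\<dots> = (\<Oplus> p \<in> ?AB. r \<otimes> (if m (fst p) (snd p) = z then f (fst p) \<otimes> g (snd p) else \<zero>))"
        using fR gR r by (intro finsum_cong') (auto simp: free_module_simps(4) m_ac)
      finally show ?thesis unfolding scaled .
    qed
    then show "bilinear_ext R m f (r \<odot>\<^bsub>free_module R Y\<^esub> g) =
        r \<odot>\<^bsub>free_module R Z\<^esub> bilinear_ext R m f g"
      by (simp add: free_module_simps(4) fun_eq_iff)
    have "bilinear_ext R m (r \<odot>\<^bsub>free_module R X\<^esub> f) g z = r \<otimes> bilinear_ext R m f g z" for z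
    proof -
      have "bilinear_ext R m (r \<odot>\<^bsub>free_module R X\<^esub> f) g z = (\<Oplus> p \<in> ?AB.
          if m (fst p) (snd p) = z then (r \<odot>\<^bsub>free_module R X\<^esub> f) (fst p) \<otimes> g (snd p) else \<zero>)"
        using fR gR r by (intro bilinear_ext_superset f g sf sg FX.smult_closed) (auto simp: free_module_simps(4))
      also have "\<dots> = (\<Oplus> p \<in> ?AB. r \<otimes> (if m (fst p) (snd p) = z then f (fst p) \<otimes> g (snd p) else \<zero>))"
        using fR gR r by (intro finsum_cong') (auto simp: free_module_simps(4) m_ac)
      finally show ?thesis unfolding scaled .
    qed
    then show "bilinear_ext R m (r \<odot>\<^bsub>free_module R X\<^esub> f) g =
        r \<odot>\<^bsub>free_module R Z\<^esub> bilinear_ext R m f g"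
      by (simp add: free_module_simps(4) fun_eq_iff)
  next
    fix h assume h: "h \<in> carrier (free_module R Y)"
    note hR = free_module_coeff_closed[OF h]
    let ?B = "{x. g x \<noteq> \<zero>} \<union> {x. h x \<noteq> \<zero>}"
    have B: "finite ?B" using sg h by (auto simp: free_module_simps)
    note sum = bilinear_ext_superset[OF f _ sf B order_refl]
    have "bilinear_ext R m f (g \<oplus>\<^bsub>free_module R Y\<^esub> h) z = bilinear_ext R m f g z \<oplus> bilinear_ext R m f h z" for z
    proof -
      have "bilinear_ext R m f (g \<oplus>\<^bsub>free_module R Y\<^esub> h) z =
          (\<Oplus> p \<in> {x. f x \<noteq> \<zero>} \<times> ?B. if m (fst p) (snd p) = z then f (fst p) \<otimes> (g \<oplus>\<^bsub>free_module R Y\<^esub> h) (snd p) else \<zero>)"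
        by (intro sum FY.M.a_closed g h) (auto simp: free_module_simps(3))
      also have "\<dots> = (\<Oplus> p \<in> {x. f x \<noteq> \<zero>} \<times> ?B.
            (if m (fst p) (snd p) = z then f (fst p) \<otimes> g (snd p) else \<zero>) \<oplus>
            (if m (fst p) (snd p) = z then f (fst p) \<otimes> h (snd p) else \<zero>))"
        using fR gR hR by (intro finsum_cong') (auto simp: free_module_simps(3) r_distr)
      also have "\<dots> = bilinear_ext R m f g z \<oplus> bilinear_ext R m f h z"
        unfolding sum[OF g Un_upper1] sum[OF h Un_upper2]
        using fR gR hR by (intro finsum_addf) auto
      finally show ?thesis .
    qed
    then show "bilinear_ext R m f (g \<oplus>\<^bsub>free_module R Y\<^esub> h) =
        bilinear_ext R m f g \<oplus>\<^bsub>free_module R Z\<^esub> bilinear_ext R m f h"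
      by (simp add: free_module_simps(3) fun_eq_iff)
  next
    fix h assume h: "h \<in> carrier (free_module R X)"
    note hR = free_module_coeff_closed[OF h]
    let ?A = "{x. f x \<noteq> \<zero>} \<union> {x. h x \<noteq> \<zero>}"
    have A: "finite ?A" using sf h by (auto simp: free_module_simps)
    note sum = bilinear_ext_superset[OF _ g A sg _ order_refl]
    have "bilinear_ext R m (f \<oplus>\<^bsub>free_module R X\<^esub> h) g z = bilinear_ext R m f g z \<oplus> bilinear_ext R m h g z" for z
    proof -
      have "bilinear_ext R m (f \<oplus>\<^bsub>free_module R X\<^esub> h) g z =
          (\<Oplus> p \<in> ?A \<times> {y. g y \<noteq> \<zero>}. if m (fst p) (snd p) = z then (f \<oplus>\<^bsub>free_module R X\<^esub> h) (fst p) \<otimes> g (snd p) else \<zero>)"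
        by (intro sum FX.M.a_closed f h) (auto simp: free_module_simps(3))
      also have "\<dots> = (\<Oplus> p \<in> ?A \<times> {y. g y \<noteq> \<zero>}.
            (if m (fst p) (snd p) = z then f (fst p) \<otimes> g (snd p) else \<zero>) \<oplus>
            (if m (fst p) (snd p) = z then h (fst p) \<otimes> g (snd p) else \<zero>))"
        using fR gR hR by (intro finsum_cong') (auto simp: free_module_simps(3) l_distr)
      also have "\<dots> = bilinear_ext R m f g z \<oplus> bilinear_ext R m h g z"
        unfolding sum[OF f Un_upper1] sum[OF h Un_upper2]
        using fR gR hR by (intro finsum_addf) auto
      finally show ?thesis .
    qed
    then show "bilinear_ext R m (f \<oplus>\<^bsub>free_module R X\<^esub> h) g =
        bilinear_ext R m f g \<oplus>\<^bsub>free_module R Z\<^esub> bilinear_ext R m h g"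
      by (simp add: free_module_simps(3) fun_eq_iff)
  }
qed

lemma bilinear_ext_basis:
  assumes "x \<in> X" "y \<in> Y"
  shows "bilinear_ext R m (basis_elem R x) (basis_elem R y) = basis_elem R (m x y)"
proof
  fix z
  show "bilinear_ext R m (basis_elem R x) (basis_elem R y) z = basis_elem R (m x y) z"
  proof -
    have "bilinear_ext R m (basis_elem R x) (basis_elem R y) z =
        (\<Oplus> p \<in> {x} \<times> {y}. if m (fst p) (snd p) = z
          then basis_elem R x (fst p) \<otimes> basis_elem R y (snd p) else \<zero>)"
      using assms
      by (intro bilinear_ext_superset basis_elem_closed basis_elem_support) simp_all
    also have "\<dots> = basis_elem R (m x y) z"
      by (simp add: basis_elem_def)
    finally show ?thesis .
  qed
qed

end

end

section \<open>Bilinear maps\<close>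

lemma bilinear_map_linear:
  assumes "bilinear_map R M N P h"
  shows "x \<in> carrier M \<Longrightarrow> k \<in> linear_maps R L N \<Longrightarrow> (\<lambda>z. h x (k z)) \<in> linear_maps R L P"
    and "y \<in> carrier N \<Longrightarrow> k' \<in> linear_maps R L M \<Longrightarrow> (\<lambda>z. h (k' z) y) \<in> linear_maps R L P"
proof -
  show "(\<lambda>z. h x (k z)) \<in> linear_maps R L P"
    if "x \<in> carrier M" "k \<in> linear_maps R L N"
    using assms that by (auto simp: bilinear_map_def intro: linear_maps_comp[of k])
  show "(\<lambda>z. h (k' z) y) \<in> linear_maps R L P"
    if "y \<in> carrier N" "k' \<in> linear_maps R L M"
    using assms that by (auto simp: bilinear_map_def intro: linear_maps_comp[of k' _ _ _ "\<lambda>x. h x y"])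
qed

lemma bilinear_map_closed:
  "\<lbrakk>bilinear_map R M N P h; x \<in> carrier M; y \<in> carrier N\<rbrakk> \<Longrightarrow> h x y \<in> carrier P"
  unfolding bilinear_map_def by (auto dest: linear_mapsD(1))

text \<open>
  Bilinearity passes along surjections.  The surjections will be the projections to quotients, with
  \<open>k\<close> an operation on classes that is computed on representatives.
\<close>

lemma bilinear_map_surj_image:
  assumes M: "module R M" and N: "module R N"
    and h: "bilinear_map R M N P h"
    and \<pi>M: "\<pi>M \<in> linear_maps R M M'" "carrier M' = \<pi>M ` carrier M"
    and \<pi>N: "\<pi>N \<in> linear_maps R N N'" "carrier N' = \<pi>N ` carrier N"
    and \<pi>P: "\<pi>P \<in> linear_maps R P P'"
    and k: "\<And>x y. \<lbrakk>x \<in> carrier M; y \<in> carrier N\<rbrakk> \<Longrightarrow> k (\<pi>M x) (\<pi>N y) = \<pi>P (h x y)"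
  shows "bilinear_map R M' N' P' k"
proof -
  interpret M: module R M by (rule M)
  interpret N: module R N by (rule N)
  note lin_right = linear_mapsD[OF bilinear_map_linear(1)[OF h _ linear_maps_id]]
  note lin_left = linear_mapsD[OF bilinear_map_linear(2)[OF h _ linear_maps_id]]
  show ?thesis
    unfolding bilinear_map_def
  proof (intro conjI ballI)
    fix X assume "X \<in> carrier M'"
    then obtain x where x: "x \<in> carrier M" and X: "X = \<pi>M x" using \<pi>M(2) by auto
    show "k X \<in> linear_maps R N' P'"
      by (rule linear_mapsI)
        (auto simp: X x \<pi>N(2) k linear_mapsD[OF \<pi>P] lin_right[OF x] simp flip: linear_mapsD(2,3)[OF \<pi>N(1)])
  next
    fix Y assume "Y \<in> carrier N'"
    then obtain y where y: "y \<in> carrier N" and Y: "Y = \<pi>N y" using \<pi>N(2) by auto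
    show "(\<lambda>X. k X Y) \<in> linear_maps R M' P'"
      by (rule linear_mapsI)
        (auto simp: Y y \<pi>M(2) k linear_mapsD[OF \<pi>P] lin_left[OF y] simp flip: linear_mapsD(2,3)[OF \<pi>M(1)])
  qed
qed

section \<open>Linear categories, ideals and quotients\<close>

lemma lincat_idealD:
  assumes "lincat_ideal R C I"
  shows "\<lbrakk>a \<in> obj C; b \<in> obj C\<rbrakk> \<Longrightarrow> submodule (I a b) R (Hom C a b)"
    and "\<lbrakk>a \<in> obj C; b \<in> obj C; c \<in> obj C; f \<in> I a b; g \<in> mor C b c\<rbrakk> \<Longrightarrow> cmp C a b c g f \<in> I a c"
    and "\<lbrakk>a \<in> obj C; b \<in> obj C; c \<in> obj C; f \<in> mor C a b; g \<in> I b c\<rbrakk> \<Longrightarrow> cmp C a b c g f \<in> I a c"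
  using assms unfolding lincat_ideal_def by auto

lemma linear_functorD:
  assumes "linear_functor R C D F"
  shows "a \<in> obj C \<Longrightarrow> on_obj F a \<in> obj D"
    and "\<lbrakk>a \<in> obj C; b \<in> obj C\<rbrakk> \<Longrightarrow>
      on_mor F a b \<in> linear_maps R (Hom C a b) (Hom D (on_obj F a) (on_obj F b))"
    and "a \<in> obj C \<Longrightarrow> on_mor F a a (ident C a) = ident D (on_obj F a)"
    and "\<lbrakk>a \<in> obj C; b \<in> obj C; c \<in> obj C; f \<in> mor C a b; g \<in> mor C b c\<rbrakk> \<Longrightarrow>
      on_mor F a c (cmp C a b c g f) =
      cmp D (on_obj F a) (on_obj F b) (on_obj F c) (on_mor F b c g) (on_mor F a b f)"
  using assms unfolding linear_functor_def by auto

lemma gen_ideal_least: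
  assumes "lincat_ideal R C I" and "\<And>c d. \<lbrakk>c \<in> obj C; d \<in> obj C\<rbrakk> \<Longrightarrow> S c d \<subseteq> I c d"
  shows "gen_ideal R C S a b \<subseteq> I a b"
  using assms unfolding gen_ideal_def by blast

lemma gen_ideal_superset:
  "\<lbrakk>a \<in> obj C; b \<in> obj C\<rbrakk> \<Longrightarrow> S a b \<subseteq> gen_ideal R C S a b"
  unfolding gen_ideal_def by blast

context linear_category
begin

lemma cmp_closed:
  "\<lbrakk>a \<in> obj C; b \<in> obj C; c \<in> obj C; f \<in> mor C a b; g \<in> mor C b c\<rbrakk> \<Longrightarrow> cmp C a b c g f \<in> mor C a c"
  by (rule bilinear_map_closed[OF cmp_bilinear])

lemma Hom_ops_closed:
  assumes "a \<in> obj C" "b \<in> obj C" "f \<in> mor C a b"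
  shows "g \<in> mor C a b \<Longrightarrow> f \<oplus>\<^bsub>Hom C a b\<^esub> g \<in> mor C a b"
    and "r \<in> carrier R \<Longrightarrow> r \<odot>\<^bsub>Hom C a b\<^esub> f \<in> mor C a b"
proof -
  interpret H: module R "Hom C a b" by (rule Hom_module[OF assms(1,2)])
  show "g \<in> mor C a b \<Longrightarrow> f \<oplus>\<^bsub>Hom C a b\<^esub> g \<in> mor C a b"
    and "r \<in> carrier R \<Longrightarrow> r \<odot>\<^bsub>Hom C a b\<^esub> f \<in> mor C a b"
    using assms(3) by simp_all
qed

lemma linear_cmp:
  assumes "a \<in> obj C" "b \<in> obj C" "c \<in> obj C"
  shows "\<lbrakk>f \<in> mor C a b; h \<in> linear_maps R L (Hom C b c)\<rbrakk> \<Longrightarrow>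
      (\<lambda>x. cmp C a b c (h x) f) \<in> linear_maps R L (Hom C a c)"
    and "\<lbrakk>g \<in> mor C b c; h' \<in> linear_maps R L (Hom C a b)\<rbrakk> \<Longrightarrow>
      (\<lambda>x. cmp C a b c g (h' x)) \<in> linear_maps R L (Hom C a c)"
  using bilinear_map_linear[OF cmp_bilinear[OF assms]] by auto

lemma lincat_ideal_mor: "lincat_ideal R C (mor C)"
  unfolding lincat_ideal_def
  by (auto intro: cmp_closed module.carrier_is_submodule Hom_module)

lemma lincat_ideal_zero: "lincat_ideal R C (\<lambda>a b. {\<zero>\<^bsub>Hom C a b\<^esub>})"
  unfolding lincat_ideal_def
proof (intro conjI ballI)
  fix a b assume "a \<in> obj C" "b \<in> obj C"
  then show "submodule {\<zero>\<^bsub>Hom C a b\<^esub>} R (Hom C a b)"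
    by (intro submodule_zero Hom_module)
next
  fix a b c f g
  assume abc: "a \<in> obj C" "b \<in> obj C" "c \<in> obj C"
    and "f \<in> {\<zero>\<^bsub>Hom C a b\<^esub>}" and g: "g \<in> mor C b c"
  then show "cmp C a b c g f \<in> {\<zero>\<^bsub>Hom C a c\<^esub>}"
    using linear_maps_zero[OF _ _ linear_cmp(2)[OF abc g linear_maps_id]] Hom_module by simp
next
  fix a b c f g
  assume abc: "a \<in> obj C" "b \<in> obj C" "c \<in> obj C"
    and f: "f \<in> mor C a b" and "g \<in> {\<zero>\<^bsub>Hom C b c\<^esub>}"
  then show "cmp C a b c g f \<in> {\<zero>\<^bsub>Hom C a c\<^esub>}"
    using linear_maps_zero[OF _ _ linear_cmp(1)[OF abc f linear_maps_id]] Hom_module by simp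
qed

text \<open>
  Intersections of ideals are ideals.  As the family of all morphisms is one of the ideals that
  contain \<open>S\<close>, the intersection consists of morphisms.
\<close>

lemma lincat_ideal_gen_ideal:
  assumes S: "\<And>c d. \<lbrakk>c \<in> obj C; d \<in> obj C\<rbrakk> \<Longrightarrow> S c d \<subseteq> mor C c d"
  shows "lincat_ideal R C (gen_ideal R C S)"
proof -
  let ?\<I> = "{I. lincat_ideal R C I \<and> (\<forall>c\<in>obj C. \<forall>d\<in>obj C. S c d \<subseteq> I c d)}"
  have mem: "f \<in> gen_ideal R C S a b \<longleftrightarrow> (\<forall>I\<in>?\<I>. f \<in> I a b)" for f a b
    unfolding gen_ideal_def by blast
  have ideal: "lincat_ideal R C I" if "I \<in> ?\<I>" for I using that by simp
  have sub: "gen_ideal R C S a b \<subseteq> mor C a b" for a b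
    by (rule gen_ideal_least[OF lincat_ideal_mor S])
  show ?thesis
    unfolding lincat_ideal_def
  proof (intro conjI ballI)
    fix a b assume ab: "a \<in> obj C" "b \<in> obj C"
    interpret H: module R "Hom C a b" by (rule Hom_module[OF ab])
    note I = lincat_idealD(1)[OF ideal ab]
    show "submodule (gen_ideal R C S a b) R (Hom C a b)"
    proof (rule H.submoduleI)
      show "\<zero>\<^bsub>Hom C a b\<^esub> \<in> gen_ideal R C S a b"
        unfolding mem using subgroup.one_closed[OF submodule.axioms(1)[OF I]] by simp
    qed (use sub H.submoduleE[OF I] in \<open>auto simp: mem\<close>)
  qed (use sub in \<open>auto simp: mem subset_iff intro: lincat_idealD(2,3)\<close>)
qed

end

lemma lincat_ideal_preimage:
  assumes C: "linear_category R C" and D: "linear_category R D"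
    and F: "linear_functor R C D F" and J: "lincat_ideal R D J"
  shows "lincat_ideal R C (\<lambda>a b. {f \<in> mor C a b. on_mor F a b f \<in> J (on_obj F a) (on_obj F b)})"
proof -
  interpret C: linear_category R C by (rule C)
  interpret D: linear_category R D by (rule D)
  note F_closed = linear_mapsD(1)[OF linear_functorD(2)[OF F]]
  show ?thesis
    unfolding lincat_ideal_def
    by (auto simp: linear_functorD(1,4)[OF F] F_closed lincat_idealD(2,3)[OF J] C.cmp_closed
      intro!: submodule_preimage[OF C.Hom_module D.Hom_module linear_functorD(2)[OF F] lincat_idealD(1)[OF J]])
qed

text \<open>
  Since preimages of ideals are ideals, it suffices to look at generators.  For the zero ideal \<open>J\<close>
  this says that a functor that kills the generators kills the ideal.
\<close>

lemma linear_functor_gen_ideal: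
  assumes C: "linear_category R C" and D: "linear_category R D"
    and F: "linear_functor R C D F" and J: "lincat_ideal R D J"
    and S: "\<And>c d. \<lbrakk>c \<in> obj C; d \<in> obj C\<rbrakk> \<Longrightarrow> S c d \<subseteq> mor C c d"
    and FS: "\<And>c d f. \<lbrakk>c \<in> obj C; d \<in> obj C; f \<in> S c d\<rbrakk> \<Longrightarrow> on_mor F c d f \<in> J (on_obj F c) (on_obj F d)"
    and f: "f \<in> gen_ideal R C S a b"
  shows "on_mor F a b f \<in> J (on_obj F a) (on_obj F b)"
  using gen_ideal_least[OF lincat_ideal_preimage[OF C D F J], of S a b] S FS f by blast

locale lincat_quotient = linear_category R C
  for R :: "('k, 'r) ring_scheme" and C :: "('k, 'o, 'm) lincat" +
  fixes I :: "'o \<Rightarrow> 'o \<Rightarrow> 'm set"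
  assumes ideal: "lincat_ideal R C I"
begin

abbreviation cls :: "'o \<Rightarrow> 'o \<Rightarrow> 'm \<Rightarrow> 'm set" where
  "cls \<equiv> mor_class C I"

lemma abelian_subgroup_ideal:
  assumes "a \<in> obj C" "b \<in> obj C" shows "abelian_subgroup (I a b) (Hom C a b)"
  using lincat_idealD(1)[OF ideal assms] Hom_module[OF assms]
  by (auto intro!: abelian_subgroupI3 additive_subgroupI simp: submodule_def module_def)

lemma mem_cls_iff:
  assumes ab: "a \<in> obj C" "b \<in> obj C" and f: "f \<in> mor C a b"
  shows "g \<in> cls a b f \<longleftrightarrow> g \<in> mor C a b \<and> cls a b g = cls a b f"
proof -
  interpret H: module R "Hom C a b" by (rule Hom_module[OF ab])
  interpret I: abelian_subgroup "I a b" "Hom C a b" by (rule abelian_subgroup_ideal[OF ab])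
  have "cls a b g = cls a b f" if "g \<in> cls a b f"
    using that H.M.a_repr_independence' f I.a_subgroup
    unfolding mor_class_def a_r_coset_def by metis
  moreover have "g \<in> mor C a b" if "g \<in> cls a b f"
    using I.a_elemrcos_carrier[OF f] that by (simp add: mor_class_def)
  moreover have "g \<in> cls a b g" if "g \<in> mor C a b"
    using I.a_rcos_self[OF that] by (simp add: mor_class_def)
  ultimately show ?thesis by blast
qed

lemma cls_eq_iff:
  assumes ab: "a \<in> obj C" "b \<in> obj C" and f: "f \<in> mor C a b" and g: "g \<in> mor C a b"
  shows "cls a b f = cls a b g \<longleftrightarrow> f \<ominus>\<^bsub>Hom C a b\<^esub> g \<in> I a b"
proof -
  interpret H: module R "Hom C a b" by (rule Hom_module[OF ab])
  interpret I: abelian_subgroup "I a b" "Hom C a b" by (rule abelian_subgroup_ideal[OF ab])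
  have "cls a b f = cls a b g \<longleftrightarrow> f \<in> cls a b g"
    using mem_cls_iff[OF ab g] f by simp
  also have "\<dots> \<longleftrightarrow> f \<ominus>\<^bsub>Hom C a b\<^esub> g \<in> I a b"
    unfolding mor_class_def a_minus_def by (rule I.a_rcos_module[OF g f])
  finally show ?thesis .
qed

text \<open>
  The unions by which operations on classes are defined collapse to a single class when the
  operation respects classes.
\<close>

lemma UN_cls:
  assumes "a \<in> obj C" "b \<in> obj C" "f \<in> mor C a b"
    and "\<And>f'. \<lbrakk>f' \<in> mor C a b; cls a b f' = cls a b f\<rbrakk> \<Longrightarrow> T f' = T f"
  shows "(\<Union>f'\<in>cls a b f. T f') = T f"
  using assms(4) mem_cls_iff[OF assms(1-3)] assms(3) by blast

lemma obj_quot [simp]: "obj (quot_lincat C I) = obj C"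
  by (simp add: quot_lincat_def)

lemma mor_quot:
  "a \<in> obj C \<Longrightarrow> b \<in> obj C \<Longrightarrow> mor (quot_lincat C I) a b = cls a b ` mor C a b"
  by (auto simp: quot_lincat_def quot_module_def A_RCOSETS_def' mor_class_def)

lemma Hom_quot_ops:
  assumes ab: "a \<in> obj C" "b \<in> obj C"
  shows "\<zero>\<^bsub>Hom (quot_lincat C I) a b\<^esub> = cls a b \<zero>\<^bsub>Hom C a b\<^esub>"
    and "\<lbrakk>f \<in> mor C a b; g \<in> mor C a b\<rbrakk> \<Longrightarrow>
      cls a b f \<oplus>\<^bsub>Hom (quot_lincat C I) a b\<^esub> cls a b g = cls a b (f \<oplus>\<^bsub>Hom C a b\<^esub> g)"
    and "\<lbrakk>r \<in> carrier R; f \<in> mor C a b\<rbrakk> \<Longrightarrow>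
      r \<odot>\<^bsub>Hom (quot_lincat C I) a b\<^esub> cls a b f = cls a b (r \<odot>\<^bsub>Hom C a b\<^esub> f)"
proof -
  interpret H: module R "Hom C a b" by (rule Hom_module[OF ab])
  interpret I: abelian_subgroup "I a b" "Hom C a b" by (rule abelian_subgroup_ideal[OF ab])
  show "\<zero>\<^bsub>Hom (quot_lincat C I) a b\<^esub> = cls a b \<zero>\<^bsub>Hom C a b\<^esub>"
    using I.a_subset by (simp add: quot_lincat_def quot_module_def mor_class_def)
  show "cls a b f \<oplus>\<^bsub>Hom (quot_lincat C I) a b\<^esub> cls a b g = cls a b (f \<oplus>\<^bsub>Hom C a b\<^esub> g)"
    if "f \<in> mor C a b" "g \<in> mor C a b"
    using that by (simp add: quot_lincat_def quot_module_def mor_class_def I.a_rcos_sum)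
  assume r: "r \<in> carrier R" and f: "f \<in> mor C a b"
  have "(\<Union>f'\<in>cls a b f. cls a b (r \<odot>\<^bsub>Hom C a b\<^esub> f')) = cls a b (r \<odot>\<^bsub>Hom C a b\<^esub> f)"
  proof (rule UN_cls[OF ab f])
    fix f' assume f': "f' \<in> mor C a b" "cls a b f' = cls a b f"
    have "r \<odot>\<^bsub>Hom C a b\<^esub> f' \<ominus>\<^bsub>Hom C a b\<^esub> r \<odot>\<^bsub>Hom C a b\<^esub> f = r \<odot>\<^bsub>Hom C a b\<^esub> (f' \<ominus>\<^bsub>Hom C a b\<^esub> f)"
      using r f f' by (simp add: a_minus_def H.smult_r_distr H.smult_r_minus)
    then show "cls a b (r \<odot>\<^bsub>Hom C a b\<^esub> f') = cls a b (r \<odot>\<^bsub>Hom C a b\<^esub> f)"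
      using r f f' H.submoduleE(4)[OF lincat_idealD(1)[OF ideal ab] r] by (simp add: cls_eq_iff[OF ab])
  qed
  then show "r \<odot>\<^bsub>Hom (quot_lincat C I) a b\<^esub> cls a b f = cls a b (r \<odot>\<^bsub>Hom C a b\<^esub> f)"
    by (simp add: quot_lincat_def quot_module_def mor_class_def)
qed

lemma
  assumes ab: "a \<in> obj C" "b \<in> obj C"
  shows Hom_quot_module: "module R (Hom (quot_lincat C I) a b)"
    and cls_linear: "cls a b \<in> linear_maps R (Hom C a b) (Hom (quot_lincat C I) a b)"
  using module_surj_image[OF Hom_module[OF ab] mor_quot[OF ab] Hom_quot_ops[OF ab]] by auto

lemma cmp_quot:
  assumes abc: "a \<in> obj C" "b \<in> obj C" "c \<in> obj C" and f: "f \<in> mor C a b" and g: "g \<in> mor C b c"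
  shows "cmp (quot_lincat C I) a b c (cls b c g) (cls a b f) = cls a c (cmp C a b c g f)"
proof -
  interpret ab: module R "Hom C a b" by (rule Hom_module[OF abc(1,2)])
  interpret bc: module R "Hom C b c" by (rule Hom_module[OF abc(2,3)])
  have left: "cls a c (cmp C a b c g' f') = cls a c (cmp C a b c g f')"
    if "f' \<in> mor C a b" "g' \<in> mor C b c" "cls b c g' = cls b c g" for f' g'
  proof -
    have "cmp C a b c g' f' \<ominus>\<^bsub>Hom C a c\<^esub> cmp C a b c g f' = cmp C a b c (g' \<ominus>\<^bsub>Hom C b c\<^esub> g) f'"
      using abc g that by (intro linear_maps_minus[where R = R, symmetric] linear_cmp(1) linear_maps_id Hom_module)
    then show ?thesis
      using abc f g that cls_eq_iff cmp_closed lincat_idealD(3)[OF ideal] by auto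
  qed
  have right: "cls a c (cmp C a b c g f') = cls a c (cmp C a b c g f)"
    if "f' \<in> mor C a b" "cls a b f' = cls a b f" for f'
  proof -
    have "cmp C a b c g f' \<ominus>\<^bsub>Hom C a c\<^esub> cmp C a b c g f = cmp C a b c g (f' \<ominus>\<^bsub>Hom C a b\<^esub> f)"
      using abc g f that by (intro linear_maps_minus[where R = R, symmetric] linear_cmp(2) linear_maps_id Hom_module)
    then show ?thesis
      using abc f g that cls_eq_iff cmp_closed lincat_idealD(2)[OF ideal] by auto
  qed
  have UN_f: "(\<Union>f'\<in>cls a b f. cls a c (cmp C a b c g' f')) = cls a c (cmp C a b c g f)"
    if g': "g' \<in> mor C b c" "cls b c g' = cls b c g" for g'
  proof -
    have "(\<Union>f'\<in>cls a b f. cls a c (cmp C a b c g' f')) = cls a c (cmp C a b c g' f)"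
    proof (rule UN_cls[OF abc(1,2) f])
      fix f' assume f': "f' \<in> mor C a b" "cls a b f' = cls a b f"
      show "cls a c (cmp C a b c g' f') = cls a c (cmp C a b c g' f)"
        unfolding left[OF f'(1) g'] left[OF f g'] by (rule right[OF f'])
    qed
    then show ?thesis unfolding left[OF f g'] .
  qed
  have "(\<Union>g'\<in>cls b c g. \<Union>f'\<in>cls a b f. cls a c (cmp C a b c g' f')) =
      (\<Union>f'\<in>cls a b f. cls a c (cmp C a b c g f'))"
    by (rule UN_cls[OF abc(2,3) g]) (simp only: UN_f g)
  then show ?thesis
    using UN_f[OF g refl] by (simp add: quot_lincat_def)
qed

lemma ident_quot: "ident (quot_lincat C I) a = cls a a (ident C a)"
  by (simp add: quot_lincat_def)

lemma mor_quotE: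
  assumes "X \<in> mor (quot_lincat C I) a b" "a \<in> obj C" "b \<in> obj C"
  obtains f where "f \<in> mor C a b" "X = cls a b f"
  using assms by (auto simp: mor_quot)

lemma cls_closed: "\<lbrakk>a \<in> obj C; b \<in> obj C; f \<in> mor C a b\<rbrakk> \<Longrightarrow> cls a b f \<in> mor (quot_lincat C I) a b"
  by (simp add: mor_quot)

lemma linear_category_quot: "linear_category R (quot_lincat C I)"
proof (rule linear_category.intro[OF cring_axioms linear_category_axioms.intro], unfold obj_quot)
  fix a b c assume abc: "a \<in> obj C" "b \<in> obj C" "c \<in> obj C"
  show "bilinear_map R (Hom (quot_lincat C I) b c) (Hom (quot_lincat C I) a b)
      (Hom (quot_lincat C I) a c) (cmp (quot_lincat C I) a b c)"
    by (rule bilinear_map_surj_image[OF Hom_module Hom_module cmp_bilinear cls_linear mor_quot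
          cls_linear mor_quot cls_linear cmp_quot]) (use abc in auto)
next
  fix a b c d F G H
  assume abcd: "a \<in> obj C" "b \<in> obj C" "c \<in> obj C" "d \<in> obj C"
    and "F \<in> mor (quot_lincat C I) a b" "G \<in> mor (quot_lincat C I) b c" "H \<in> mor (quot_lincat C I) c d"
  then obtain f g h where "F = cls a b f" "G = cls b c g" "H = cls c d h"
    and "f \<in> mor C a b" "g \<in> mor C b c" "h \<in> mor C c d"
    by (auto simp: mor_quot)
  then show "cmp (quot_lincat C I) a b d (cmp (quot_lincat C I) b c d H G) F =
      cmp (quot_lincat C I) a c d H (cmp (quot_lincat C I) a b c G F)"
    using abcd by (simp add: cmp_quot cmp_closed cmp_assoc)
qed (auto simp: Hom_quot_module ident_quot cls_closed ident_closed cmp_quot cmp_ident_left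
    cmp_ident_right elim!: mor_quotE)

lemma cls_functor_cong:
  assumes F: "linear_functor R C C F"
    and F_ideal: "\<And>f. f \<in> I a b \<Longrightarrow> on_mor F a b f \<in> I (on_obj F a) (on_obj F b)"
    and ab: "a \<in> obj C" "b \<in> obj C" and f: "f \<in> mor C a b" and g: "g \<in> mor C a b"
    and eq: "cls a b f = cls a b g"
  shows "cls (on_obj F a) (on_obj F b) (on_mor F a b f) = cls (on_obj F a) (on_obj F b) (on_mor F a b g)"
proof -
  note Fab = linear_functorD(1)[OF F ab(1)] linear_functorD(1)[OF F ab(2)]
  note lin = linear_functorD(2)[OF F ab]
  have "on_mor F a b f \<ominus>\<^bsub>Hom C (on_obj F a) (on_obj F b)\<^esub> on_mor F a b g \<in> I (on_obj F a) (on_obj F b)"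
    using F_ideal eq cls_eq_iff[OF ab f g]
      linear_maps_minus[OF Hom_module[OF ab] Hom_module[OF Fab] lin f g] by metis
  then show ?thesis
    using cls_eq_iff[OF Fab] linear_mapsD(1)[OF lin] f g by blast
qed

text \<open>
  The functor induced by \<open>F\<close> on the quotient evaluates \<open>F\<close> on an arbitrary representative; if \<open>F\<close>
  kills the ideal, the choice does not matter.
\<close>

definition quot_functor :: "('o, 'm, 'p, 'n) cat_functor \<Rightarrow> ('o, 'm set, 'p, 'n) cat_functor" where
  "quot_functor F = \<lparr>on_obj = on_obj F, on_mor = (\<lambda>a b X. on_mor F a b (SOME f. f \<in> X))\<rparr>"

lemma on_obj_quot_functor [simp]: "on_obj (quot_functor F) = on_obj F"
  by (simp add: quot_functor_def)

lemma
  assumes D: "linear_category R D" and F: "linear_functor R C D F"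
    and kill: "\<And>a b f. \<lbrakk>a \<in> obj C; b \<in> obj C; f \<in> I a b\<rbrakk> \<Longrightarrow>
      on_mor F a b f = \<zero>\<^bsub>Hom D (on_obj F a) (on_obj F b)\<^esub>"
  shows quot_functor_cls: "\<lbrakk>a \<in> obj C; b \<in> obj C; f \<in> mor C a b\<rbrakk> \<Longrightarrow>
      on_mor (quot_functor F) a b (cls a b f) = on_mor F a b f"
    and linear_functor_quot: "linear_functor R (quot_lincat C I) D (quot_functor F)"
proof -
  interpret D: linear_category R D by (rule D)
  show on_cls: "on_mor (quot_functor F) a b (cls a b f) = on_mor F a b f"
    if ab: "a \<in> obj C" "b \<in> obj C" and f: "f \<in> mor C a b" for a b f
  proof -
    let ?D = "Hom D (on_obj F a) (on_obj F b)"
    interpret C: module R "Hom C a b" by (rule Hom_module[OF ab])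
    interpret D': module R ?D by (rule D.Hom_module) (simp_all add: linear_functorD(1)[OF F] ab)
    define f' where "f' = (SOME f'. f' \<in> cls a b f)"
    have "f \<in> cls a b f"
      using mem_cls_iff[OF ab f] f by blast
    then have "f' \<in> cls a b f"
      unfolding f'_def by (rule someI)
    then have f': "f' \<in> mor C a b" "f' \<ominus>\<^bsub>Hom C a b\<^esub> f \<in> I a b"
      using mem_cls_iff[OF ab f] cls_eq_iff[OF ab _ f] by blast+
    note lin = linear_functorD(2)[OF F ab]
    have "on_mor F a b f' \<ominus>\<^bsub>?D\<^esub> on_mor F a b f = \<zero>\<^bsub>?D\<^esub>"
      using linear_maps_minus[OF C.module_axioms D'.module_axioms lin f'(1) f] kill[OF ab f'(2)] by simp
    then have "on_mor F a b f' = on_mor F a b f"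
      using linear_mapsD(1)[OF lin f] linear_mapsD(1)[OF lin f'(1)]
      by (metis a_minus_def D'.M.minus_equality D'.M.minus_minus D'.M.a_inv_closed)
    then show ?thesis by (simp add: quot_functor_def f'_def)
  qed
  show "linear_functor R (quot_lincat C I) D (quot_functor F)"
    unfolding linear_functor_def
  proof (intro conjI ballI, unfold obj_quot on_obj_quot_functor)
    fix a b assume ab: "a \<in> obj C" "b \<in> obj C"
    note lin = linear_mapsD[OF linear_functorD(2)[OF F ab]]
    show "on_mor (quot_functor F) a b \<in>
        linear_maps R (Hom (quot_lincat C I) a b) (Hom D (on_obj F a) (on_obj F b))"
    proof (rule linear_mapsI)
      fix X assume "X \<in> mor (quot_lincat C I) a b"
      then obtain f where f: "f \<in> mor C a b" and X: "X = cls a b f" by (rule mor_quotE[OF _ ab])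
      show "on_mor (quot_functor F) a b X \<in> mor D (on_obj F a) (on_obj F b)"
        by (simp add: X on_cls ab f lin)
      show "on_mor (quot_functor F) a b (r \<odot>\<^bsub>Hom (quot_lincat C I) a b\<^esub> X) =
          r \<odot>\<^bsub>Hom D (on_obj F a) (on_obj F b)\<^esub> on_mor (quot_functor F) a b X" if "r \<in> carrier R" for r
        by (simp add: X on_cls Hom_quot_ops Hom_ops_closed ab f that lin)
      fix Y assume "Y \<in> mor (quot_lincat C I) a b"
      then obtain g where g: "g \<in> mor C a b" and Y: "Y = cls a b g" by (rule mor_quotE[OF _ ab])
      show "on_mor (quot_functor F) a b (X \<oplus>\<^bsub>Hom (quot_lincat C I) a b\<^esub> Y) =
          on_mor (quot_functor F) a b X \<oplus>\<^bsub>Hom D (on_obj F a) (on_obj F b)\<^esub> on_mor (quot_functor F) a b Y"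
        by (simp add: X Y on_cls Hom_quot_ops Hom_ops_closed ab f g lin)
    qed
  next
    fix a b c X Y
    assume abc: "a \<in> obj C" "b \<in> obj C" "c \<in> obj C"
      and "X \<in> mor (quot_lincat C I) a b" "Y \<in> mor (quot_lincat C I) b c"
    then obtain f g where "X = cls a b f" "Y = cls b c g" and fg: "f \<in> mor C a b" "g \<in> mor C b c"
      by (auto simp: mor_quot)
    then show "on_mor (quot_functor F) a c (cmp (quot_lincat C I) a b c Y X) =
        cmp D (on_obj F a) (on_obj F b) (on_obj F c) (on_mor (quot_functor F) b c Y) (on_mor (quot_functor F) a b X)"
      using abc by (simp add: cmp_quot on_cls cmp_closed linear_functorD(4)[OF F abc fg])
  next
    fix a assume "a \<in> obj C"
    then show "on_mor (quot_functor F) a a (ident (quot_lincat C I) a) = ident D (on_obj F a)"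
      by (simp add: ident_quot on_cls ident_closed linear_functorD(3)[OF F])
  qed (use linear_functorD(1)[OF F] in auto)
qed

end

section \<open>Free linear categories\<close>

lemma free_lincat_simps:
  "obj (free_lincat R G) = verts G"
  "Hom (free_lincat R G) a b = free_module R {p. pre_digraph.awalk G a p b}"
  "cmp (free_lincat R G) a b c = bilinear_ext R (\<lambda>q p. p @ q)"
  "ident (free_lincat R G) a = basis_elem R []"
  by (simp_all add: free_lincat_def fun_eq_iff)

locale free_linear_category = cring R + G: wf_digraph G
  for R :: "('k, 'r) ring_scheme" and G :: "('v, 'e) pre_digraph"
begin

abbreviation L :: "('k, 'v, 'e list \<Rightarrow> 'k) lincat" where
  "L \<equiv> free_lincat R G"

lemma path_closed: "G.awalk a p b \<Longrightarrow> basis_elem R p \<in> mor L a b"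
  by (simp add: free_lincat_simps basis_elem_closed)

lemma mor_span: "spans R (Hom L a b) (basis_elem R ` {p. G.awalk a p b})"
  unfolding free_lincat_simps by (rule free_module_span)

lemma L_module: "module R (Hom L a b)"
  by (simp add: free_lincat_simps module_free_module)

lemma linear_eq_on_paths:
  assumes "module R N" "h \<in> linear_maps R (Hom L a b) N" "k \<in> linear_maps R (Hom L a b) N"
    and "\<And>p. G.awalk a p b \<Longrightarrow> h (basis_elem R p) = k (basis_elem R p)" and "f \<in> mor L a b"
  shows "h f = k f"
  by (rule linear_maps_eq_on_span[OF L_module assms(1) mor_span assms(2,3)]) (use assms in auto)

lemma cmp_path:
  "\<lbrakk>G.awalk a p b; G.awalk b q c\<rbrakk> \<Longrightarrow>
    cmp L a b c (basis_elem R q) (basis_elem R p) = basis_elem R (p @ q)"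
  unfolding free_lincat_simps
  by (rule bilinear_ext_basis[where X = "{q. G.awalk b q c}" and Y = "{p. G.awalk a p b}" and Z = UNIV]) auto

lemma L_cmp_bilinear: "bilinear_map R (Hom L b c) (Hom L a b) (Hom L a c) (cmp L a b c)"
  unfolding free_lincat_simps by (rule bilinear_ext_bilinear) auto

text \<open>
  The axioms are multilinear, and on paths they are the monoid laws of list concatenation.  For
  associativity the arguments are released from being paths one after the other.
\<close>

lemma linear_category_free: "linear_category R L"
proof (rule linear_category.intro[OF cring_axioms linear_category_axioms.intro])
  note lin = bilinear_map_linear[OF L_cmp_bilinear] linear_maps_id
  fix a b c d f g h
  assume f: "f \<in> mor L a b" and g: "g \<in> mor L b c" and h: "h \<in> mor L c d"
  note cl = bilinear_map_closed[OF L_cmp_bilinear] path_closed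
  have 1: "cmp L a b d (cmp L b c d (basis_elem R r) (basis_elem R q)) f =
      cmp L a c d (basis_elem R r) (cmp L a b c (basis_elem R q) f)"
    if "G.awalk b q c" "G.awalk c r d" for q r
    by (rule linear_eq_on_paths[OF L_module _ _ _ f])
      (use that in \<open>auto intro!: lin cl simp: cmp_path[of a _ b] cmp_path[of b _ c] cmp_path[of a _ c] cmp_path[of b _ d]\<close>)
  have 2: "cmp L a b d (cmp L b c d (basis_elem R r) g) f = cmp L a c d (basis_elem R r) (cmp L a b c g f)"
    if "G.awalk c r d" for r
    by (rule linear_eq_on_paths[OF L_module _ _ _ g]) (use that f 1 in \<open>auto intro!: lin cl\<close>)
  show "cmp L a b d (cmp L b c d h g) f = cmp L a c d h (cmp L a b c g f)"
    by (rule linear_eq_on_paths[OF L_module _ _ _ h]) (use f g 2 in \<open>auto intro!: lin cl\<close>)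
next
  note lin = bilinear_map_linear[OF L_cmp_bilinear] linear_maps_id
  fix a b f assume ab: "a \<in> obj L" "b \<in> obj L" and f: "f \<in> mor L a b"
  have ab': "G.awalk a [] a" "G.awalk b [] b"
    using ab by (simp_all add: free_lincat_simps G.awalk_Nil_iff)
  show "cmp L a b b (ident L b) f = f" unfolding free_lincat_simps(4)
    by (rule linear_eq_on_paths[OF L_module _ _ _ f])
      (use ab' in \<open>auto intro!: lin path_closed simp: cmp_path[OF _ ab'(2)]\<close>)
  show "cmp L a a b f (ident L a) = f" unfolding free_lincat_simps(4)
    by (rule linear_eq_on_paths[OF L_module _ _ _ f])
      (use ab' in \<open>auto intro!: lin path_closed simp: cmp_path[OF ab'(1)]\<close>)
qed (auto simp: L_module L_cmp_bilinear, auto simp: free_lincat_simps G.awalk_Nil_iff basis_elem_closed)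

text \<open>
  Both sides of the composition law are bilinear, so it suffices to compare them on paths.
\<close>

lemma linear_functor_freeI:
  assumes D: "linear_category R D"
    and obj: "\<And>a. a \<in> verts G \<Longrightarrow> on_obj F a \<in> obj D"
    and lin: "\<And>a b. \<lbrakk>a \<in> verts G; b \<in> verts G\<rbrakk> \<Longrightarrow>
      on_mor F a b \<in> linear_maps R (Hom L a b) (Hom D (on_obj F a) (on_obj F b))"
    and id: "\<And>a. a \<in> verts G \<Longrightarrow> on_mor F a a (basis_elem R []) = ident D (on_obj F a)"
    and cmp: "\<And>a b c p q. \<lbrakk>G.awalk a p b; G.awalk b q c\<rbrakk> \<Longrightarrow>
      on_mor F a c (basis_elem R (p @ q)) =
      cmp D (on_obj F a) (on_obj F b) (on_obj F c)
        (on_mor F b c (basis_elem R q)) (on_mor F a b (basis_elem R p))"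
  shows "linear_functor R L D F"
  unfolding linear_functor_def
proof (intro conjI ballI)
  interpret L: linear_category R L by (rule linear_category_free)
  interpret D: linear_category R D by (rule D)
  fix a b c f g assume abc: "a \<in> obj L" "b \<in> obj L" "c \<in> obj L"
    and f: "f \<in> mor L a b" and g: "g \<in> mor L b c"
  have v: "a \<in> verts G" "b \<in> verts G" "c \<in> verts G"
    using abc by (simp_all add: free_lincat_simps(1))
  note D' = obj[OF v(1)] obj[OF v(2)] obj[OF v(3)]
  note closed = linear_mapsD(1)[OF lin]
  have 1: "on_mor F a c (cmp L a b c (basis_elem R q) f) =
      cmp D (on_obj F a) (on_obj F b) (on_obj F c) (on_mor F b c (basis_elem R q)) (on_mor F a b f)"
    if q: "G.awalk b q c" for q
  proof (rule linear_eq_on_paths[OF D.Hom_module[OF D'(1,3)] _ _ _ f])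
    show "(\<lambda>f. on_mor F a c (cmp L a b c (basis_elem R q) f))
        \<in> linear_maps R (Hom L a b) (Hom D (on_obj F a) (on_obj F c))"
      using abc v q
      by (intro linear_maps_comp[OF _ lin] L.linear_cmp linear_maps_id path_closed) auto
    show "(\<lambda>f. cmp D (on_obj F a) (on_obj F b) (on_obj F c) (on_mor F b c (basis_elem R q)) (on_mor F a b f))
        \<in> linear_maps R (Hom L a b) (Hom D (on_obj F a) (on_obj F c))"
      using v q by (intro D.linear_cmp D' lin closed path_closed)
  qed (use q in \<open>simp add: cmp cmp_path[of a _ b _ c]\<close>)
  show "on_mor F a c (cmp L a b c g f) =
      cmp D (on_obj F a) (on_obj F b) (on_obj F c) (on_mor F b c g) (on_mor F a b f)"
  proof (rule linear_eq_on_paths[OF D.Hom_module[OF D'(1,3)] _ _ _ g])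
    show "(\<lambda>g. on_mor F a c (cmp L a b c g f))
        \<in> linear_maps R (Hom L b c) (Hom D (on_obj F a) (on_obj F c))"
      using abc v f
      by (intro linear_maps_comp[OF _ lin] L.linear_cmp linear_maps_id) auto
    show "(\<lambda>g. cmp D (on_obj F a) (on_obj F b) (on_obj F c) (on_mor F b c g) (on_mor F a b f))
        \<in> linear_maps R (Hom L b c) (Hom D (on_obj F a) (on_obj F c))"
      using v f by (intro D.linear_cmp D' lin closed)
  qed (rule 1, simp)
qed (auto simp: obj lin id free_lincat_simps(1,4))

end

section \<open>Whiskering of paths\<close>

locale mon_quiver_construction = cring R + Q: mon_quiver Q
  for R :: "('k, 'r) ring_scheme" and Q :: "('v, 'e) mon_quiver"
begin

abbreviation tens :: "'v \<Rightarrow> 'v \<Rightarrow> 'v" (infixl "\<cdot>" 70) where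
  "a \<cdot> b \<equiv> a \<otimes>\<^bsub>vmonoid Q\<^esub> b"

abbreviation V :: "'v set" where "V \<equiv> verts (quiver Q)"
abbreviation E :: "'e set" where "E \<equiv> arcs (quiver Q)"
abbreviation \<epsilon> :: 'v where "\<epsilon> \<equiv> \<one>\<^bsub>vmonoid Q\<^esub>"

lemma V_monoid [simp]:
  "\<epsilon> \<in> V"
  "\<lbrakk>a \<in> V; b \<in> V\<rbrakk> \<Longrightarrow> a \<cdot> b \<in> V"
  "a \<in> V \<Longrightarrow> \<epsilon> \<cdot> a = a"
  "a \<in> V \<Longrightarrow> a \<cdot> \<epsilon> = a"
  "\<lbrakk>a \<in> V; b \<in> V; c \<in> V\<rbrakk> \<Longrightarrow> a \<cdot> b \<cdot> c = a \<cdot> (b \<cdot> c)"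
  using Q.one_closed Q.m_closed Q.l_one Q.r_one Q.m_assoc by (simp_all add: Q.carrier_vmonoid)

lemma bar_quiver_simps [simp]:
  "verts (bar_quiver Q) = V"
  "arcs (bar_quiver Q) = V \<times> E \<times> V"
  "tail (bar_quiver Q) (v, e, w) = v \<cdot> tail (quiver Q) e \<cdot> w"
  "head (bar_quiver Q) (v, e, w) = v \<cdot> head (quiver Q) e \<cdot> w"
  by (simp_all add: bar_quiver_def)

lemma wf_digraph_bar_quiver: "wf_digraph (bar_quiver Q)"
  by unfold_locales auto

sublocale P: free_linear_category R "bar_quiver Q"
  by (rule free_linear_category.intro[OF cring_axioms wf_digraph_bar_quiver])

abbreviation path :: "'v \<Rightarrow> ('v \<times> 'e \<times> 'v) list \<Rightarrow> 'v \<Rightarrow> bool" where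
  "path \<equiv> P.G.awalk"

abbreviation wl :: "'v \<Rightarrow> ('v \<times> 'e \<times> 'v) list \<Rightarrow> ('v \<times> 'e \<times> 'v) list" where
  "wl \<equiv> whisker_left Q"

abbreviation wr :: "('v \<times> 'e \<times> 'v) list \<Rightarrow> 'v \<Rightarrow> ('v \<times> 'e \<times> 'v) list" where
  "wr \<equiv> whisker_right Q"

lemma path_verts: "path a p b \<Longrightarrow> a \<in> V" "path a p b \<Longrightarrow> b \<in> V"
  using P.G.awalk_hd_in_verts P.G.awalk_last_in_verts by auto

lemma path_Nil [simp]: "path a [] b \<longleftrightarrow> a = b \<and> a \<in> V"
  by (simp add: P.G.awalk_Nil_iff)

lemma path_Cons: "path a (\<alpha> # p) b \<longleftrightarrow>
    \<alpha> \<in> V \<times> E \<times> V \<and> a = tail (bar_quiver Q) \<alpha> \<and> path (head (bar_quiver Q) \<alpha>) p b"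
  by (simp add: P.G.awalk_Cons_iff)

lemma path_append: "\<lbrakk>path a p b; path b q c\<rbrakk> \<Longrightarrow> path a (p @ q) c"
  by (induction p arbitrary: a) (auto simp: path_Cons)

lemma path_arcs: "path a p b \<Longrightarrow> set p \<subseteq> V \<times> E \<times> V"
  by (auto simp: pre_digraph.awalk_def)

lemma whisker_Nil [simp]: "wl x [] = []" "wr [] x = []"
  by (simp_all add: whisker_left_def whisker_right_def)

lemma whisker_append [simp]: "wl x (p @ q) = wl x p @ wl x q" "wr (p @ q) x = wr p x @ wr q x"
  by (simp_all add: whisker_left_def whisker_right_def)

lemma path_wl: "\<lbrakk>path a p b; x \<in> V\<rbrakk> \<Longrightarrow> path (x \<cdot> a) (wl x p) (x \<cdot> b)"
  by (induction p arbitrary: a) (auto simp: path_Cons whisker_left_def)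

lemma path_wr: "\<lbrakk>path a p b; x \<in> V\<rbrakk> \<Longrightarrow> path (a \<cdot> x) (wr p x) (b \<cdot> x)"
proof (induction p arbitrary: a)
  case (Cons \<alpha> p)
  obtain v e w where \<alpha>: "\<alpha> = (v, e, w)" by (cases \<alpha>)
  have "path (head (bar_quiver Q) \<alpha> \<cdot> x) (wr p x) (b \<cdot> x)"
    using Cons by (simp add: path_Cons)
  then show ?case
    using Cons.prems by (simp add: path_Cons \<alpha> whisker_right_def)
qed simp

lemma wl_wl: "\<lbrakk>path a p b; x \<in> V; y \<in> V\<rbrakk> \<Longrightarrow> wl x (wl y p) = wl (x \<cdot> y) p"
  by (drule path_arcs) (auto simp: whisker_left_def)

lemma wr_wr: "\<lbrakk>path a p b; x \<in> V; y \<in> V\<rbrakk> \<Longrightarrow> wr (wr p x) y = wr p (x \<cdot> y)"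
  by (drule path_arcs) (auto simp: whisker_right_def)

lemma wr_wl: "wr (wl x p) y = wl x (wr p y)"
  by (simp add: whisker_left_def whisker_right_def case_prod_unfold)

lemma wl_one: "path a p b \<Longrightarrow> wl \<epsilon> p = p"
  by (drule path_arcs) (auto simp: whisker_left_def intro!: map_idI)

lemma wr_one: "path a p b \<Longrightarrow> wr p \<epsilon> = p"
  by (drule path_arcs) (auto simp: whisker_right_def intro!: map_idI)

lemma path_path_tensor: "\<lbrakk>path a p b; path c q d\<rbrakk> \<Longrightarrow> path (a \<cdot> c) (path_tensor Q a d p q) (b \<cdot> d)"
  unfolding path_tensor_def using path_verts by (blast intro: path_append path_wl path_wr)

lemma path_wr_wl: "\<lbrakk>path a p b; path c q d\<rbrakk> \<Longrightarrow> path (a \<cdot> c) (wr p c @ wl b q) (b \<cdot> d)"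
  using path_verts by (blast intro: path_append path_wl path_wr)


section \<open>The interchange ideal\<close>

text \<open>
  For arcs \<open>\<alpha> : a \<rightarrow> b\<close> and \<open>\<beta> : c \<rightarrow> d\<close> the interchange relation is the difference of the two
  ways around the square with sides \<open>\<alpha> \<otimes> 1\<close> and \<open>1 \<otimes> \<beta>\<close>.
\<close>

definition square :: "'v \<Rightarrow> 'v \<Rightarrow> 'v \<Rightarrow> 'v \<Rightarrow> ('v \<times> 'e \<times> 'v) list \<Rightarrow> ('v \<times> 'e \<times> 'v) list \<Rightarrow>
    ('v \<times> 'e \<times> 'v) list \<Rightarrow> 'k" where
  "square a b c d p q = basis_elem R (wl a q @ wr p d)
     \<ominus>\<^bsub>Hom P.L (a \<cdot> c) (b \<cdot> d)\<^esub> basis_elem R (wr p c @ wl b q)"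

text \<open>
  With \<open>\<alpha> = (v, e, w)\<close> and \<open>\<beta> = (v', e', w')\<close> the generators of the ideal take this form, in which the
  four context objects are absorbed into the arcs and whiskering is visible.
\<close>

lemma interchange_rels_square:
  "r \<in> interchange_rels R Q x y \<longleftrightarrow>
    (\<exists>\<alpha> a b \<beta> c d. path a [\<alpha>] b \<and> path c [\<beta>] d \<and> x = a \<cdot> c \<and> y = b \<cdot> d \<and> r = square a b c d [\<alpha>] [\<beta>])"
proof -
  \<comment> \<open>\<open>m\<close> and \<open>m'\<close> are the two intermediate corners of the square from \<open>a'\<close> to \<open>b'\<close>\<close>
  have eq: "cmp (pre_cat R Q) a' m b'
             (basis_elem R [(v, e, w \<cdot> v' \<cdot> y1 \<cdot> w')])
             (basis_elem R [(v \<cdot> x0 \<cdot> w \<cdot> v', e', w')])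
           \<ominus>\<^bsub>Hom (pre_cat R Q) a' b'\<^esub>
           cmp (pre_cat R Q) a' m' b'
             (basis_elem R [(v \<cdot> y0 \<cdot> w \<cdot> v', e', w')])
             (basis_elem R [(v, e, w \<cdot> v' \<cdot> x1 \<cdot> w')])
         = square (v \<cdot> x0 \<cdot> w) (v \<cdot> y0 \<cdot> w) (v' \<cdot> x1 \<cdot> w') (v' \<cdot> y1 \<cdot> w') [(v, e, w)] [(v', e', w')]"
    if "v \<in> V" "w \<in> V" "v' \<in> V" "w' \<in> V" "e \<in> E" "e' \<in> E"
      and "x0 = tail (quiver Q) e" "y0 = head (quiver Q) e" "x1 = tail (quiver Q) e'" "y1 = head (quiver Q) e'"
      and "a' = v \<cdot> x0 \<cdot> w \<cdot> v' \<cdot> x1 \<cdot> w'" "b' = v \<cdot> y0 \<cdot> w \<cdot> v' \<cdot> y1 \<cdot> w'"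
      and "m = v \<cdot> x0 \<cdot> w \<cdot> v' \<cdot> y1 \<cdot> w'" "m' = v \<cdot> y0 \<cdot> w \<cdot> v' \<cdot> x1 \<cdot> w'"
    for v w v' w' e e' x0 y0 x1 y1 a' b' m m'
  proof -
    have "cmp (pre_cat R Q) a' m b'
             (basis_elem R [(v, e, w \<cdot> v' \<cdot> y1 \<cdot> w')])
             (basis_elem R [(v \<cdot> x0 \<cdot> w \<cdot> v', e', w')]) =
        basis_elem R ([(v \<cdot> x0 \<cdot> w \<cdot> v', e', w')] @ [(v, e, w \<cdot> v' \<cdot> y1 \<cdot> w')])"
      unfolding pre_cat_def by (rule P.cmp_path) (use that in \<open>auto simp: path_Cons\<close>)
    moreover have "cmp (pre_cat R Q) a' m' b'
             (basis_elem R [(v \<cdot> y0 \<cdot> w \<cdot> v', e', w')])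
             (basis_elem R [(v, e, w \<cdot> v' \<cdot> x1 \<cdot> w')]) =
        basis_elem R ([(v, e, w \<cdot> v' \<cdot> x1 \<cdot> w')] @ [(v \<cdot> y0 \<cdot> w \<cdot> v', e', w')])"
      unfolding pre_cat_def by (rule P.cmp_path) (use that in \<open>auto simp: path_Cons\<close>)
    ultimately show ?thesis
      using that by (simp add: square_def whisker_left_def whisker_right_def pre_cat_def)
  qed
  show ?thesis
  proof
    assume "r \<in> interchange_rels R Q x y"
    then obtain v w v' w' e e' where h: "v \<in> V" "w \<in> V" "v' \<in> V" "w' \<in> V" "e \<in> E" "e' \<in> E"
      and xy: "x = v \<cdot> tail (quiver Q) e \<cdot> w \<cdot> v' \<cdot> tail (quiver Q) e' \<cdot> w'"
         "y = v \<cdot> head (quiver Q) e \<cdot> w \<cdot> v' \<cdot> head (quiver Q) e' \<cdot> w'"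
      and r: "r = square (v \<cdot> tail (quiver Q) e \<cdot> w) (v \<cdot> head (quiver Q) e \<cdot> w)
         (v' \<cdot> tail (quiver Q) e' \<cdot> w') (v' \<cdot> head (quiver Q) e' \<cdot> w') [(v, e, w)] [(v', e', w')]"
      unfolding interchange_rels_def by (auto simp only: mem_Collect_eq eq)
    have "path (v \<cdot> tail (quiver Q) e \<cdot> w) [(v, e, w)] (v \<cdot> head (quiver Q) e \<cdot> w)"
      "path (v' \<cdot> tail (quiver Q) e' \<cdot> w') [(v', e', w')] (v' \<cdot> head (quiver Q) e' \<cdot> w')"
      using h by (simp_all add: path_Cons)
    moreover have "x = (v \<cdot> tail (quiver Q) e \<cdot> w) \<cdot> (v' \<cdot> tail (quiver Q) e' \<cdot> w')"
      "y = (v \<cdot> head (quiver Q) e \<cdot> w) \<cdot> (v' \<cdot> head (quiver Q) e' \<cdot> w')"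
      using h xy by simp_all
    ultimately show "\<exists>\<alpha> a b \<beta> c d. path a [\<alpha>] b \<and> path c [\<beta>] d \<and>
        x = a \<cdot> c \<and> y = b \<cdot> d \<and> r = square a b c d [\<alpha>] [\<beta>]"
      using r by blast
  next
    assume "\<exists>\<alpha> a b \<beta> c d. path a [\<alpha>] b \<and> path c [\<beta>] d \<and> x = a \<cdot> c \<and> y = b \<cdot> d \<and> r = square a b c d [\<alpha>] [\<beta>]"
    then obtain v e w v' e' w' a b c d where p: "path a [(v, e, w)] b" "path c [(v', e', w')] d"
      and xyr: "x = a \<cdot> c" "y = b \<cdot> d" "r = square a b c d [(v, e, w)] [(v', e', w')]"
      by auto
    have h: "v \<in> V" "w \<in> V" "v' \<in> V" "w' \<in> V" "e \<in> E" "e' \<in> E"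
      and abcd: "a = v \<cdot> tail (quiver Q) e \<cdot> w" "b = v \<cdot> head (quiver Q) e \<cdot> w"
        "c = v' \<cdot> tail (quiver Q) e' \<cdot> w'" "d = v' \<cdot> head (quiver Q) e' \<cdot> w'"
      using p by (simp_all add: path_Cons)
    show "r \<in> interchange_rels R Q x y"
      unfolding interchange_rels_def mem_Collect_eq xyr
      apply (rule bexI[OF _ h(1)], rule bexI[OF _ h(2)], rule bexI[OF _ h(3)], rule bexI[OF _ h(4)],
          rule bexI[OF _ h(5)], rule bexI[OF _ h(6)])
      apply (intro exI conjI; (rule refl)?)
      apply (use h abcd in simp)
      apply (use h abcd in simp)
      apply (subst eq; (rule refl | rule h)?)
      apply (use h abcd in simp_all)
      done
  qed
qed

lemma square_closed:
  assumes "path a p b" "path c q d"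
  shows "square a b c d p q \<in> mor P.L (a \<cdot> c) (b \<cdot> d)"
proof -
  interpret H: module R "Hom P.L (a \<cdot> c) (b \<cdot> d)" by (rule P.L_module)
  show ?thesis
    unfolding square_def
    by (intro H.M.minus_closed P.path_closed path_wr_wl assms path_path_tensor[unfolded path_tensor_def])
qed

sublocale P: linear_category R P.L
  by (rule P.linear_category_free)

abbreviation I :: "'v \<Rightarrow> 'v \<Rightarrow> (('v \<times> 'e \<times> 'v) list \<Rightarrow> 'k) set" where
  "I \<equiv> interchange_ideal R Q"

lemma obj_L [simp]: "obj P.L = V"
  by (simp add: free_lincat_simps)

lemma ident_L [simp]: "ident P.L a = basis_elem R []"
  by (simp add: free_lincat_simps)

lemma interchange_rels_closed: "interchange_rels R Q a b \<subseteq> mor P.L a b"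
  by (auto simp: interchange_rels_square square_closed)

lemma ideal_I: "lincat_ideal R P.L I"
  unfolding interchange_ideal_def pre_cat_def
  by (rule P.lincat_ideal_gen_ideal) (rule interchange_rels_closed)

lemma square_in_I: "\<lbrakk>path a [\<alpha>] b; path c [\<beta>] d\<rbrakk> \<Longrightarrow> square a b c d [\<alpha>] [\<beta>] \<in> I (a \<cdot> c) (b \<cdot> d)"
  unfolding interchange_ideal_def pre_cat_def
  using path_verts
  by (intro subsetD[OF gen_ideal_superset]) (auto simp: interchange_rels_square simp del: split_paired_Ex, blast)

text \<open>
  The use of generators: both whiskering (with \<open>J\<close> the interchange ideal) and the functors to other
  monoidal categories (with \<open>J = 0\<close>) are handled by looking at squares of arcs.
\<close>

lemma linear_functor_I:
  assumes "linear_category R D" "linear_functor R P.L D F" "lincat_ideal R D J"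
    and "\<And>a \<alpha> b c \<beta> d. \<lbrakk>path a [\<alpha>] b; path c [\<beta>] d\<rbrakk> \<Longrightarrow>
      on_mor F (a \<cdot> c) (b \<cdot> d) (square a b c d [\<alpha>] [\<beta>]) \<in> J (on_obj F (a \<cdot> c)) (on_obj F (b \<cdot> d))"
    and "f \<in> I a b"
  shows "on_mor F a b f \<in> J (on_obj F a) (on_obj F b)"
proof (rule linear_functor_gen_ideal[OF P.linear_category_free assms(1-3)])
  show "f \<in> gen_ideal R P.L (interchange_rels R Q) a b"
    using assms(5) unfolding interchange_ideal_def pre_cat_def .
next
  fix c d g assume "g \<in> interchange_rels R Q c d"
  then show "on_mor F c d g \<in> J (on_obj F c) (on_obj F d)"
    using assms(4) unfolding interchange_rels_square by blast
qed (rule interchange_rels_closed)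

sublocale quot: lincat_quotient R P.L I
  by (rule lincat_quotient.intro[OF P.linear_category_free lincat_quotient_axioms.intro[OF ideal_I]])

section \<open>The tensor product on the quotient\<close>

lemma pre_tensor_bilinear:
  "bilinear_map R (Hom P.L a b) (Hom P.L c d) (Hom P.L (a \<cdot> c) (b \<cdot> d)) (pre_tensor R Q a b c d)"
proof -
  have "pre_tensor R Q a b c d = bilinear_ext R (path_tensor Q a d)"
    by (simp add: pre_tensor_def fun_eq_iff)
  then show ?thesis
    unfolding free_lincat_simps
    by (simp only:) (rule bilinear_ext_bilinear, simp add: path_path_tensor)
qed

lemma pre_tensor_path:
  "\<lbrakk>path a p b; path c q d\<rbrakk> \<Longrightarrow>
    pre_tensor R Q a b c d (basis_elem R p) (basis_elem R q) = basis_elem R (path_tensor Q a d p q)"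
  unfolding pre_tensor_def
  by (rule bilinear_ext_basis[where X = "{p. path a p b}" and Y = "{q. path c q d}" and Z = UNIV]) auto

definition whisker_right_functor ::
    "'v \<Rightarrow> ('v, ('v \<times> 'e \<times> 'v) list \<Rightarrow> 'k, 'v, ('v \<times> 'e \<times> 'v) list \<Rightarrow> 'k) cat_functor" where
  "whisker_right_functor x =
    \<lparr>on_obj = (\<lambda>a. a \<cdot> x), on_mor = (\<lambda>a b f. pre_tensor R Q a b x x f (basis_elem R []))\<rparr>"

definition whisker_left_functor ::
    "'v \<Rightarrow> ('v, ('v \<times> 'e \<times> 'v) list \<Rightarrow> 'k, 'v, ('v \<times> 'e \<times> 'v) list \<Rightarrow> 'k) cat_functor" where
  "whisker_left_functor x =
    \<lparr>on_obj = (\<lambda>a. x \<cdot> a), on_mor = (\<lambda>a b f. pre_tensor R Q x x a b (basis_elem R []) f)\<rparr>"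

abbreviation RW :: "'v \<Rightarrow> ('v, ('v \<times> 'e \<times> 'v) list \<Rightarrow> 'k, 'v, ('v \<times> 'e \<times> 'v) list \<Rightarrow> 'k) cat_functor" where
  "RW \<equiv> whisker_right_functor"

abbreviation LW :: "'v \<Rightarrow> ('v, ('v \<times> 'e \<times> 'v) list \<Rightarrow> 'k, 'v, ('v \<times> 'e \<times> 'v) list \<Rightarrow> 'k) cat_functor" where
  "LW \<equiv> whisker_left_functor"

lemma whisker_functor_obj [simp]: "on_obj (RW x) a = a \<cdot> x" "on_obj (LW x) a = x \<cdot> a"
  by (simp_all add: whisker_right_functor_def whisker_left_functor_def)

lemma whisker_functor_path:
  assumes "x \<in> V" "path a p b"
  shows "on_mor (RW x) a b (basis_elem R p) = basis_elem R (wr p x)"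
    and "on_mor (LW x) a b (basis_elem R p) = basis_elem R (wl x p)"
  using assms by (simp_all add: whisker_right_functor_def whisker_left_functor_def
      pre_tensor_path path_tensor_def)

lemma whisker_functor_linear:
  assumes "x \<in> V"
  shows "on_mor (RW x) a b \<in> linear_maps R (Hom P.L a b) (Hom P.L (a \<cdot> x) (b \<cdot> x))"
    and "on_mor (LW x) a b \<in> linear_maps R (Hom P.L a b) (Hom P.L (x \<cdot> a) (x \<cdot> b))"
  using bilinear_map_linear[OF pre_tensor_bilinear _ linear_maps_id] P.path_closed[of x "[]" x] assms
  by (simp_all add: whisker_right_functor_def whisker_left_functor_def)

lemma whisker_functor:
  assumes x: "x \<in> V"
  shows "linear_functor R P.L P.L (RW x)" and "linear_functor R P.L P.L (LW x)"
proof -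
  show "linear_functor R P.L P.L (RW x)"
  proof (rule P.linear_functor_freeI[OF P.linear_category_free])
    fix a b c p q assume pq: "path a p b" "path b q c"
    then show "on_mor (RW x) a c (basis_elem R (p @ q)) =
        cmp P.L (on_obj (RW x) a) (on_obj (RW x) b) (on_obj (RW x) c)
          (on_mor (RW x) b c (basis_elem R q)) (on_mor (RW x) a b (basis_elem R p))"
      using P.cmp_path[OF path_wr[OF pq(1) x] path_wr[OF pq(2) x]]
      by (simp add: whisker_functor_path x path_append[OF pq])
  qed (use x in \<open>auto simp: whisker_functor_path whisker_functor_linear\<close>)
  show "linear_functor R P.L P.L (LW x)"
  proof (rule P.linear_functor_freeI[OF P.linear_category_free])
    fix a b c p q assume pq: "path a p b" "path b q c"
    then show "on_mor (LW x) a c (basis_elem R (p @ q)) =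
        cmp P.L (on_obj (LW x) a) (on_obj (LW x) b) (on_obj (LW x) c)
          (on_mor (LW x) b c (basis_elem R q)) (on_mor (LW x) a b (basis_elem R p))"
      using P.cmp_path[OF path_wl[OF pq(1) x] path_wl[OF pq(2) x]]
      by (simp add: whisker_functor_path x path_append[OF pq])
  qed (use x in \<open>auto simp: whisker_functor_path whisker_functor_linear\<close>)
qed

lemma whisker_functor_square:
  assumes x: "x \<in> V" and p: "path a p b" and q: "path c q d"
  shows "on_mor (RW x) (a \<cdot> c) (b \<cdot> d) (square a b c d p q) = square a b (c \<cdot> x) (d \<cdot> x) p (wr q x)"
    and "on_mor (LW x) (a \<cdot> c) (b \<cdot> d) (square a b c d p q) = square (x \<cdot> a) (x \<cdot> b) c d (wl x p) q"
proof -
  note v = path_verts[OF p] path_verts[OF q] x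
  note paths = path_path_tensor[OF p q, unfolded path_tensor_def] path_wr_wl[OF p q]
  note minus = linear_maps_minus[OF P.L_module P.L_module whisker_functor_linear(1)[OF x] paths[THEN P.path_closed]]
    linear_maps_minus[OF P.L_module P.L_module whisker_functor_linear(2)[OF x] paths[THEN P.path_closed]]
  show "on_mor (RW x) (a \<cdot> c) (b \<cdot> d) (square a b c d p q) = square a b (c \<cdot> x) (d \<cdot> x) p (wr q x)"
    unfolding square_def minus
    using v by (simp add: whisker_functor_path[OF x paths(1)] whisker_functor_path[OF x paths(2)]
        wr_wl wr_wr[OF p])
  show "on_mor (LW x) (a \<cdot> c) (b \<cdot> d) (square a b c d p q) = square (x \<cdot> a) (x \<cdot> b) c d (wl x p) q"
    unfolding square_def minus
    using v by (simp add: whisker_functor_path[OF x paths(1)] whisker_functor_path[OF x paths(2)]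
        wr_wl wl_wl[OF q])
qed

text \<open>
  The generators are preserved: whiskering an interchange relation gives the interchange relation of
  the whiskered arcs.
\<close>

lemma whisker_functor_I:
  assumes x: "x \<in> V" and f: "f \<in> I a b"
  shows "on_mor (RW x) a b f \<in> I (a \<cdot> x) (b \<cdot> x)" and "on_mor (LW x) a b f \<in> I (x \<cdot> a) (x \<cdot> b)"
proof -
  have "on_mor (RW x) a b f \<in> I (on_obj (RW x) a) (on_obj (RW x) b)"
  proof (rule linear_functor_I[OF P.linear_category_free whisker_functor(1)[OF x] ideal_I _ f])
    fix a \<alpha> b c \<beta> d assume \<alpha>: "path a [\<alpha>] b" and \<beta>: "path c [\<beta>] d"
    obtain \<beta>' where \<beta>': "wr [\<beta>] x = [\<beta>']" by (simp add: whisker_right_def)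
    then show "on_mor (RW x) (a \<cdot> c) (b \<cdot> d) (square a b c d [\<alpha>] [\<beta>]) \<in>
        I (on_obj (RW x) (a \<cdot> c)) (on_obj (RW x) (b \<cdot> d))"
      using square_in_I[OF \<alpha>, of "c \<cdot> x" \<beta>' "d \<cdot> x"] path_wr[OF \<beta> x] path_verts[OF \<alpha>] path_verts[OF \<beta>] x
      by (simp add: whisker_functor_square[OF x \<alpha> \<beta>])
  qed
  then show "on_mor (RW x) a b f \<in> I (a \<cdot> x) (b \<cdot> x)" by simp
  have "on_mor (LW x) a b f \<in> I (on_obj (LW x) a) (on_obj (LW x) b)"
  proof (rule linear_functor_I[OF P.linear_category_free whisker_functor(2)[OF x] ideal_I _ f])
    fix a \<alpha> b c \<beta> d assume \<alpha>: "path a [\<alpha>] b" and \<beta>: "path c [\<beta>] d"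
    obtain \<alpha>' where \<alpha>': "wl x [\<alpha>] = [\<alpha>']" by (simp add: whisker_left_def)
    then show "on_mor (LW x) (a \<cdot> c) (b \<cdot> d) (square a b c d [\<alpha>] [\<beta>]) \<in>
        I (on_obj (LW x) (a \<cdot> c)) (on_obj (LW x) (b \<cdot> d))"
      using square_in_I[OF _ \<beta>, of "x \<cdot> a" \<alpha>' "x \<cdot> b"] path_wl[OF \<alpha> x] path_verts[OF \<alpha>] path_verts[OF \<beta>] x
      by (simp add: whisker_functor_square[OF x \<alpha> \<beta>])
  qed
  then show "on_mor (LW x) a b f \<in> I (x \<cdot> a) (x \<cdot> b)" by simp
qed

text \<open>
  This expresses the tensor product by operations that are already known to respect the ideal.
\<close>

lemma pre_tensor_whisker:
  assumes v: "a \<in> V" "b \<in> V" "c \<in> V" "d \<in> V" and f: "f \<in> mor P.L a b" and g: "g \<in> mor P.L c d"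
  shows "pre_tensor R Q a b c d f g =
    cmp P.L (a \<cdot> c) (a \<cdot> d) (b \<cdot> d) (on_mor (RW d) a b f) (on_mor (LW a) c d g)"
proof -
  note lin = bilinear_map_linear[OF pre_tensor_bilinear] linear_maps_id P.linear_cmp
    whisker_functor_linear linear_mapsD(1)[OF whisker_functor_linear(1)]
    linear_mapsD(1)[OF whisker_functor_linear(2)] P.path_closed
  have 1: "pre_tensor R Q a b c d (basis_elem R p) g =
      cmp P.L (a \<cdot> c) (a \<cdot> d) (b \<cdot> d) (on_mor (RW d) a b (basis_elem R p)) (on_mor (LW a) c d g)"
    if p: "path a p b" for p
  proof (rule P.linear_eq_on_paths[OF P.L_module _ _ _ g])
    fix q assume q: "path c q d"
    show "pre_tensor R Q a b c d (basis_elem R p) (basis_elem R q) =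
      cmp P.L (a \<cdot> c) (a \<cdot> d) (b \<cdot> d) (on_mor (RW d) a b (basis_elem R p)) (on_mor (LW a) c d (basis_elem R q))"
      by (simp add: pre_tensor_path[OF p q] whisker_functor_path[OF v(4) p] whisker_functor_path[OF v(1) q]
          P.cmp_path[OF path_wl[OF q v(1)] path_wr[OF p v(4)]] path_tensor_def)
  qed (use v p in \<open>auto intro!: lin\<close>)
  show ?thesis
    by (rule P.linear_eq_on_paths[OF P.L_module _ _ _ f])
      (use v g 1 in \<open>auto intro!: lin\<close>)
qed

abbreviation \<M> :: "('k, 'v, (('v \<times> 'e \<times> 'v) list \<Rightarrow> 'k) set) linmoncat" where
  "\<M> \<equiv> free_linmoncat R Q"

lemma free_linmoncat_simps:
  "obj \<M> = V"
  "Hom \<M> = Hom (quot_lincat P.L I)"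
  "cmp \<M> = cmp (quot_lincat P.L I)"
  "ident \<M> a = quot.cls a a (basis_elem R [])"
  "otens \<M> = tens"
  "tunit \<M> = \<epsilon>"
  "mtens \<M> a b c d F G = (\<Union>f\<in>F. \<Union>g\<in>G. quot.cls (a \<cdot> c) (b \<cdot> d) (pre_tensor R Q a b c d f g))"
  by (simp_all add: free_linmoncat_def lincat.defs linmoncat.defs pre_cat_def quot.ident_quot
      quot_lincat_def free_lincat_simps)

text \<open>
  The tensor product of classes is well-defined: whiskering preserves the ideal, and composition of
  classes is well-defined.
\<close>

lemma mtens_cls:
  assumes v: "a \<in> V" "b \<in> V" "c \<in> V" "d \<in> V" and f: "f \<in> mor P.L a b" and g: "g \<in> mor P.L c d"
  shows "mtens \<M> a b c d (quot.cls a b f) (quot.cls c d g) =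
    quot.cls (a \<cdot> c) (b \<cdot> d) (pre_tensor R Q a b c d f g)"
proof -
  note closed = linear_mapsD(1)[OF whisker_functor_linear(1)] linear_mapsD(1)[OF whisker_functor_linear(2)]
  have well_defined: "quot.cls (a \<cdot> c) (b \<cdot> d) (pre_tensor R Q a b c d f1 g1) =
      quot.cls (a \<cdot> c) (b \<cdot> d) (pre_tensor R Q a b c d f2 g2)"
    if "f1 \<in> mor P.L a b" "f2 \<in> mor P.L a b" "quot.cls a b f1 = quot.cls a b f2"
      and "g1 \<in> mor P.L c d" "g2 \<in> mor P.L c d" "quot.cls c d g1 = quot.cls c d g2" for f1 f2 g1 g2
  proof -
    have "quot.cls (a \<cdot> d) (b \<cdot> d) (on_mor (RW d) a b f1) = quot.cls (a \<cdot> d) (b \<cdot> d) (on_mor (RW d) a b f2)"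
      using quot.cls_functor_cong[OF whisker_functor(1)[OF v(4)] _ _ _ that(1-3)] whisker_functor_I v by simp
    moreover have "quot.cls (a \<cdot> c) (a \<cdot> d) (on_mor (LW a) c d g1) = quot.cls (a \<cdot> c) (a \<cdot> d) (on_mor (LW a) c d g2)"
      using quot.cls_functor_cong[OF whisker_functor(2)[OF v(1)] _ _ _ that(4-6)] whisker_functor_I v by simp
    ultimately show ?thesis
      using v that by (simp add: pre_tensor_whisker closed flip: quot.cmp_quot)
  qed
  have "(\<Union>f'\<in>quot.cls a b f. \<Union>g'\<in>quot.cls c d g. quot.cls (a \<cdot> c) (b \<cdot> d) (pre_tensor R Q a b c d f' g')) =
      (\<Union>g'\<in>quot.cls c d g. quot.cls (a \<cdot> c) (b \<cdot> d) (pre_tensor R Q a b c d f g'))"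
  proof (rule quot.UN_cls)
    fix f' assume "f' \<in> mor P.L a b" "quot.cls a b f' = quot.cls a b f"
    then show "(\<Union>g'\<in>quot.cls c d g. quot.cls (a \<cdot> c) (b \<cdot> d) (pre_tensor R Q a b c d f' g')) =
      (\<Union>g'\<in>quot.cls c d g. quot.cls (a \<cdot> c) (b \<cdot> d) (pre_tensor R Q a b c d f g'))"
      using f g v quot.mem_cls_iff[of c d g] by (intro SUP_cong refl well_defined) auto
  qed (use v f in auto)
  also have "\<dots> = quot.cls (a \<cdot> c) (b \<cdot> d) (pre_tensor R Q a b c d f g)"
    by (rule quot.UN_cls; (rule well_defined)?) (use v f g in simp_all)
  finally show ?thesis by (simp add: free_linmoncat_simps)
qed

abbreviation pcls :: "'v \<Rightarrow> 'v \<Rightarrow> ('v \<times> 'e \<times> 'v) list \<Rightarrow> (('v \<times> 'e \<times> 'v) list \<Rightarrow> 'k) set" where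
  "pcls a b p \<equiv> quot.cls a b (basis_elem R p)"

lemma pcls_closed: "path a p b \<Longrightarrow> pcls a b p \<in> mor \<M> a b"
  using path_verts by (simp add: free_linmoncat_simps quot.cls_closed P.path_closed)

lemma cmp_pcls: "\<lbrakk>path a p b; path b q c\<rbrakk> \<Longrightarrow> cmp \<M> a b c (pcls b c q) (pcls a b p) = pcls a c (p @ q)"
  using path_verts by (simp add: free_linmoncat_simps quot.cmp_quot P.path_closed P.cmp_path)

lemma mtens_pcls:
  "\<lbrakk>path a p b; path c q d\<rbrakk> \<Longrightarrow>
    mtens \<M> a b c d (pcls a b p) (pcls c d q) = pcls (a \<cdot> c) (b \<cdot> d) (path_tensor Q a d p q)"
  using path_verts by (simp add: mtens_cls P.path_closed pre_tensor_path)

lemma linear_category_free_linmoncat: "linear_category R \<M>"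
proof -
  interpret Quot: linear_category R "quot_lincat P.L I" by (rule quot.linear_category_quot)
  show ?thesis
    using Quot.Hom_module Quot.ident_closed Quot.cmp_bilinear Quot.cmp_assoc Quot.cmp_ident_left
      Quot.cmp_ident_right
    by (intro linear_category.intro[OF cring_axioms linear_category_axioms.intro])
      (simp_all add: free_linmoncat_simps quot.ident_quot)
qed

sublocale M: linear_category R \<M>
  by (rule linear_category_free_linmoncat)

text \<open>
  The classes of paths are the images of a spanning set under the projection to the quotient.
\<close>

lemma linear_eq_on_pcls:
  assumes N: "module R N" and h: "h \<in> linear_maps R (Hom \<M> a b) N" and k: "k \<in> linear_maps R (Hom \<M> a b) N"
    and eq: "\<And>p. path a p b \<Longrightarrow> h (pcls a b p) = k (pcls a b p)"
    and v: "a \<in> V" "b \<in> V" and X: "X \<in> mor \<M> a b"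
  shows "h X = k X"
proof (rule linear_maps_eq_on_span[OF M.Hom_module N _ h k _ X])
  show "spans R (Hom \<M> a b) (quot.cls a b ` basis_elem R ` {p. path a p b})"
    using v unfolding free_linmoncat_simps
    by (intro spans_surj_image[OF P.L_module quot.Hom_quot_module P.mor_span quot.cls_linear quot.mor_quot]) auto
qed (use eq v in \<open>auto simp: free_linmoncat_simps\<close>)

section \<open>Interchange and the monoidal axioms\<close>

lemma pcls_append_cong:
  assumes "path a p b" "path a p' b" "path b q c" "path b q' c"
    and "pcls a b p = pcls a b p'" "pcls b c q = pcls b c q'"
  shows "pcls a c (p @ q) = pcls a c (p' @ q')"
  using assms by (metis cmp_pcls)

text \<open>
  The interchange law holds for single arcs by definition of the ideal, and extends to paths by
  moving one arc at a time past the other path.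
\<close>

lemma interchange_pcls:
  assumes "path a p b" "path c q d"
  shows "pcls (a \<cdot> c) (b \<cdot> d) (wl a q @ wr p d) = pcls (a \<cdot> c) (b \<cdot> d) (wr p c @ wl b q)"
proof -
  have arcs: "pcls (a \<cdot> c) (b \<cdot> d) (wl a [\<beta>] @ wr [\<alpha>] d) = pcls (a \<cdot> c) (b \<cdot> d) (wr [\<alpha>] c @ wl b [\<beta>])"
    if "path a [\<alpha>] b" "path c [\<beta>] d" for a b c d \<alpha> \<beta>
    using square_in_I[OF that] path_verts that path_path_tensor[OF that] path_wr_wl[OF that]
    by (subst quot.cls_eq_iff) (auto simp: square_def path_tensor_def intro: P.path_closed)
  have arc_path: "pcls (a \<cdot> c) (b \<cdot> d) (wl a q @ wr [\<alpha>] d) = pcls (a \<cdot> c) (b \<cdot> d) (wr [\<alpha>] c @ wl b q)"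
    if \<alpha>: "path a [\<alpha>] b" and "path c q d" for a b c d \<alpha> q
    using that(2)
  proof (induction q arbitrary: c)
    case Nil
    then show ?case by simp
  next
    case (Cons \<beta> q)
    define m where "m = head (bar_quiver Q) \<beta>"
    have \<beta>: "path c [\<beta>] m" and q: "path m q d"
      using Cons.prems path_verts by (auto simp: path_Cons m_def)
    note v = path_verts[OF \<alpha>] path_verts[OF \<beta>] path_verts[OF q]
    have "pcls (a \<cdot> c) (b \<cdot> d) (wl a [\<beta>] @ (wl a q @ wr [\<alpha>] d)) =
        pcls (a \<cdot> c) (b \<cdot> d) (wl a [\<beta>] @ (wr [\<alpha>] m @ wl b q))"
      by (rule pcls_append_cong[OF _ _ _ _ refl Cons.IH[OF q]])
        (use path_wl[OF \<beta>] path_path_tensor[OF \<alpha> q] path_wr_wl[OF \<alpha> q] v in \<open>simp_all add: path_tensor_def\<close>)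
    also have "\<dots> = pcls (a \<cdot> c) (b \<cdot> d) ((wl a [\<beta>] @ wr [\<alpha>] m) @ wl b q)"
      by simp
    also have "\<dots> = pcls (a \<cdot> c) (b \<cdot> d) ((wr [\<alpha>] c @ wl b [\<beta>]) @ wl b q)"
      by (rule pcls_append_cong[OF _ _ _ _ arcs[OF \<alpha> \<beta>] refl])
        (use path_wl[OF q] path_path_tensor[OF \<alpha> \<beta>] path_wr_wl[OF \<alpha> \<beta>] v in \<open>simp_all add: path_tensor_def\<close>)
    finally show ?case by (simp add: whisker_left_def)
  qed
  show ?thesis
    using assms(1)
  proof (induction p arbitrary: a)
    case Nil
    then show ?case by simp
  next
    case (Cons \<alpha> p)
    define m where "m = head (bar_quiver Q) \<alpha>"
    have \<alpha>: "path a [\<alpha>] m" and p: "path m p b"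
      using Cons.prems path_verts by (auto simp: path_Cons m_def)
    note q = assms(2)
    note v = path_verts[OF \<alpha>] path_verts[OF p] path_verts[OF q]
    have "pcls (a \<cdot> c) (b \<cdot> d) ((wl a q @ wr [\<alpha>] d) @ wr p d) =
        pcls (a \<cdot> c) (b \<cdot> d) ((wr [\<alpha>] c @ wl m q) @ wr p d)"
      by (rule pcls_append_cong[OF _ _ _ _ arc_path[OF \<alpha> q] refl])
        (use path_wr[OF p] path_path_tensor[OF \<alpha> q] path_wr_wl[OF \<alpha> q] v in \<open>simp_all add: path_tensor_def\<close>)
    also have "\<dots> = pcls (a \<cdot> c) (b \<cdot> d) (wr [\<alpha>] c @ (wl m q @ wr p d))"
      by simp
    also have "\<dots> = pcls (a \<cdot> c) (b \<cdot> d) (wr [\<alpha>] c @ (wr p c @ wl b q))"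
      by (rule pcls_append_cong[OF _ _ _ _ refl Cons.IH[OF p]])
        (use path_wr[OF \<alpha>] path_path_tensor[OF p q] path_wr_wl[OF p q] v in \<open>simp_all add: path_tensor_def\<close>)
    finally show ?case by (simp add: whisker_right_def)
  qed
qed

lemma mtens_bilinear:
  assumes v: "a \<in> V" "b \<in> V" "c \<in> V" "d \<in> V"
  shows "bilinear_map R (Hom \<M> a b) (Hom \<M> c d) (Hom \<M> (a \<cdot> c) (b \<cdot> d)) (mtens \<M> a b c d)"
  unfolding free_linmoncat_simps(2)
  by (rule bilinear_map_surj_image[OF P.L_module P.L_module pre_tensor_bilinear[of a b c d]
        quot.cls_linear quot.mor_quot quot.cls_linear quot.mor_quot quot.cls_linear])
    (use v in \<open>auto simp: mtens_cls\<close>)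

lemmas linear_mtens = bilinear_map_linear[OF mtens_bilinear]
lemmas mtens_closed = bilinear_map_closed[OF mtens_bilinear]

lemma free_linmoncat_obj [simp]: "obj \<M> = V" "otens \<M> = tens" "tunit \<M> = \<epsilon>"
  by (simp_all add: free_linmoncat_simps)

text \<open>
  Both sides are composites of the same four whiskered paths up to the order of the middle two,
  \<open>1\<^sub>a \<otimes> q'\<close> and \<open>p \<otimes> 1\<^bsub>c'\<^esub>\<close>, which are exchanged by \<open>interchange_pcls\<close>.
\<close>

lemma mtens_cmp_pcls:
  assumes p: "path a p b" and q: "path b q c" and p': "path a' p' b'" and q': "path b' q' c'"
  shows "mtens \<M> a c a' c' (cmp \<M> a b c (pcls b c q) (pcls a b p)) (cmp \<M> a' b' c' (pcls b' c' q') (pcls a' b' p')) =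
    cmp \<M> (a \<cdot> a') (b \<cdot> b') (c \<cdot> c') (mtens \<M> b c b' c' (pcls b c q) (pcls b' c' q'))
      (mtens \<M> a b a' b' (pcls a b p) (pcls a' b' p'))"
proof -
  note v = path_verts[OF p] path_verts[OF q] path_verts[OF p'] path_verts[OF q']
  have "pcls (a \<cdot> a') (c \<cdot> c') (wl a p' @ ((wl a q' @ wr p c') @ wr q c')) =
      pcls (a \<cdot> a') (c \<cdot> c') (wl a p' @ ((wr p b' @ wl b q') @ wr q c'))"
    by (rule pcls_append_cong[OF _ _ _ _ refl pcls_append_cong[OF _ _ _ _ interchange_pcls[OF p q'] refl]])
      (use path_wl[OF p'] path_wr[OF q] v path_path_tensor[OF p q'] path_wr_wl[OF p q']
        path_append[OF path_path_tensor[OF p q'] path_wr[OF q]] path_append[OF path_wr_wl[OF p q'] path_wr[OF q]]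
        in \<open>simp_all add: path_tensor_def\<close>)
  then show ?thesis
    using path_path_tensor[OF p p'] path_path_tensor[OF q q']
    by (simp add: cmp_pcls[OF p q] cmp_pcls[OF p' q'] mtens_pcls[OF path_append[OF p q] path_append[OF p' q']]
        mtens_pcls[OF p p'] mtens_pcls[OF q q'] cmp_pcls)
      (simp add: path_tensor_def)
qed

text \<open>
  Either way of bracketing gives the same concatenation of three whiskered paths, so associativity
  holds already for paths.
\<close>

lemma mtens_assoc_pcls:
  assumes p: "path a p a'" and q: "path b q b'" and r: "path c r c'"
  shows "mtens \<M> (a \<cdot> b) (a' \<cdot> b') c c' (mtens \<M> a a' b b' (pcls a a' p) (pcls b b' q)) (pcls c c' r) =
    mtens \<M> a a' (b \<cdot> c) (b' \<cdot> c') (pcls a a' p) (mtens \<M> b b' c c' (pcls b b' q) (pcls c c' r))"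
proof -
  note v = path_verts[OF p] path_verts[OF q] path_verts[OF r]
  have "path_tensor Q (a \<cdot> b) c' (path_tensor Q a b' p q) r = path_tensor Q a (b' \<cdot> c') p (path_tensor Q b c' q r)"
    using v by (simp add: path_tensor_def wl_wl[OF r] wr_wr[OF p] wr_wl)
  then show ?thesis
    using v by (simp add: mtens_pcls[OF p q] mtens_pcls[OF q r]
        mtens_pcls[OF path_path_tensor[OF p q] r] mtens_pcls[OF p path_path_tensor[OF q r]])
qed

lemma linear_monoidal_category_free_linmoncat: "linear_monoidal_category R \<M>"
proof (rule linear_monoidal_category.intro[OF linear_category_free_linmoncat])
  show "Group.monoid (obj_monoid \<M>)"
    by (rule monoidI) (auto simp: obj_monoid_def)
  show "linear_monoidal_category_axioms R \<M>"
  proof (rule linear_monoidal_category_axioms.intro, unfold free_linmoncat_obj)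
    fix a b c d assume "a \<in> V" "b \<in> V" "c \<in> V" "d \<in> V"
    then show "bilinear_map R (Hom \<M> a b) (Hom \<M> c d) (Hom \<M> (a \<cdot> c) (b \<cdot> d)) (mtens \<M> a b c d)"
      by (rule mtens_bilinear)
  next
    fix a b assume "a \<in> V" "b \<in> V"
    then show "mtens \<M> a a b b (ident \<M> a) (ident \<M> b) = ident \<M> (a \<cdot> b)"
      by (simp add: free_linmoncat_simps(4) mtens_pcls path_tensor_def)
  next
    fix a b f assume v: "a \<in> V" "b \<in> V" and f: "f \<in> mor \<M> a b"
    have \<epsilon>: "path \<epsilon> [] \<epsilon>" by simp
    have id: "ident \<M> \<epsilon> = pcls \<epsilon> \<epsilon> []" by (simp add: free_linmoncat_simps(4))
    note l = linear_mtens(1)[OF _ _ v pcls_closed[OF \<epsilon>] linear_maps_id]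
    note r = linear_mtens(2)[OF v _ _ pcls_closed[OF \<epsilon>] linear_maps_id]
    show "mtens \<M> \<epsilon> \<epsilon> a b (ident \<M> \<epsilon>) f = f" unfolding id
      by (rule linear_eq_on_pcls[OF _ _ _ _ v f])
        (use l v in \<open>auto intro: linear_maps_id M.Hom_module simp: mtens_pcls[OF \<epsilon>] path_tensor_def wl_one\<close>)
    show "mtens \<M> a b \<epsilon> \<epsilon> f (ident \<M> \<epsilon>) = f" unfolding id
      by (rule linear_eq_on_pcls[OF _ _ _ _ v f])
        (use r v in \<open>auto intro: linear_maps_id M.Hom_module simp: mtens_pcls[OF _ \<epsilon>] path_tensor_def wr_one\<close>)
  next
    fix a b c a' b' c' f g h
    assume v: "a \<in> V" "b \<in> V" "c \<in> V" "a' \<in> V" "b' \<in> V" "c' \<in> V"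
      and f: "f \<in> mor \<M> a a'" and g: "g \<in> mor \<M> b b'" and h: "h \<in> mor \<M> c c'"
    let ?eq = "\<lambda>f g h. mtens \<M> (a \<cdot> b) (a' \<cdot> b') c c' (mtens \<M> a a' b b' f g) h =
        mtens \<M> a a' (b \<cdot> c) (b' \<cdot> c') f (mtens \<M> b b' c c' g h)"
    have assoc: "a \<cdot> b \<cdot> c = a \<cdot> (b \<cdot> c)" "a' \<cdot> b' \<cdot> c' = a' \<cdot> (b' \<cdot> c')"
      using v by simp_all
    \<comment> \<open>the two bracketings land in hom-modules that are equal by associativity on objects\<close>
    note tens_bc = linear_mtens[of a a' "b \<cdot> c" "b' \<cdot> c'", folded assoc]
    note lins = linear_mtens tens_bc linear_maps_id mtens_closed pcls_closed v V_monoid(2)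
    note eqI = linear_eq_on_pcls[where N = "Hom \<M> (a \<cdot> b \<cdot> c) (a' \<cdot> b' \<cdot> c')"]
    have N: "module R (Hom \<M> (a \<cdot> b \<cdot> c) (a' \<cdot> b' \<cdot> c'))"
      using v by (intro M.Hom_module) simp_all
    have 1: "?eq (pcls a a' p) (pcls b b' q) h" if "path a p a'" "path b q b'" for p q
      by (rule eqI[OF N _ _ _ v(3,6) h]) (intro lins that mtens_assoc_pcls; assumption)+
    have 2: "?eq (pcls a a' p) g h" if "path a p a'" for p
      by (rule eqI[OF N _ _ _ v(2,5) g]) (intro lins that h 1; assumption)+
    show "?eq f g h"
      by (rule eqI[OF N _ _ _ v(1,4) f]) (intro lins g h 2; assumption)+
  next
    fix a b c a' b' c' f g f' g'
    assume v: "a \<in> V" "b \<in> V" "c \<in> V" "a' \<in> V" "b' \<in> V" "c' \<in> V"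
      and f: "f \<in> mor \<M> a b" and g: "g \<in> mor \<M> b c" and f': "f' \<in> mor \<M> a' b'" and g': "g' \<in> mor \<M> b' c'"
    let ?eq = "\<lambda>f g f' g'. mtens \<M> a c a' c' (cmp \<M> a b c g f) (cmp \<M> a' b' c' g' f') =
      cmp \<M> (a \<cdot> a') (b \<cdot> b') (c \<cdot> c') (mtens \<M> b c b' c' g g') (mtens \<M> a b a' b' f f')"
    note lins = linear_mtens M.linear_cmp[unfolded free_linmoncat_obj] linear_maps_id mtens_closed
      M.cmp_closed[unfolded free_linmoncat_obj] pcls_closed v V_monoid(2)
    note eqI = linear_eq_on_pcls[where N = "Hom \<M> (a \<cdot> a') (c \<cdot> c')"]
    have N: "module R (Hom \<M> (a \<cdot> a') (c \<cdot> c'))"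
      using v by (intro M.Hom_module) simp_all
    have 1: "?eq (pcls a b p) (pcls b c q) (pcls a' b' p') g'"
      if "path a p b" "path b q c" "path a' p' b'" for p q p'
      by (rule eqI[OF N _ _ _ v(5,6) g']) (intro lins that mtens_cmp_pcls; assumption)+
    have 2: "?eq (pcls a b p) (pcls b c q) f' g'" if "path a p b" "path b q c" for p q
      by (rule eqI[OF N _ _ _ v(4,5) f']) (intro lins that g' 1; assumption)+
    have 3: "?eq (pcls a b p) g f' g'" if "path a p b" for p
      by (rule eqI[OF N _ _ _ v(2,3) g]) (intro lins that f' g' 2; assumption)+
    show "?eq f g f' g'"
      by (rule eqI[OF N _ _ _ v(1,2) f]) (intro lins g f' g' 3; assumption)+
  qed
qed

section \<open>Generation by the quiver\<close>

lemma path_edge: "e \<in> E \<Longrightarrow> path (tail (quiver Q) e) [(\<epsilon>, e, \<epsilon>)] (head (quiver Q) e)"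
  by (simp add: path_Cons)

lemma free_tau_simps:
  "on_verts (free_tau R Q) v = v"
  "on_arcs (free_tau R Q) e =
    (tail (quiver Q) e, pcls (tail (quiver Q) e) (head (quiver Q) e) [(\<epsilon>, e, \<epsilon>)], head (quiver Q) e)"
  by (simp_all add: free_tau_def pre_cat_def)

lemma mon_quiver_morphism_free_tau: "mon_quiver_morphism Q (U_cat \<M>) (free_tau R Q)"
  unfolding mon_quiver_morphism_def
  by (auto simp: U_cat_def obj_monoid_def free_tau_simps hom_def Q.carrier_vmonoid
      intro: pcls_closed path_edge)

text \<open>
  The identity \<open>(v, e, w) = 1\<^sub>v \<otimes> \<tau>(e) \<otimes> 1\<^sub>w\<close> is what makes a monoidal functor on \<open>\<M>\<close> unique: it
  is determined on arcs, hence on paths, by its values on \<open>\<tau>\<close>.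
\<close>

lemma pcls_arc:
  assumes "v \<in> V" "e \<in> E" "w \<in> V" and x: "x = tail (quiver Q) e" and y: "y = head (quiver Q) e"
  shows "pcls (v \<cdot> x \<cdot> w) (v \<cdot> y \<cdot> w) [(v, e, w)] =
    mtens \<M> (v \<cdot> x) (v \<cdot> y) w w
      (mtens \<M> v v x y (ident \<M> v) (pcls x y [(\<epsilon>, e, \<epsilon>)])) (ident \<M> w)"
proof -
  have v: "path v [] v" and w: "path w [] w" using assms by simp_all
  have e: "path x [(\<epsilon>, e, \<epsilon>)] y" using path_edge assms by simp
  show ?thesis
    unfolding free_linmoncat_simps(4) mtens_pcls[OF v e] mtens_pcls[OF path_path_tensor[OF v e] w]
    using assms by (simp add: path_tensor_def whisker_left_def whisker_right_def)
qed

lemma linear_functor_free_linmoncat_iff: "linear_functor R \<M> D F \<longleftrightarrow> linear_functor R (quot_lincat P.L I) D F"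
  by (simp add: linear_functor_def free_linmoncat_simps(2,3,4) quot.ident_quot)

end

section \<open>The universal property\<close>

locale mon_quiver_representation = mon_quiver_construction R Q + D: linear_monoidal_category R D
  for R :: "('k, 'r) ring_scheme" and Q :: "('v, 'e) mon_quiver" and D :: "('k, 'o, 'm) linmoncat" +
  fixes \<phi> :: "('v, 'e, 'o, 'o \<times> 'm \<times> 'o) quiver_mor"
  assumes \<phi>: "mon_quiver_morphism Q (U_cat D) \<phi>"
begin

abbreviation otD :: "'o \<Rightarrow> 'o \<Rightarrow> 'o" (infixl "\<boxtimes>" 70) where
  "otD \<equiv> otens D"

lemma D_monoid [simp]:
  "tunit D \<in> obj D"
  "\<lbrakk>a \<in> obj D; b \<in> obj D\<rbrakk> \<Longrightarrow> a \<boxtimes> b \<in> obj D"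
  "a \<in> obj D \<Longrightarrow> tunit D \<boxtimes> a = a"
  "a \<in> obj D \<Longrightarrow> a \<boxtimes> tunit D = a"
  "\<lbrakk>a \<in> obj D; b \<in> obj D; c \<in> obj D\<rbrakk> \<Longrightarrow> a \<boxtimes> b \<boxtimes> c = a \<boxtimes> (b \<boxtimes> c)"
  using D.obj.one_closed D.obj.m_closed D.obj.l_one D.obj.r_one D.obj.m_assoc
  by (simp_all add: obj_monoid_def)

lemma D_mtens_closed:
  "\<lbrakk>a \<in> obj D; b \<in> obj D; c \<in> obj D; d \<in> obj D; f \<in> mor D a b; g \<in> mor D c d\<rbrakk> \<Longrightarrow>
    mtens D a b c d f g \<in> mor D (a \<boxtimes> c) (b \<boxtimes> d)"
  by (rule bilinear_map_closed[OF D.mtens_bilinear])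

abbreviation ob :: "'v \<Rightarrow> 'o" where "ob \<equiv> on_verts \<phi>"

definition edge_mor :: "'e \<Rightarrow> 'm" where
  "edge_mor e = fst (snd (on_arcs \<phi> e))"

lemma ob_simps [simp]:
  "a \<in> V \<Longrightarrow> ob a \<in> obj D"
  "\<lbrakk>a \<in> V; b \<in> V\<rbrakk> \<Longrightarrow> ob (a \<cdot> b) = ob a \<boxtimes> ob b"
  "ob \<epsilon> = tunit D"
  using \<phi> by (auto simp: mon_quiver_morphism_def U_cat_def obj_monoid_def hom_def Q.carrier_vmonoid)

lemma edge_mor:
  assumes "e \<in> E"
  shows "edge_mor e \<in> mor D (ob (tail (quiver Q) e)) (ob (head (quiver Q) e))"
    and "on_arcs \<phi> e = (ob (tail (quiver Q) e), edge_mor e, ob (head (quiver Q) e))"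
  using \<phi> assms by (auto simp: mon_quiver_morphism_def U_cat_def edge_mor_def)

fun arc_mor :: "'v \<times> 'e \<times> 'v \<Rightarrow> 'm" where
  "arc_mor (v, e, w) =
    mtens D (ob v \<boxtimes> ob (tail (quiver Q) e)) (ob v \<boxtimes> ob (head (quiver Q) e)) (ob w) (ob w)
      (mtens D (ob v) (ob v) (ob (tail (quiver Q) e)) (ob (head (quiver Q) e)) (ident D (ob v)) (edge_mor e))
      (ident D (ob w))"

text \<open>
  The object \<open>b\<close> is the target of the path; it is a parameter because the empty list does not
  determine its vertex.
\<close>

primrec path_mor :: "'v \<Rightarrow> ('v \<times> 'e \<times> 'v) list \<Rightarrow> 'm" where
  "path_mor b [] = ident D (ob b)"
| "path_mor b (\<alpha> # p) = cmp D (ob (tail (bar_quiver Q) \<alpha>)) (ob (head (bar_quiver Q) \<alpha>)) (ob b)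
    (path_mor b p) (arc_mor \<alpha>)"

lemma arc_mor_closed:
  assumes "\<alpha> \<in> V \<times> E \<times> V"
  shows "arc_mor \<alpha> \<in> mor D (ob (tail (bar_quiver Q) \<alpha>)) (ob (head (bar_quiver Q) \<alpha>))"
proof -
  obtain v e w where \<alpha>: "\<alpha> = (v, e, w)" "v \<in> V" "e \<in> E" "w \<in> V" using assms by auto
  have 1: "mtens D (ob v) (ob v) (ob (tail (quiver Q) e)) (ob (head (quiver Q) e)) (ident D (ob v)) (edge_mor e) \<in>
      mor D (ob v \<boxtimes> ob (tail (quiver Q) e)) (ob v \<boxtimes> ob (head (quiver Q) e))"
    using \<alpha> by (intro D_mtens_closed D.ident_closed edge_mor) auto
  have "arc_mor (v, e, w) \<in>
      mor D (ob v \<boxtimes> ob (tail (quiver Q) e) \<boxtimes> ob w) (ob v \<boxtimes> ob (head (quiver Q) e) \<boxtimes> ob w)"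
    unfolding arc_mor.simps using \<alpha> by (intro D_mtens_closed 1 D.ident_closed) auto
  then show ?thesis using \<alpha> by simp
qed

lemma path_mor_closed: "path a p b \<Longrightarrow> path_mor b p \<in> mor D (ob a) (ob b)"
proof (induction p arbitrary: a)
  case Nil
  then show ?case by (auto intro: D.ident_closed)
next
  case (Cons \<alpha> p)
  then have \<alpha>: "\<alpha> \<in> V \<times> E \<times> V" "a = tail (bar_quiver Q) \<alpha>" and p: "path (head (bar_quiver Q) \<alpha>) p b"
    by (simp_all add: path_Cons)
  then show ?case
    using path_verts[OF Cons.prems] path_verts[OF p]
    unfolding path_mor.simps \<alpha>(2) by (intro D.cmp_closed arc_mor_closed Cons.IH) auto
qed

lemma path_mor_append:
  assumes q: "path b q c" and "path a p b"
  shows "path_mor c (p @ q) = cmp D (ob a) (ob b) (ob c) (path_mor c q) (path_mor b p)"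
  using assms(2)
proof (induction p arbitrary: a)
  case Nil
  then show ?case using path_mor_closed[OF q] path_verts[OF q] by (auto simp: D.cmp_ident_right)
next
  case (Cons \<alpha> p)
  then have \<alpha>: "\<alpha> \<in> V \<times> E \<times> V" "a = tail (bar_quiver Q) \<alpha>" and p: "path (head (bar_quiver Q) \<alpha>) p b"
    by (simp_all add: path_Cons)
  show ?case
    unfolding append_Cons path_mor.simps \<alpha>(2) Cons.IH[OF p]
    using path_verts[OF Cons.prems] path_verts[OF p] path_verts[OF q] \<alpha>
    by (intro D.cmp_assoc arc_mor_closed path_mor_closed[OF p] path_mor_closed[OF q] ob_simps(1)) auto
qed

lemma arc_mor_whisker:
  assumes "\<alpha> = (v, e, w)" "v \<in> V" "e \<in> E" "w \<in> V" and x: "x \<in> V"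
    and a: "a = tail (bar_quiver Q) \<alpha>" and b: "b = head (bar_quiver Q) \<alpha>"
  shows "arc_mor (x \<cdot> v, e, w) = mtens D (ob x) (ob x) (ob a) (ob b) (ident D (ob x)) (arc_mor \<alpha>)"
    and "arc_mor (v, e, w \<cdot> x) = mtens D (ob a) (ob b) (ob x) (ob x) (arc_mor \<alpha>) (ident D (ob x))"
proof -
  let ?s = "ob (tail (quiver Q) e)" and ?t = "ob (head (quiver Q) e)"
  have obj: "ob v \<in> obj D" "ob w \<in> obj D" "ob x \<in> obj D" "?s \<in> obj D" "?t \<in> obj D"
    using assms by simp_all
  note e = edge_mor(1)[OF assms(3)]
  note id = D.ident_closed[OF obj(1)] D.ident_closed[OF obj(2)] D.ident_closed[OF obj(3)]
  have ab: "ob a = ob v \<boxtimes> (?s \<boxtimes> ob w)" "ob b = ob v \<boxtimes> (?t \<boxtimes> ob w)"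
    using assms by simp_all
  define f where "f = mtens D (ob v) (ob v) ?s ?t (ident D (ob v)) (edge_mor e)"
  have f: "f \<in> mor D (ob v \<boxtimes> ?s) (ob v \<boxtimes> ?t)"
    unfolding f_def by (intro D_mtens_closed obj id e)
  have "arc_mor (x \<cdot> v, e, w) =
      mtens D (ob x \<boxtimes> ob v \<boxtimes> ?s) (ob x \<boxtimes> ob v \<boxtimes> ?t) (ob w) (ob w)
        (mtens D (ob x \<boxtimes> ob v) (ob x \<boxtimes> ob v) ?s ?t
          (mtens D (ob x) (ob x) (ob v) (ob v) (ident D (ob x)) (ident D (ob v))) (edge_mor e))
        (ident D (ob w))"
    using assms by (simp add: D.mtens_ident)
  also have "\<dots> = mtens D (ob x \<boxtimes> (ob v \<boxtimes> ?s)) (ob x \<boxtimes> (ob v \<boxtimes> ?t)) (ob w) (ob w)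
      (mtens D (ob x) (ob x) (ob v \<boxtimes> ?s) (ob v \<boxtimes> ?t) (ident D (ob x)) f) (ident D (ob w))"
    using obj by (simp only: D.mtens_assoc[OF obj(3,1,4,3,1,5) id(3,1) e] f_def D_monoid)
  also have "\<dots> = mtens D (ob x) (ob x) (ob v \<boxtimes> ?s \<boxtimes> ob w) (ob v \<boxtimes> ?t \<boxtimes> ob w) (ident D (ob x))
      (mtens D (ob v \<boxtimes> ?s) (ob v \<boxtimes> ?t) (ob w) (ob w) f (ident D (ob w)))"
    using obj by (intro D.mtens_assoc id f) simp_all
  finally show "arc_mor (x \<cdot> v, e, w) = mtens D (ob x) (ob x) (ob a) (ob b) (ident D (ob x)) (arc_mor \<alpha>)"
    using obj by (simp add: assms(1) f_def ab)
  have "arc_mor (v, e, w \<cdot> x) =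
      mtens D (ob v \<boxtimes> ?s) (ob v \<boxtimes> ?t) (ob w \<boxtimes> ob x) (ob w \<boxtimes> ob x) f
        (mtens D (ob w) (ob w) (ob x) (ob x) (ident D (ob w)) (ident D (ob x)))"
    using assms by (simp add: D.mtens_ident f_def)
  also have "\<dots> = mtens D (ob v \<boxtimes> ?s \<boxtimes> ob w) (ob v \<boxtimes> ?t \<boxtimes> ob w) (ob x) (ob x)
      (mtens D (ob v \<boxtimes> ?s) (ob v \<boxtimes> ?t) (ob w) (ob w) f (ident D (ob w))) (ident D (ob x))"
    using obj by (intro D.mtens_assoc[symmetric] id f) simp_all
  finally show "arc_mor (v, e, w \<cdot> x) = mtens D (ob a) (ob b) (ob x) (ob x) (arc_mor \<alpha>) (ident D (ob x))"
    using obj by (simp add: assms(1) f_def ab)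
qed

text \<open>
  By induction along the path, using that tensoring with the identity \<open>1\<^sub>x = 1\<^sub>x \<circ> 1\<^sub>x\<close> is compatible
  with composition.
\<close>

lemma path_mor_whisker:
  assumes x: "x \<in> V" and "path a p b"
  shows "path_mor (x \<cdot> b) (wl x p) = mtens D (ob x) (ob x) (ob a) (ob b) (ident D (ob x)) (path_mor b p)"
    and "path_mor (b \<cdot> x) (wr p x) = mtens D (ob a) (ob b) (ob x) (ob x) (path_mor b p) (ident D (ob x))"
proof -
  have id: "ident D (ob x) \<in> mor D (ob x) (ob x)"
    and id_id: "ident D (ob x) = cmp D (ob x) (ob x) (ob x) (ident D (ob x)) (ident D (ob x))"
    using x by (simp_all add: D.ident_closed D.cmp_ident_left)
  have "path_mor (x \<cdot> b) (wl x p) = mtens D (ob x) (ob x) (ob a) (ob b) (ident D (ob x)) (path_mor b p) \<and>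
      path_mor (b \<cdot> x) (wr p x) = mtens D (ob a) (ob b) (ob x) (ob x) (path_mor b p) (ident D (ob x))"
    using assms(2)
  proof (induction p arbitrary: a)
    case Nil
    then show ?case using x by (auto simp: D.mtens_ident)
  next
    case (Cons \<alpha> p)
    obtain v e w where \<alpha>: "\<alpha> = (v, e, w)" "v \<in> V" "e \<in> E" "w \<in> V"
      using Cons.prems by (auto simp: path_Cons)
    define m where "m = head (bar_quiver Q) \<alpha>"
    have a: "a = tail (bar_quiver Q) \<alpha>" and p: "path m p b"
      using Cons.prems by (simp_all add: path_Cons m_def)
    have obj: "ob a \<in> obj D" "ob m \<in> obj D" "ob b \<in> obj D" "ob x \<in> obj D"
      using path_verts[OF Cons.prems] path_verts[OF p] x by simp_all
    have \<alpha>_mor: "arc_mor \<alpha> \<in> mor D (ob a) (ob m)"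
      unfolding a m_def by (rule arc_mor_closed) (use \<alpha> in simp)
    note p_mor = path_mor_closed[OF p]
    note arc = arc_mor_whisker[OF \<alpha> x a m_def]
    have ends: "tail (bar_quiver Q) (x \<cdot> v, e, w) = x \<cdot> a" "head (bar_quiver Q) (x \<cdot> v, e, w) = x \<cdot> m"
      "tail (bar_quiver Q) (v, e, w \<cdot> x) = a \<cdot> x" "head (bar_quiver Q) (v, e, w \<cdot> x) = m \<cdot> x"
      using \<alpha> x by (simp_all add: a m_def)
    have v: "a \<in> V" "b \<in> V" "m \<in> V" using path_verts[OF Cons.prems] path_verts[OF p] by simp_all
    have "path_mor (x \<cdot> b) (wl x (\<alpha> # p)) = cmp D (ob x \<boxtimes> ob a) (ob x \<boxtimes> ob m) (ob x \<boxtimes> ob b)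
        (mtens D (ob x) (ob x) (ob m) (ob b) (ident D (ob x)) (path_mor b p))
        (mtens D (ob x) (ob x) (ob a) (ob m) (ident D (ob x)) (arc_mor \<alpha>))"
      using Cons.IH[OF p] x v unfolding whisker_left_def by (simp add: \<alpha>(1) ends arc[unfolded \<alpha>(1)] del: bar_quiver_simps arc_mor.simps)
    also have "\<dots> = mtens D (ob x) (ob x) (ob a) (ob b)
        (cmp D (ob x) (ob x) (ob x) (ident D (ob x)) (ident D (ob x)))
        (cmp D (ob a) (ob m) (ob b) (path_mor b p) (arc_mor \<alpha>))"
      by (intro D.mtens_cmp[symmetric] obj id \<alpha>_mor p_mor)
    finally have 1: "path_mor (x \<cdot> b) (wl x (\<alpha> # p)) =
        mtens D (ob x) (ob x) (ob a) (ob b) (ident D (ob x)) (path_mor b (\<alpha> # p))"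
      by (simp add: a m_def flip: id_id)
    have "path_mor (b \<cdot> x) (wr (\<alpha> # p) x) = cmp D (ob a \<boxtimes> ob x) (ob m \<boxtimes> ob x) (ob b \<boxtimes> ob x)
        (mtens D (ob m) (ob b) (ob x) (ob x) (path_mor b p) (ident D (ob x)))
        (mtens D (ob a) (ob m) (ob x) (ob x) (arc_mor \<alpha>) (ident D (ob x)))"
      using Cons.IH[OF p] x v unfolding whisker_right_def by (simp add: \<alpha>(1) ends arc[unfolded \<alpha>(1)] del: bar_quiver_simps arc_mor.simps)
    also have "\<dots> = mtens D (ob a) (ob b) (ob x) (ob x)
        (cmp D (ob a) (ob m) (ob b) (path_mor b p) (arc_mor \<alpha>))
        (cmp D (ob x) (ob x) (ob x) (ident D (ob x)) (ident D (ob x)))"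
      by (intro D.mtens_cmp[symmetric] obj id \<alpha>_mor p_mor)
    finally have 2: "path_mor (b \<cdot> x) (wr (\<alpha> # p) x) =
        mtens D (ob a) (ob b) (ob x) (ob x) (path_mor b (\<alpha> # p)) (ident D (ob x))"
      by (simp add: a m_def flip: id_id)
    show ?case using 1 2 by blast
  qed
  then show "path_mor (x \<cdot> b) (wl x p) = mtens D (ob x) (ob x) (ob a) (ob b) (ident D (ob x)) (path_mor b p)"
    and "path_mor (b \<cdot> x) (wr p x) = mtens D (ob a) (ob b) (ob x) (ob x) (path_mor b p) (ident D (ob x))"
    by auto
qed

text \<open>
  By the interchange law in \<open>D\<close>, both ways around the square of two paths are sent to the tensor
  product of their images.
\<close>

lemma path_mor_square:
  assumes p: "path a p b" and q: "path c q d"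
  shows "path_mor (b \<cdot> d) (wl a q @ wr p d) = mtens D (ob a) (ob b) (ob c) (ob d) (path_mor b p) (path_mor d q)"
    and "path_mor (b \<cdot> d) (wr p c @ wl b q) = mtens D (ob a) (ob b) (ob c) (ob d) (path_mor b p) (path_mor d q)"
proof -
  note v = path_verts[OF p] path_verts[OF q]
  have obj: "ob a \<in> obj D" "ob b \<in> obj D" "ob c \<in> obj D" "ob d \<in> obj D"
    using v by simp_all
  note mor = path_mor_closed[OF p] path_mor_closed[OF q] D.ident_closed
  show "path_mor (b \<cdot> d) (wl a q @ wr p d) = mtens D (ob a) (ob b) (ob c) (ob d) (path_mor b p) (path_mor d q)"
    using D.mtens_cmp[OF obj(1,1,2,3,4,4) mor(3)[OF obj(1)] mor(1,2) mor(3)[OF obj(4)]] obj v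
    by (simp add: path_mor_append[OF path_wr[OF p v(4)] path_wl[OF q v(1)]]
        path_mor_whisker[OF v(1) q] path_mor_whisker[OF v(4) p] mor D.cmp_ident_left D.cmp_ident_right)
  show "path_mor (b \<cdot> d) (wr p c @ wl b q) = mtens D (ob a) (ob b) (ob c) (ob d) (path_mor b p) (path_mor d q)"
    using D.mtens_cmp[OF obj(1,2,2,3,3,4) mor(1) mor(3)[OF obj(2)] mor(3)[OF obj(3)] mor(2)] obj v
    by (simp add: path_mor_append[OF path_wl[OF q v(2)] path_wr[OF p v(3)]]
        path_mor_whisker[OF v(2) q] path_mor_whisker[OF v(3) p] mor D.cmp_ident_left D.cmp_ident_right)
qed

definition pre_lift :: "('v, ('v \<times> 'e \<times> 'v) list \<Rightarrow> 'k, 'o, 'm) cat_functor" where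
  "pre_lift = \<lparr>on_obj = ob, on_mor = (\<lambda>a b. lin_ext (Hom D (ob a) (ob b)) (path_mor b))\<rparr>"

lemma pre_lift_obj [simp]: "on_obj pre_lift = ob"
  by (simp add: pre_lift_def)

lemma
  assumes v: "a \<in> V" "b \<in> V"
  shows pre_lift_linear: "on_mor pre_lift a b \<in> linear_maps R (Hom P.L a b) (Hom D (ob a) (ob b))"
    and pre_lift_path: "path a p b \<Longrightarrow> on_mor pre_lift a b (basis_elem R p) = path_mor b p"
proof -
  have M: "module R (Hom D (ob a) (ob b))" using v by (intro D.Hom_module) simp_all
  show "on_mor pre_lift a b \<in> linear_maps R (Hom P.L a b) (Hom D (ob a) (ob b))"
    unfolding pre_lift_def free_lincat_simps cat_functor.simps
    by (rule lin_ext_linear[OF M]) (simp add: path_mor_closed)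
  show "on_mor pre_lift a b (basis_elem R p) = path_mor b p" if "path a p b"
    unfolding pre_lift_def cat_functor.simps
    by (rule lin_ext_basis[OF M, of "{p. path a p b}"]) (simp_all add: path_mor_closed that)
qed

lemma linear_functor_pre_lift: "linear_functor R P.L D pre_lift"
proof (rule P.linear_functor_freeI[OF D.linear_category_axioms])
  fix a b c p q assume p: "path a p b" and q: "path b q c"
  show "on_mor pre_lift a c (basis_elem R (p @ q)) =
      cmp D (on_obj pre_lift a) (on_obj pre_lift b) (on_obj pre_lift c)
        (on_mor pre_lift b c (basis_elem R q)) (on_mor pre_lift a b (basis_elem R p))"
    using path_verts[OF p] path_verts[OF q]
    by (simp add: pre_lift_path[OF _ _ path_append[OF p q]] pre_lift_path p q path_mor_append[OF q p])
qed (auto simp: pre_lift_linear pre_lift_path)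

lemma pre_lift_zero_on_I:
  assumes "f \<in> I a b"
  shows "on_mor pre_lift a b f = \<zero>\<^bsub>Hom D (ob a) (ob b)\<^esub>"
proof -
  have "on_mor pre_lift a b f \<in> {\<zero>\<^bsub>Hom D (on_obj pre_lift a) (on_obj pre_lift b)\<^esub>}"
  proof (rule linear_functor_I[OF D.linear_category_axioms linear_functor_pre_lift D.lincat_ideal_zero _ assms])
    fix a \<alpha> b c \<beta> d assume \<alpha>: "path a [\<alpha>] b" and \<beta>: "path c [\<beta>] d"
    have v: "a \<cdot> c \<in> V" "b \<cdot> d \<in> V" using path_verts[OF \<alpha>] path_verts[OF \<beta>] by simp_all
    note paths = path_path_tensor[OF \<alpha> \<beta>, unfolded path_tensor_def] path_wr_wl[OF \<alpha> \<beta>]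
    have D: "module R (Hom D (ob (a \<cdot> c)) (ob (b \<cdot> d)))"
      by (rule D.Hom_module) (use v in \<open>simp_all only: ob_simps(1)\<close>)
    interpret D: module R "Hom D (ob (a \<cdot> c)) (ob (b \<cdot> d))" by (rule D)
    have "on_mor pre_lift (a \<cdot> c) (b \<cdot> d) (square a b c d [\<alpha>] [\<beta>]) =
        path_mor (b \<cdot> d) (wl a [\<beta>] @ wr [\<alpha>] d) \<ominus>\<^bsub>Hom D (ob (a \<cdot> c)) (ob (b \<cdot> d))\<^esub>
        path_mor (b \<cdot> d) (wr [\<alpha>] c @ wl b [\<beta>])"
      unfolding square_def
        linear_maps_minus[OF P.L_module D pre_lift_linear[OF v] paths[THEN P.path_closed]]
        pre_lift_path[OF v paths(1)] pre_lift_path[OF v paths(2)] ..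
    also have "\<dots> = \<zero>\<^bsub>Hom D (ob (a \<cdot> c)) (ob (b \<cdot> d))\<^esub>"
      using path_mor_closed[OF paths(1)] unfolding path_mor_square[OF \<alpha> \<beta>]
      by (simp only: a_minus_def D.M.r_neg)
    finally show "on_mor pre_lift (a \<cdot> c) (b \<cdot> d) (square a b c d [\<alpha>] [\<beta>]) \<in>
        {\<zero>\<^bsub>Hom D (on_obj pre_lift (a \<cdot> c)) (on_obj pre_lift (b \<cdot> d))\<^esub>}"
      by simp
  qed
  then show ?thesis by simp
qed

definition lift :: "('v, (('v \<times> 'e \<times> 'v) list \<Rightarrow> 'k) set, 'o, 'm) cat_functor" where
  "lift = quot.quot_functor pre_lift"

lemma lift_obj [simp]: "on_obj lift = ob"
  by (simp add: lift_def)

lemma linear_functor_lift: "linear_functor R \<M> D lift"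
  unfolding linear_functor_free_linmoncat_iff lift_def
  by (rule quot.linear_functor_quot[OF D.linear_category_axioms linear_functor_pre_lift])
    (simp add: pre_lift_zero_on_I)

lemma lift_pcls: "path a p b \<Longrightarrow> on_mor lift a b (pcls a b p) = path_mor b p"
  using quot.quot_functor_cls[OF D.linear_category_axioms linear_functor_pre_lift] path_verts
  by (simp add: lift_def pre_lift_zero_on_I P.path_closed pre_lift_path)

text \<open>
  Both sides are bilinear, and on paths this is \<open>path_mor_square\<close>.
\<close>

lemma lift_mtens:
  assumes v: "a \<in> V" "b \<in> V" "c \<in> V" "d \<in> V" and f: "f \<in> mor \<M> a b" and g: "g \<in> mor \<M> c d"
  shows "on_mor lift (a \<cdot> c) (b \<cdot> d) (mtens \<M> a b c d f g) =
    mtens D (ob a) (ob b) (ob c) (ob d) (on_mor lift a b f) (on_mor lift c d g)"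
proof -
  note lift_lin = linear_functorD(2)[OF linear_functor_lift, unfolded lift_obj free_linmoncat_obj]
  have ob: "ob (a \<cdot> c) = ob a \<boxtimes> ob c" "ob (b \<cdot> d) = ob b \<boxtimes> ob d" using v by simp_all
  have N: "module R (Hom D (ob (a \<cdot> c)) (ob (b \<cdot> d)))"
    using v by (intro D.Hom_module) simp_all
  note lin_l = linear_maps_comp[OF _ lift_lin[of "a \<cdot> c" "b \<cdot> d"]]
  have 1: "on_mor lift (a \<cdot> c) (b \<cdot> d) (mtens \<M> a b c d (pcls a b p) g) =
      mtens D (ob a) (ob b) (ob c) (ob d) (on_mor lift a b (pcls a b p)) (on_mor lift c d g)"
    if p: "path a p b" for p
  proof (rule linear_eq_on_pcls[OF N _ _ _ v(3,4) g])
    show "(\<lambda>g. on_mor lift (a \<cdot> c) (b \<cdot> d) (mtens \<M> a b c d (pcls a b p) g))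
        \<in> linear_maps R (Hom \<M> c d) (Hom D (ob (a \<cdot> c)) (ob (b \<cdot> d)))"
      by (intro lin_l linear_mtens linear_maps_id pcls_closed p v V_monoid(2))
    show "(\<lambda>g. mtens D (ob a) (ob b) (ob c) (ob d) (on_mor lift a b (pcls a b p)) (on_mor lift c d g))
        \<in> linear_maps R (Hom \<M> c d) (Hom D (ob (a \<cdot> c)) (ob (b \<cdot> d)))"
      unfolding ob by (intro bilinear_map_linear[OF D.mtens_bilinear] linear_mapsD(1)[OF lift_lin]
          lift_lin pcls_closed p v ob_simps(1))
    show "on_mor lift (a \<cdot> c) (b \<cdot> d) (mtens \<M> a b c d (pcls a b p) (pcls c d q)) =
        mtens D (ob a) (ob b) (ob c) (ob d) (on_mor lift a b (pcls a b p)) (on_mor lift c d (pcls c d q))"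
      if q: "path c q d" for q
      by (simp add: mtens_pcls[OF p q] lift_pcls[OF path_path_tensor[OF p q]] lift_pcls[OF p] lift_pcls[OF q])
        (simp add: path_tensor_def path_mor_square[OF p q])
  qed
  show ?thesis
  proof (rule linear_eq_on_pcls[OF N _ _ _ v(1,2) f])
    show "(\<lambda>f. on_mor lift (a \<cdot> c) (b \<cdot> d) (mtens \<M> a b c d f g))
        \<in> linear_maps R (Hom \<M> a b) (Hom D (ob (a \<cdot> c)) (ob (b \<cdot> d)))"
      by (intro lin_l linear_mtens linear_maps_id g v V_monoid(2))
    show "(\<lambda>f. mtens D (ob a) (ob b) (ob c) (ob d) (on_mor lift a b f) (on_mor lift c d g))
        \<in> linear_maps R (Hom \<M> a b) (Hom D (ob (a \<cdot> c)) (ob (b \<cdot> d)))"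
      unfolding ob by (intro bilinear_map_linear[OF D.mtens_bilinear] linear_mapsD(1)[OF lift_lin]
          lift_lin g v ob_simps(1))
  qed (rule 1)
qed

lemma linear_monoidal_functor_lift: "linear_monoidal_functor R \<M> D lift"
  by (simp add: linear_monoidal_functor_def linear_functor_lift lift_mtens)

lemma arc_mor_edge: "e \<in> E \<Longrightarrow> arc_mor (\<epsilon>, e, \<epsilon>) = edge_mor e"
  by (simp add: D.mtens_unit_left D.mtens_unit_right edge_mor)

lemma lift_tau: "quiver_mor_eq Q (quiver_mor_comp (U_functor lift) (free_tau R Q)) \<phi>"
  unfolding quiver_mor_eq_def
proof (intro conjI ballI)
  fix e assume e: "e \<in> E"
  have "path_mor (head (quiver Q) e) [(\<epsilon>, e, \<epsilon>)] = edge_mor e"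
    using e arc_mor_edge[OF e] edge_mor(1)[OF e] by (simp add: D.cmp_ident_left del: arc_mor.simps)
  then show "on_arcs (quiver_mor_comp (U_functor lift) (free_tau R Q)) e = on_arcs \<phi> e"
    by (simp add: quiver_mor_comp_def U_functor_def free_tau_simps lift_pcls[OF path_edge[OF e]] edge_mor(2)[OF e])
qed (simp add: quiver_mor_comp_def U_functor_def free_tau_simps)

text \<open>
  The values of \<open>G\<close> on edges are prescribed, by \<open>pcls_arc\<close> those on arcs follow, by functoriality
  those on paths, and by linearity all others.
\<close>

lemma lift_unique:
  assumes G: "linear_monoidal_functor R \<M> D G"
    and \<tau>: "quiver_mor_eq Q (quiver_mor_comp (U_functor G) (free_tau R Q)) \<phi>"
  shows "functor_eq \<M> G lift"
proof -
  have G_lin: "linear_functor R \<M> D G" using G by (simp add: linear_monoidal_functor_def)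
  have G_obj: "on_obj G a = ob a" if "a \<in> V" for a
    using \<tau> that by (simp add: quiver_mor_eq_def quiver_mor_comp_def U_functor_def free_tau_simps)
  have G_edge: "on_mor G (tail (quiver Q) e) (head (quiver Q) e)
      (pcls (tail (quiver Q) e) (head (quiver Q) e) [(\<epsilon>, e, \<epsilon>)]) = edge_mor e" if "e \<in> E" for e
  proof -
    have "on_arcs (quiver_mor_comp (U_functor G) (free_tau R Q)) e = on_arcs \<phi> e"
      using \<tau> that by (simp add: quiver_mor_eq_def)
    then show ?thesis
      using edge_mor(2)[OF that] by (simp add: quiver_mor_comp_def U_functor_def free_tau_simps)
  qed
  have G_mtens: "on_mor G (a \<cdot> c) (b \<cdot> d) (mtens \<M> a b c d f g) =
      mtens D (ob a) (ob b) (ob c) (ob d) (on_mor G a b f) (on_mor G c d g)"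
    if "a \<in> V" "b \<in> V" "c \<in> V" "d \<in> V" "f \<in> mor \<M> a b" "g \<in> mor \<M> c d" for a b c d f g
    using G that by (simp add: linear_monoidal_functor_def G_obj)
  have G_ident: "on_mor G a a (ident \<M> a) = ident D (ob a)" if "a \<in> V" for a
    using linear_functorD(3)[OF G_lin] that by (simp add: G_obj)
  have G_arc: "on_mor G (tail (bar_quiver Q) \<alpha>) (head (bar_quiver Q) \<alpha>)
      (pcls (tail (bar_quiver Q) \<alpha>) (head (bar_quiver Q) \<alpha>) [\<alpha>]) = arc_mor \<alpha>"
    if \<alpha>_arc: "\<alpha> \<in> V \<times> E \<times> V" for \<alpha>
  proof -
    obtain v e w where \<alpha>: "\<alpha> = (v, e, w)" "v \<in> V" "e \<in> E" "w \<in> V" using \<alpha>_arc by auto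
    have id: "ident \<M> a \<in> mor \<M> a a" if "a \<in> V" for a using M.ident_closed that by simp
    note edge = pcls_closed[OF path_edge[OF \<alpha>(3)]]
    show ?thesis
      unfolding \<alpha>(1) bar_quiver_simps pcls_arc[OF \<alpha>(2-4) refl refl]
      using \<alpha> by (simp add: G_mtens G_ident G_edge id edge mtens_closed del: V_monoid(5))
  qed
  have G_path: "on_mor G a b (pcls a b p) = path_mor b p" if "path a p b" for a b p
    using that
  proof (induction p arbitrary: a)
    case Nil
    then show ?case using G_ident by (auto simp: free_linmoncat_simps(4))
  next
    case (Cons \<alpha> p)
    define m where "m = head (bar_quiver Q) \<alpha>"
    have \<alpha>: "\<alpha> \<in> V \<times> E \<times> V" "path a [\<alpha>] m" "a = tail (bar_quiver Q) \<alpha>" and p: "path m p b"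
      using Cons.prems path_verts by (auto simp: path_Cons m_def)
    note v = path_verts[OF \<alpha>(2)] path_verts[OF p]
    have "on_mor G a b (pcls a b (\<alpha> # p)) = on_mor G a b (cmp \<M> a m b (pcls m b p) (pcls a m [\<alpha>]))"
      using cmp_pcls[OF \<alpha>(2) p] by simp
    also have "\<dots> = cmp D (ob a) (ob m) (ob b) (on_mor G m b (pcls m b p)) (on_mor G a m (pcls a m [\<alpha>]))"
      using linear_functorD(4)[OF G_lin, of a m b] v pcls_closed[OF \<alpha>(2)] pcls_closed[OF p] by (simp add: G_obj)
    also have "\<dots> = path_mor b (\<alpha> # p)"
      using G_arc[OF \<alpha>(1)] Cons.IH[OF p] by (simp add: \<alpha>(3) m_def)
    finally show ?case .
  qed
  have "on_mor G a b f = on_mor lift a b f" if v: "a \<in> V" "b \<in> V" and f: "f \<in> mor \<M> a b" for a b f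
  proof (rule linear_eq_on_pcls[OF _ _ _ _ v f])
    show "module R (Hom D (ob a) (ob b))" using v by (intro D.Hom_module) simp_all
    show "on_mor G a b \<in> linear_maps R (Hom \<M> a b) (Hom D (ob a) (ob b))"
      using linear_functorD(2)[OF G_lin, of a b] v by (simp add: G_obj)
    show "on_mor lift a b \<in> linear_maps R (Hom \<M> a b) (Hom D (ob a) (ob b))"
      using linear_functorD(2)[OF linear_functor_lift, of a b] v by simp
  qed (simp add: G_path lift_pcls)
  then show ?thesis
    by (simp add: functor_eq_def G_obj)
qed

end

theorem theorem4p1:
  fixes R :: "('k, 'r) ring_scheme" and Q :: "('v, 'e) mon_quiver"
  assumes "cring R" and "mon_quiver Q"
  shows "linear_monoidal_category R (free_linmoncat R Q) \<and>
    mon_quiver_morphism Q (U_cat (free_linmoncat R Q)) (free_tau R Q) \<and>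
    (\<forall>(D :: ('k, 'o, 'm) linmoncat) (\<phi> :: ('v, 'e, 'o, 'o \<times> 'm \<times> 'o) quiver_mor).
       linear_monoidal_category R D \<and> mon_quiver_morphism Q (U_cat D) \<phi> \<longrightarrow>
       (\<exists>F. linear_monoidal_functor R (free_linmoncat R Q) D F \<and>
            quiver_mor_eq Q (quiver_mor_comp (U_functor F) (free_tau R Q)) \<phi> \<and>
            (\<forall>G. linear_monoidal_functor R (free_linmoncat R Q) D G \<and>
                 quiver_mor_eq Q (quiver_mor_comp (U_functor G) (free_tau R Q)) \<phi> \<longrightarrow>
                 functor_eq (free_linmoncat R Q) G F)))"
proof -
  interpret mon_quiver_construction R Q
    by (rule mon_quiver_construction.intro[OF assms])
  show ?thesis
  proof (intro conjI allI impI linear_monoidal_category_free_linmoncat mon_quiver_morphism_free_tau)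
    fix D :: "('k, 'o, 'm) linmoncat" and \<phi> :: "('v, 'e, 'o, 'o \<times> 'm \<times> 'o) quiver_mor"
    assume D: "linear_monoidal_category R D \<and> mon_quiver_morphism Q (U_cat D) \<phi>"
    interpret mon_quiver_representation R Q D \<phi>
      by (intro mon_quiver_representation.intro mon_quiver_construction_axioms
          mon_quiver_representation_axioms.intro) (use D in auto)
    show "\<exists>F. linear_monoidal_functor R (free_linmoncat R Q) D F \<and>
            quiver_mor_eq Q (quiver_mor_comp (U_functor F) (free_tau R Q)) \<phi> \<and>
            (\<forall>G. linear_monoidal_functor R (free_linmoncat R Q) D G \<and>
                 quiver_mor_eq Q (quiver_mor_comp (U_functor G) (free_tau R Q)) \<phi> \<longrightarrow>
                 functor_eq (free_linmoncat R Q) G F)"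
      using linear_monoidal_functor_lift lift_tau lift_unique by blast
  qed
qed

end
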